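(* Let $T$ be a complete first-order theory, let $\pi(x)$ be a partial type over $\emptyset$ in a tuple of variables $x$ of length $\lambda$, and let ${\mathfrak C}\prec{\mathfrak C}'$ be models of $T$ which are both $\aleph_0$-saturated and strongly $\aleph_0$-homogeneous. Put $X=\pi({\mathfrak C})$ and let $r\colon S_X({\mathfrak C}')\to S_X({\mathfrak C})$ be the restriction map. Let $F'$ be a closed, $\operatorname{Aut}({\mathfrak C}')$-invariant equivalence relation on $S_X({\mathfrak C}')$ and $F$ a closed, $\operatorname{Aut}({\mathfrak C})$-invariant equivalence relation on $S_X({\mathfrak C})$, and suppose that $F'$ and $F$ are compatible, i.e. $\{(r(a),r(b)) : (a,b)\in F'\}=F$. Then the Ellis group of the flow $(\operatorname{Aut}({\mathfrak C}'),S_X({\mathfrak C}')/F')$ is topologically isomorphic to the Ellis group of the flow $(\operatorname{Aut}({\mathfrak C}),S_X({\mathfrak C})/F)$, where both Ellis groups carry the $\tau$-topology.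
   Context: A model $M$ is $\kappa$-saturated if every complete type over a subset of $M$ of size $<\kappa$ is realized in $M$, and strongly $\kappa$-homogeneous if every partial elementary map between subsets of $M$ of size $<\kappa$ extends to an automorphism of $M$. For a model ${\mathfrak C}$, $S_X({\mathfrak C})$ is the (Stone) space of complete types over ${\mathfrak C}$ in the variables $x$ containing $\pi$; $\operatorname{Aut}({\mathfrak C})$ (with the pointwise convergence topology) acts on it by $\sigma(p)=\{\varphi(x,\sigma(a)):\varphi(x,a)\in p\}$, giving a flow. A $G$-flow is a topological group $G$ acting continuously on a compact Hausdorff space $Y$; for a closed $G$-invariant equivalence relation $\sim$ on $Y$, $Y/\!\sim$ is again a $G$-flow. The Ellis semigroup $E(Y)$ is the closure in $Y^Y$ (product topology) of $\{y\mapsto gy: g\in G\}$; it is a compact semigroup under composition. If $\mathcal{M}$ is a minimal left ideal of $E(Y)$ and $u\in\mathcal{M}$ is an idempotent, then $u\mathcal{M}$ is a group, the Ellis group. The $\tau$-topology on $u\mathcal{M}$: for $a\in E(Y)$ and $B\subseteq E(Y)$ let $a\circ B$ be the set of limits of convergent nets $(g_ib_i)$ with $g_i\in G$, $b_i\in B$ and $g_i\to a$ (identifying $g$ with $y\mapsto gy$); the closure operator $\operatorname{cl}_\tau(B)=u\mathcal{M}\cap(u\circ B)$ for $B\subseteq u\mathcal{M}$ defines the $\tau$-topology. The Ellis group with the $\tau$-topology is, up to topological isomorphism, independent of the choice of $\mathcal{M}$ and $u$. *)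

theory Defs
  imports "HOL-Analysis.Analysis" "HOL-Algebra.Bij"
begin

unbundle cardinal_syntax

section \<open>First-order logic\<close>

text \<open>
  Symbols come as sets rather than whole types, so that a language may lack function symbols or
  relation symbols.
\<close>

record ('f, 'p) lang =
  fsyms :: "'f set"
  psyms :: "'p set"
  farity :: "'f \<Rightarrow> nat"
  parity :: "'p \<Rightarrow> nat"

text \<open>
  There are two kinds of variables: \<open>BVar n\<close> is available for quantification, whereas an atom
  \<open>Atom v\<close> is never quantified and plays the role of a free variable or of a parameter, depending
  on \<open>'v\<close>. With \<open>'v = 'i + 'a\<close>, the atom \<open>Inl i\<close> is the variable \<open>x\<^sub>i\<close> of the tuple \<open>x\<close> and \<open>Inr a\<close>
  is the parameter \<open>a\<close>.
\<close>

datatype (dead 'f, tatoms: 'v) tm =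
    BVar nat
  | Atom 'v
  | Fn 'f "('f, 'v) tm list"
  for map: trename

datatype (dead 'f, dead 'p, atoms: 'v) fm =
    Eq "('f, 'v) tm" "('f, 'v) tm"
  | Rel 'p "('f, 'v) tm list"
  | Neg "('f, 'p, 'v) fm"
  | Conj "('f, 'p, 'v) fm" "('f, 'p, 'v) fm"
  | Ex nat "('f, 'p, 'v) fm"
  for map: rename

fun wf_tm :: "('f, 'p) lang \<Rightarrow> ('f, 'v) tm \<Rightarrow> bool" where
  "wf_tm L (BVar n) \<longleftrightarrow> True"
| "wf_tm L (Atom v) \<longleftrightarrow> True"
| "wf_tm L (Fn f ts) \<longleftrightarrow> f \<in> fsyms L \<and> length ts = farity L f \<and> (\<forall>t\<in>set ts. wf_tm L t)"

fun wf_fm :: "('f, 'p) lang \<Rightarrow> ('f, 'p, 'v) fm \<Rightarrow> bool" where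
  "wf_fm L (Eq s t) \<longleftrightarrow> wf_tm L s \<and> wf_tm L t"
| "wf_fm L (Rel P ts) \<longleftrightarrow> P \<in> psyms L \<and> length ts = parity L P \<and> (\<forall>t\<in>set ts. wf_tm L t)"
| "wf_fm L (Neg \<phi>) \<longleftrightarrow> wf_fm L \<phi>"
| "wf_fm L (Conj \<phi> \<psi>) \<longleftrightarrow> wf_fm L \<phi> \<and> wf_fm L \<psi>"
| "wf_fm L (Ex n \<phi>) \<longleftrightarrow> wf_fm L \<phi>"

fun bvars_tm :: "('f, 'v) tm \<Rightarrow> nat set" where
  "bvars_tm (BVar n) = {n}"
| "bvars_tm (Atom v) = {}"
| "bvars_tm (Fn f ts) = (\<Union>t\<in>set ts. bvars_tm t)"

text \<open>The indices \<open>n\<close> such that \<open>BVar n\<close> occurs outside the scope of a quantifier \<open>Ex n\<close>.\<close>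

fun unbound :: "('f, 'p, 'v) fm \<Rightarrow> nat set" where
  "unbound (Eq s t) = bvars_tm s \<union> bvars_tm t"
| "unbound (Rel P ts) = (\<Union>t\<in>set ts. bvars_tm t)"
| "unbound (Neg \<phi>) = unbound \<phi>"
| "unbound (Conj \<phi> \<psi>) = unbound \<phi> \<union> unbound \<psi>"
| "unbound (Ex n \<phi>) = unbound \<phi> - {n}"

text \<open>
  \<open>fmls L V\<close> is the set of \<open>L\<close>-formulas whose free variables and parameters all belong to \<open>V\<close>; in
  particular \<open>fmls L {}\<close> is the set of \<open>L\<close>-sentences.
\<close>

definition fmls :: "('f, 'p) lang \<Rightarrow> 'v set \<Rightarrow> ('f, 'p, 'v) fm set" where
  "fmls L V = {\<phi>. wf_fm L \<phi> \<and> unbound \<phi> = {} \<and> atoms \<phi> \<subseteq> V}"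

record ('f, 'p, 'a) struct =
  univ :: "'a set"
  fint :: "'f \<Rightarrow> 'a list \<Rightarrow> 'a"
  pint :: "'p \<Rightarrow> 'a list \<Rightarrow> bool"

definition tuples :: "('f, 'p, 'a) struct \<Rightarrow> nat \<Rightarrow> 'a list set" where
  "tuples M n = {xs. length xs = n \<and> set xs \<subseteq> univ M}"

definition is_struct :: "('f, 'p) lang \<Rightarrow> ('f, 'p, 'a) struct \<Rightarrow> bool" where
  "is_struct L M \<longleftrightarrow> univ M \<noteq> {} \<and>
     (\<forall>f\<in>fsyms L. \<forall>xs\<in>tuples M (farity L f). fint M f xs \<in> univ M)"

fun teval :: "('f, 'p, 'a) struct \<Rightarrow> ('v \<Rightarrow> 'a) \<Rightarrow> (nat \<Rightarrow> 'a) \<Rightarrow> ('f, 'v) tm \<Rightarrow> 'a" where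
  "teval M v e (BVar n) = e n"
| "teval M v e (Atom x) = v x"
| "teval M v e (Fn f ts) = fint M f (map (teval M v e) ts)"

fun sat :: "('f, 'p, 'a) struct \<Rightarrow> ('v \<Rightarrow> 'a) \<Rightarrow> (nat \<Rightarrow> 'a) \<Rightarrow> ('f, 'p, 'v) fm \<Rightarrow> bool" where
  "sat M v e (Eq s t) \<longleftrightarrow> teval M v e s = teval M v e t"
| "sat M v e (Rel P ts) \<longleftrightarrow> pint M P (map (teval M v e) ts)"
| "sat M v e (Neg \<phi>) \<longleftrightarrow> \<not> sat M v e \<phi>"
| "sat M v e (Conj \<phi> \<psi>) \<longleftrightarrow> sat M v e \<phi> \<and> sat M v e \<psi>"
| "sat M v e (Ex n \<phi>) \<longleftrightarrow> (\<exists>d\<in>univ M. sat M v (e(n := d)) \<phi>)"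

text \<open>
  Truth of a member of \<open>fmls L V\<close> under the assignment \<open>v\<close> of its atoms. The environment for the
  quantifiable variables is irrelevant, since none of them occurs unbound.
\<close>

definition holds :: "('f, 'p, 'a) struct \<Rightarrow> ('v \<Rightarrow> 'a) \<Rightarrow> ('f, 'p, 'v) fm \<Rightarrow> bool" where
  "holds M v \<phi> \<longleftrightarrow> sat M v (\<lambda>_. undefined) \<phi>"

definition is_model ::
  "('f, 'p) lang \<Rightarrow> ('f, 'p, unit) fm set \<Rightarrow> ('f, 'p, 'a) struct \<Rightarrow> bool" where
  "is_model L T M \<longleftrightarrow> is_struct L M \<and> (\<forall>\<phi>\<in>T. holds M (\<lambda>_. undefined) \<phi>)"

text \<open>
  Semantic consequence. By the downward Loewenheim--Skolem theorem it suffices to consider models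
  whose universe is a set of formulas: there are at least \<open>|L| + \<aleph>\<^sub>0\<close> many formulas.
\<close>

definition entails ::
  "('f, 'p) lang \<Rightarrow> ('f, 'p, unit) fm set \<Rightarrow> ('f, 'p, unit) fm \<Rightarrow> bool" where
  "entails L T \<phi> \<longleftrightarrow>
     (\<forall>N :: ('f, 'p, ('f, 'p, unit) fm) struct. is_model L T N \<longrightarrow> holds N (\<lambda>_. undefined) \<phi>)"

definition complete_theory :: "('f, 'p) lang \<Rightarrow> ('f, 'p, unit) fm set \<Rightarrow> bool" where
  "complete_theory L T \<longleftrightarrow> T \<subseteq> fmls L {} \<and>
     (\<exists>N :: ('f, 'p, ('f, 'p, unit) fm) struct. is_model L T N) \<and>
     (\<forall>\<phi>\<in>fmls L {}. entails L T \<phi> \<or> entails L T (Neg \<phi>))"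

definition elementary_substruct ::
  "('f, 'p) lang \<Rightarrow> ('f, 'p, 'a) struct \<Rightarrow> ('f, 'p, 'a) struct \<Rightarrow> bool" where
  "elementary_substruct L M N \<longleftrightarrow> univ M \<subseteq> univ N \<and>
     (\<forall>f\<in>fsyms L. \<forall>xs\<in>tuples M (farity L f). fint M f xs = fint N f xs) \<and>
     (\<forall>P\<in>psyms L. \<forall>xs\<in>tuples M (parity L P). pint M P xs \<longleftrightarrow> pint N P xs) \<and>
     (\<forall>\<phi>\<in>fmls L (univ M). holds M (\<lambda>a. a) \<phi> \<longleftrightarrow> holds N (\<lambda>a. a) \<phi>)"

definition Aut :: "('f, 'p) lang \<Rightarrow> ('f, 'p, 'a) struct \<Rightarrow> ('a \<Rightarrow> 'a) set" where
  "Aut L M = {\<sigma> \<in> Bij (univ M).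
     (\<forall>f\<in>fsyms L. \<forall>xs\<in>tuples M (farity L f). \<sigma> (fint M f xs) = fint M f (map \<sigma> xs)) \<and>
     (\<forall>P\<in>psyms L. \<forall>xs\<in>tuples M (parity L P). pint M P (map \<sigma> xs) \<longleftrightarrow> pint M P xs)}"

section \<open>Types, saturation and homogeneity\<close>

text \<open>Types in the tuple of variables \<open>(x\<^sub>i)\<close>, \<open>i \<in> I\<close>, over a set \<open>A\<close> of parameters from \<open>M\<close>.\<close>

definition partial_type ::
  "('f, 'p) lang \<Rightarrow> ('f, 'p, 'a) struct \<Rightarrow> 'i set \<Rightarrow> 'a set \<Rightarrow> ('f, 'p, 'i + 'a) fm set \<Rightarrow> bool" where
  "partial_type L M I A p \<longleftrightarrow> p \<subseteq> fmls L (I <+> A) \<and>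
     (\<forall>q. finite q \<and> q \<subseteq> p \<longrightarrow>
        (\<exists>c\<in>I \<rightarrow> univ M. \<forall>\<phi>\<in>q. holds M (case_sum c (\<lambda>a. a)) \<phi>))"

definition complete_type ::
  "('f, 'p) lang \<Rightarrow> ('f, 'p, 'a) struct \<Rightarrow> 'i set \<Rightarrow> 'a set \<Rightarrow> ('f, 'p, 'i + 'a) fm set \<Rightarrow> bool" where
  "complete_type L M I A p \<longleftrightarrow> partial_type L M I A p \<and>
     (\<forall>\<phi>\<in>fmls L (I <+> A). \<phi> \<in> p \<or> Neg \<phi> \<in> p)"

definition realized ::
  "('f, 'p, 'a) struct \<Rightarrow> 'i set \<Rightarrow> ('f, 'p, 'i + 'a) fm set \<Rightarrow> bool" where
  "realized M I p \<longleftrightarrow> (\<exists>c\<in>I \<rightarrow> univ M. \<forall>\<phi>\<in>p. holds M (case_sum c (\<lambda>a. a)) \<phi>)"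

text \<open>As usual, the types in the definition of saturation are types in finitely many variables.\<close>

definition saturated :: "'k rel \<Rightarrow> ('f, 'p) lang \<Rightarrow> ('f, 'p, 'a) struct \<Rightarrow> bool" where
  "saturated \<kappa> L M \<longleftrightarrow>
     (\<forall>(n::nat) A p. A \<subseteq> univ M \<and> |A| <o \<kappa> \<and> complete_type L M {..<n} A p
        \<longrightarrow> realized M {..<n} p)"

definition partial_elementary_map ::
  "('f, 'p) lang \<Rightarrow> ('f, 'p, 'a) struct \<Rightarrow> 'a set \<Rightarrow> ('a \<Rightarrow> 'a) \<Rightarrow> bool" where
  "partial_elementary_map L M A f \<longleftrightarrow> A \<subseteq> univ M \<and> f ` A \<subseteq> univ M \<and>
     (\<forall>\<phi>\<in>fmls L A. holds M (\<lambda>a. a) \<phi> \<longleftrightarrow> holds M f \<phi>)"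

definition strongly_homogeneous :: "'k rel \<Rightarrow> ('f, 'p) lang \<Rightarrow> ('f, 'p, 'a) struct \<Rightarrow> bool" where
  "strongly_homogeneous \<kappa> L M \<longleftrightarrow>
     (\<forall>A f. |A| <o \<kappa> \<and> partial_elementary_map L M A f \<longrightarrow> (\<exists>\<sigma>\<in>Aut L M. \<forall>a\<in>A. \<sigma> a = f a))"

section \<open>The type space as a flow\<close>

definition type_space ::
  "('f, 'p) lang \<Rightarrow> 'i set \<Rightarrow> ('f, 'p, 'i + 'a) fm set \<Rightarrow> ('f, 'p, 'a) struct
     \<Rightarrow> ('f, 'p, 'i + 'a) fm set set" where
  "type_space L I \<pi> M = {p. complete_type L M I (univ M) p \<and> \<pi> \<subseteq> p}"

definition stone_topology ::
  "('f, 'p) lang \<Rightarrow> 'i set \<Rightarrow> ('f, 'p, 'i + 'a) fm set \<Rightarrow> ('f, 'p, 'a) struct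
     \<Rightarrow> ('f, 'p, 'i + 'a) fm set topology" where
  "stone_topology L I \<pi> M = topology_generated_by
     ((\<lambda>\<phi>. {p \<in> type_space L I \<pi> M. \<phi> \<in> p}) ` fmls L (I <+> univ M))"

lemma topspace_stone_topology: "topspace (stone_topology L I \<pi> M) = type_space L I \<pi> M"
proof -
  let ?\<phi> = "Ex 0 (Eq (BVar 0) (BVar 0)) :: ('a, 'b, 'c + 'd) fm"
  have "?\<phi> \<in> fmls L (I <+> univ M)" and "Neg ?\<phi> \<in> fmls L (I <+> univ M)"
    by (auto simp: fmls_def)
  then have "\<exists>\<phi>\<in>fmls L (I <+> univ M). \<phi> \<in> p" if "p \<in> type_space L I \<pi> M" for p
    using that unfolding type_space_def complete_type_def by blast
  then show ?thesis
    unfolding stone_topology_def topology_generated_by_topspace by auto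
qed

definition type_act :: "('a \<Rightarrow> 'a) \<Rightarrow> ('f, 'p, 'i + 'a) fm set \<Rightarrow> ('f, 'p, 'i + 'a) fm set" where
  "type_act \<sigma> p = rename (map_sum (\<lambda>i. i) \<sigma>) ` p"

definition type_restrict ::
  "('f, 'p) lang \<Rightarrow> 'i set \<Rightarrow> ('f, 'p, 'a) struct \<Rightarrow> ('f, 'p, 'i + 'a) fm set
     \<Rightarrow> ('f, 'p, 'i + 'a) fm set" where
  "type_restrict L I M p = p \<inter> fmls L (I <+> univ M)"

definition closed_invariant_equiv ::
  "('f, 'p) lang \<Rightarrow> 'i set \<Rightarrow> ('f, 'p, 'i + 'a) fm set \<Rightarrow> ('f, 'p, 'a) struct
     \<Rightarrow> ('f, 'p, 'i + 'a) fm set rel \<Rightarrow> bool" where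
  "closed_invariant_equiv L I \<pi> M F \<longleftrightarrow>
     equiv (type_space L I \<pi> M) F \<and>
     closedin (prod_topology (stone_topology L I \<pi> M) (stone_topology L I \<pi> M)) F \<and>
     (\<forall>\<sigma>\<in>Aut L M. \<forall>(p, q)\<in>F. (type_act \<sigma> p, type_act \<sigma> q) \<in> F)"

definition quotient_topology :: "'y topology \<Rightarrow> 'y rel \<Rightarrow> 'y set topology" where
  "quotient_topology Y R = topology (\<lambda>U. U \<subseteq> topspace Y // R \<and>
     openin Y {y \<in> topspace Y. R `` {y} \<in> U})"

lemma openin_quotient_topology:
  "openin (quotient_topology Y R) U \<longleftrightarrow>
     U \<subseteq> topspace Y // R \<and> openin Y {y \<in> topspace Y. R `` {y} \<in> U}"
proof -
  have "istopology (\<lambda>U. U \<subseteq> topspace Y // R \<and> openin Y {y \<in> topspace Y. R `` {y} \<in> U})"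
    unfolding istopology_def
  proof (intro conjI allI impI)
    fix S T
    assume S: "S \<subseteq> topspace Y // R \<and> openin Y {y \<in> topspace Y. R `` {y} \<in> S}"
      and T: "T \<subseteq> topspace Y // R \<and> openin Y {y \<in> topspace Y. R `` {y} \<in> T}"
    show "S \<inter> T \<subseteq> topspace Y // R" using S by blast
    have "{y \<in> topspace Y. R `` {y} \<in> S \<inter> T} =
        {y \<in> topspace Y. R `` {y} \<in> S} \<inter> {y \<in> topspace Y. R `` {y} \<in> T}"
      by blast
    then show "openin Y {y \<in> topspace Y. R `` {y} \<in> S \<inter> T}"
      using S T by (simp only: openin_Int)
  next
    fix K
    assume K: "\<forall>S\<in>K. S \<subseteq> topspace Y // R \<and> openin Y {y \<in> topspace Y. R `` {y} \<in> S}"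
    show "\<Union>K \<subseteq> topspace Y // R" using K by blast
    have "{y \<in> topspace Y. R `` {y} \<in> \<Union>K} =
        (\<Union>S\<in>K. {y \<in> topspace Y. R `` {y} \<in> S})"
      by blast
    then show "openin Y {y \<in> topspace Y. R `` {y} \<in> \<Union>K}"
      using K by auto
  qed
  then show ?thesis
    by (simp add: quotient_topology_def)
qed

lemma topspace_quotient_topology: "topspace (quotient_topology Y R) = topspace Y // R"
proof
  show "topspace (quotient_topology Y R) \<subseteq> topspace Y // R"
    by (metis openin_quotient_topology openin_topspace)
  have "{y \<in> topspace Y. R `` {y} \<in> topspace Y // R} = topspace Y"
    by (auto intro: quotientI)
  then have "openin (quotient_topology Y R) (topspace Y // R)"
    by (simp add: openin_quotient_topology)
  then show "topspace Y // R \<subseteq> topspace (quotient_topology Y R)"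
    by (rule openin_subset)
qed

text \<open>
  The data of a flow. The topology of the acting group is not recorded: the Ellis group and its
  \<open>\<tau>\<close>-topology only depend on the maps by which the group elements act.
\<close>

record ('g, 'y) flow =
  flow_group :: "'g set"
  flow_space :: "'y topology"
  flow_act :: "'g \<Rightarrow> 'y \<Rightarrow> 'y"

text \<open>An automorphism maps the class of \<open>p\<close> to the class of \<open>\<sigma>(p)\<close>, which is the image of the former.\<close>

definition type_flow ::
  "('f, 'p) lang \<Rightarrow> 'i set \<Rightarrow> ('f, 'p, 'i + 'a) fm set \<Rightarrow> ('f, 'p, 'a) struct
     \<Rightarrow> ('f, 'p, 'i + 'a) fm set rel \<Rightarrow> ('a \<Rightarrow> 'a, ('f, 'p, 'i + 'a) fm set set) flow" where
  "type_flow L I \<pi> M F =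
     \<lparr>flow_group = Aut L M,
      flow_space = quotient_topology (stone_topology L I \<pi> M) F,
      flow_act = (\<lambda>\<sigma> c. type_act \<sigma> ` c)\<rparr>"

section \<open>The Ellis group with the \<open>\<tau>\<close>-topology\<close>

definition flow_carrier :: "('g, 'y) flow \<Rightarrow> 'y set" where
  "flow_carrier \<Phi> = topspace (flow_space \<Phi>)"

definition self_maps :: "('g, 'y) flow \<Rightarrow> ('y \<Rightarrow> 'y) topology" where
  "self_maps \<Phi> = product_topology (\<lambda>_. flow_space \<Phi>) (flow_carrier \<Phi>)"

definition flow_maps :: "('g, 'y) flow \<Rightarrow> ('y \<Rightarrow> 'y) set" where
  "flow_maps \<Phi> = (\<lambda>g. restrict (flow_act \<Phi> g) (flow_carrier \<Phi>)) ` flow_group \<Phi>"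

definition ellis_semigroup :: "('g, 'y) flow \<Rightarrow> ('y \<Rightarrow> 'y) set" where
  "ellis_semigroup \<Phi> = self_maps \<Phi> closure_of flow_maps \<Phi>"

definition ellis_mult :: "('g, 'y) flow \<Rightarrow> ('y \<Rightarrow> 'y) \<Rightarrow> ('y \<Rightarrow> 'y) \<Rightarrow> ('y \<Rightarrow> 'y)" where
  "ellis_mult \<Phi> = compose (flow_carrier \<Phi>)"

definition left_ideal :: "('g, 'y) flow \<Rightarrow> ('y \<Rightarrow> 'y) set \<Rightarrow> bool" where
  "left_ideal \<Phi> \<M> \<longleftrightarrow> \<M> \<noteq> {} \<and> \<M> \<subseteq> ellis_semigroup \<Phi> \<and>
     (\<forall>a\<in>ellis_semigroup \<Phi>. \<forall>m\<in>\<M>. ellis_mult \<Phi> a m \<in> \<M>)"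

definition minimal_left_ideal :: "('g, 'y) flow \<Rightarrow> ('y \<Rightarrow> 'y) set \<Rightarrow> bool" where
  "minimal_left_ideal \<Phi> \<M> \<longleftrightarrow> left_ideal \<Phi> \<M> \<and> (\<forall>\<N>. left_ideal \<Phi> \<N> \<and> \<N> \<subseteq> \<M> \<longrightarrow> \<N> = \<M>)"

definition ellis_group :: "('g, 'y) flow \<Rightarrow> ('y \<Rightarrow> 'y) set \<Rightarrow> ('y \<Rightarrow> 'y) \<Rightarrow> ('y \<Rightarrow> 'y) monoid" where
  "ellis_group \<Phi> \<M> u = \<lparr>carrier = ellis_mult \<Phi> u ` \<M>, mult = ellis_mult \<Phi>, one = u\<rparr>"

text \<open>
  The set \<open>a \<circ> B\<close> of limits of convergent nets \<open>(g\<^sub>i b\<^sub>i)\<close> with \<open>g\<^sub>i \<rightarrow> a\<close>. Convergence of nets is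
  expressed by filters; replacing the index filter of a net by its image under \<open>i \<mapsto> (g\<^sub>i, b\<^sub>i)\<close>, one
  may take the pairs \<open>(g, b)\<close> themselves as indices.
\<close>

definition ellis_circ ::
  "('g, 'y) flow \<Rightarrow> ('y \<Rightarrow> 'y) \<Rightarrow> ('y \<Rightarrow> 'y) set \<Rightarrow> ('y \<Rightarrow> 'y) set" where
  "ellis_circ \<Phi> a B = {c. \<exists>\<F> :: (('y \<Rightarrow> 'y) \<times> ('y \<Rightarrow> 'y)) filter.
     \<F> \<noteq> bot \<and> (\<forall>\<^sub>F (g, b) in \<F>. g \<in> flow_maps \<Phi> \<and> b \<in> B) \<and>
     limitin (self_maps \<Phi>) (\<lambda>(g, b). g) a \<F> \<and>
     limitin (self_maps \<Phi>) (\<lambda>(g, b). ellis_mult \<Phi> g b) c \<F>}"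

definition tau_closure ::
  "('g, 'y) flow \<Rightarrow> ('y \<Rightarrow> 'y) set \<Rightarrow> ('y \<Rightarrow> 'y) \<Rightarrow> ('y \<Rightarrow> 'y) set \<Rightarrow> ('y \<Rightarrow> 'y) set" where
  "tau_closure \<Phi> \<M> u B = carrier (ellis_group \<Phi> \<M> u) \<inter> ellis_circ \<Phi> u B"

definition tau_topology ::
  "('g, 'y) flow \<Rightarrow> ('y \<Rightarrow> 'y) set \<Rightarrow> ('y \<Rightarrow> 'y) \<Rightarrow> ('y \<Rightarrow> 'y) topology" where
  "tau_topology \<Phi> \<M> u = topology (\<lambda>U. U \<subseteq> carrier (ellis_group \<Phi> \<M> u) \<and>
     tau_closure \<Phi> \<M> u (carrier (ellis_group \<Phi> \<M> u) - U) = carrier (ellis_group \<Phi> \<M> u) - U)"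

lemma ellis_circ_mono: "A \<subseteq> B \<Longrightarrow> ellis_circ \<Phi> a A \<subseteq> ellis_circ \<Phi> a B"
  unfolding ellis_circ_def
  by (rule Collect_mono, intro impI, elim exE conjE, rule exI, intro conjI, assumption,
      erule eventually_mono, auto)

lemma ellis_circ_empty: "ellis_circ \<Phi> a {} = {}"
  by (auto simp: ellis_circ_def case_prod_unfold trivial_limit_def)

lemma ellis_circ_Un: "ellis_circ \<Phi> a (A \<union> B) = ellis_circ \<Phi> a A \<union> ellis_circ \<Phi> a B"
proof
  show "ellis_circ \<Phi> a A \<union> ellis_circ \<Phi> a B \<subseteq> ellis_circ \<Phi> a (A \<union> B)"
    by (simp add: ellis_circ_mono)
  show "ellis_circ \<Phi> a (A \<union> B) \<subseteq> ellis_circ \<Phi> a A \<union> ellis_circ \<Phi> a B"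
  proof
    fix c assume "c \<in> ellis_circ \<Phi> a (A \<union> B)"
    then obtain \<F> where ne: "\<F> \<noteq> bot"
      and ev: "\<forall>\<^sub>F (g, b) in \<F>. g \<in> flow_maps \<Phi> \<and> b \<in> A \<union> B"
      and la: "limitin (self_maps \<Phi>) (\<lambda>(g, b). g) a \<F>"
      and lc: "limitin (self_maps \<Phi>) (\<lambda>(g, b). ellis_mult \<Phi> g b) c \<F>"
      unfolding ellis_circ_def by blast
    have sub: "c \<in> ellis_circ \<Phi> a D"
      if "inf \<F> (principal {x. snd x \<in> D}) \<noteq> bot" for D
      unfolding ellis_circ_def mem_Collect_eq
    proof (intro exI conjI)
      let ?G = "inf \<F> (principal {x. snd x \<in> D})"
      show "?G \<noteq> bot" by fact
      show "\<forall>\<^sub>F (g, b) in ?G. g \<in> flow_maps \<Phi> \<and> b \<in> D"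
        unfolding eventually_inf_principal using ev by (auto elim: eventually_mono)
      show "limitin (self_maps \<Phi>) (\<lambda>(g, b). g) a ?G"
        using la by (auto simp: limitin_def intro: filter_leD[OF inf_le1])
      show "limitin (self_maps \<Phi>) (\<lambda>(g, b). ellis_mult \<Phi> g b) c ?G"
        using lc by (auto simp: limitin_def intro: filter_leD[OF inf_le1])
    qed
    show "c \<in> ellis_circ \<Phi> a A \<union> ellis_circ \<Phi> a B"
    proof (rule ccontr)
      assume "c \<notin> ellis_circ \<Phi> a A \<union> ellis_circ \<Phi> a B"
      then have "inf \<F> (principal {x. snd x \<in> A}) = bot" "inf \<F> (principal {x. snd x \<in> B}) = bot"
        using sub by blast+
      then have "\<forall>\<^sub>F x in \<F>. snd x \<notin> A" "\<forall>\<^sub>F x in \<F>. snd x \<notin> B"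
        by (simp_all add: trivial_limit_def eventually_inf_principal)
      with ev have "\<forall>\<^sub>F x in \<F>. False"
        by eventually_elim auto
      with ne show False
        by (simp add: trivial_limit_def)
    qed
  qed
qed

lemma ellis_circ_mult:
  assumes a: "a \<in> ellis_semigroup \<Phi>" and b: "b \<in> ellis_semigroup \<Phi>" "b \<in> B"
  shows "ellis_mult \<Phi> a b \<in> ellis_circ \<Phi> a B"
proof -
  let ?X = "self_maps \<Phi>" and ?Y = "flow_carrier \<Phi>"
  define \<N> where "\<N> = inf (nhdsin ?X a) (principal (flow_maps \<Phi>))"
  define \<F> where "\<F> = filtermap (\<lambda>g. (g, b)) \<N>"
  have top: "topspace ?X = ?Y \<rightarrow>\<^sub>E ?Y"
    by (simp add: self_maps_def flow_carrier_def)
  have aX: "a \<in> topspace ?X" and bX: "b \<in> topspace ?X"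
    using a b by (auto simp: ellis_semigroup_def in_closure_of)
  have N: "\<N> \<noteq> bot"
  proof
    assume "\<N> = bot"
    then have "\<forall>\<^sub>F g in nhdsin ?X a. g \<notin> flow_maps \<Phi>"
      by (simp add: \<N>_def trivial_limit_def eventually_inf_principal)
    then obtain S where "openin ?X S" "a \<in> S" "\<forall>g\<in>S. g \<notin> flow_maps \<Phi>"
      using aX by (auto simp: eventually_nhdsin)
    then show False
      using a by (auto simp: ellis_semigroup_def in_closure_of)
  qed
  have lim: "limitin ?X (\<lambda>g. g) a \<N>"
    unfolding limitin_def \<N>_def
    using aX by (auto simp: eventually_inf_principal eventually_nhdsin)
  have evX: "\<forall>\<^sub>F g in \<N>. g \<in> topspace ?X"
    using lim aX by (simp add: limitin_def)
  have lim': "limitin ?X (\<lambda>g. ellis_mult \<Phi> g b) (ellis_mult \<Phi> a b) \<N>"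
    unfolding self_maps_def limitin_componentwise
  proof (intro conjI ballI)
    show "ellis_mult \<Phi> a b \<in> extensional ?Y"
      by (simp add: ellis_mult_def)
    show "\<forall>\<^sub>F g in \<N>. ellis_mult \<Phi> g b \<in> topspace (product_topology (\<lambda>_. flow_space \<Phi>) ?Y)"
      using evX
    proof eventually_elim
      case (elim g)
      then have "ellis_mult \<Phi> g b \<in> ?Y \<rightarrow>\<^sub>E ?Y"
        using bX unfolding top ellis_mult_def by (auto simp: compose_def)
      then show ?case
        by (simp add: flow_carrier_def)
    qed
  next
    fix y assume y: "y \<in> ?Y"
    then have "b y \<in> ?Y"
      using bX top by auto
    then have "limitin (flow_space \<Phi>) (\<lambda>g. g (b y)) (a (b y)) \<N>"
      using lim unfolding self_maps_def limitin_componentwise by blast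
    then show "limitin (flow_space \<Phi>) (\<lambda>g. ellis_mult \<Phi> g b y) (ellis_mult \<Phi> a b y) \<N>"
      using y by (simp add: ellis_mult_def compose_def)
  qed
  show ?thesis
    unfolding ellis_circ_def mem_Collect_eq
  proof (intro exI conjI)
    show "\<F> \<noteq> bot"
      using N by (simp add: \<F>_def filtermap_bot_iff)
    show "\<forall>\<^sub>F (g, b) in \<F>. g \<in> flow_maps \<Phi> \<and> b \<in> B"
      using b by (simp add: \<F>_def \<N>_def eventually_filtermap eventually_inf_principal)
    show "limitin ?X (\<lambda>(g, b). g) a \<F>"
      using lim by (simp add: \<F>_def limitin_def eventually_filtermap)
    show "limitin ?X (\<lambda>(g, b). ellis_mult \<Phi> g b) (ellis_mult \<Phi> a b) \<F>"
      using lim' by (simp add: \<F>_def limitin_def eventually_filtermap)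
  qed
qed

lemma tau_closure_extensive:
  assumes M: "left_ideal \<Phi> \<M>" and u: "u \<in> \<M>" "ellis_mult \<Phi> u u = u"
    and B: "B \<subseteq> carrier (ellis_group \<Phi> \<M> u)"
  shows "B \<subseteq> tau_closure \<Phi> \<M> u B"
proof
  fix b assume b: "b \<in> B"
  with B obtain m where m: "m \<in> \<M>" "b = ellis_mult \<Phi> u m"
    by (auto simp: ellis_group_def)
  have E: "u \<in> ellis_semigroup \<Phi>" "m \<in> ellis_semigroup \<Phi>" "b \<in> ellis_semigroup \<Phi>"
    using M u m unfolding left_ideal_def by blast+
  then have "m \<in> flow_carrier \<Phi> \<rightarrow> flow_carrier \<Phi>"
    using closure_of_subset_topspace[of "self_maps \<Phi>" "flow_maps \<Phi>"]
    by (auto simp: ellis_semigroup_def self_maps_def flow_carrier_def)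
  then have "ellis_mult \<Phi> u b = ellis_mult \<Phi> (ellis_mult \<Phi> u u) m"
    unfolding m ellis_mult_def by (rule compose_assoc)
  then have "ellis_mult \<Phi> u b = b"
    using u m by simp
  then show "b \<in> tau_closure \<Phi> \<M> u B"
    using ellis_circ_mult[OF E(1,3) b] B b by (auto simp: tau_closure_def)
qed

lemma openin_tau_topology:
  assumes "left_ideal \<Phi> \<M>" "u \<in> \<M>" "ellis_mult \<Phi> u u = u"
  shows "openin (tau_topology \<Phi> \<M> u) U \<longleftrightarrow> U \<subseteq> carrier (ellis_group \<Phi> \<M> u) \<and>
     tau_closure \<Phi> \<M> u (carrier (ellis_group \<Phi> \<M> u) - U) = carrier (ellis_group \<Phi> \<M> u) - U"
proof -
  let ?G = "carrier (ellis_group \<Phi> \<M> u)" and ?cl = "tau_closure \<Phi> \<M> u"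
  have ext: "B \<subseteq> ?cl B" if "B \<subseteq> ?G" for B
    using tau_closure_extensive[OF assms that] .
  have mono: "?cl A \<subseteq> ?cl B" if "A \<subseteq> B" for A B
    using ellis_circ_mono[OF that, of \<Phi> u] by (auto simp: tau_closure_def)
  have "istopology (\<lambda>U. U \<subseteq> ?G \<and> ?cl (?G - U) = ?G - U)"
    unfolding istopology_def
  proof (intro conjI allI impI)
    fix S T assume S: "S \<subseteq> ?G \<and> ?cl (?G - S) = ?G - S" and T: "T \<subseteq> ?G \<and> ?cl (?G - T) = ?G - T"
    show "S \<inter> T \<subseteq> ?G" using S by blast
    have "?cl (?G - S \<inter> T) = ?cl (?G - S) \<union> ?cl (?G - T)"
      unfolding tau_closure_def Diff_Int ellis_circ_Un by blast
    then show "?cl (?G - S \<inter> T) = ?G - S \<inter> T"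
      using S T by (simp add: Diff_Int)
  next
    fix K assume K: "\<forall>S\<in>K. S \<subseteq> ?G \<and> ?cl (?G - S) = ?G - S"
    show "\<Union>K \<subseteq> ?G" using K by blast
    have "?cl (?G - \<Union>K) \<subseteq> ?G - S" if "S \<in> K" for S
      using mono[of "?G - \<Union>K" "?G - S"] K that by blast
    moreover have "?cl (?G - \<Union>K) \<subseteq> ?G"
      by (simp add: tau_closure_def)
    ultimately have "?cl (?G - \<Union>K) \<subseteq> ?G - \<Union>K"
      by blast
    then show "?cl (?G - \<Union>K) = ?G - \<Union>K"
      using ext[of "?G - \<Union>K"] by blast
  qed
  then show ?thesis
    by (simp add: tau_topology_def)
qed

lemma topspace_tau_topology:
  assumes "left_ideal \<Phi> \<M>" "u \<in> \<M>" "ellis_mult \<Phi> u u = u"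
  shows "topspace (tau_topology \<Phi> \<M> u) = carrier (ellis_group \<Phi> \<M> u)"
proof
  show "topspace (tau_topology \<Phi> \<M> u) \<subseteq> carrier (ellis_group \<Phi> \<M> u)"
    by (metis assms openin_tau_topology openin_topspace)
  have "openin (tau_topology \<Phi> \<M> u) (carrier (ellis_group \<Phi> \<M> u))"
    using assms by (simp add: openin_tau_topology) (simp add: tau_closure_def ellis_circ_empty)
  then show "carrier (ellis_group \<Phi> \<M> u) \<subseteq> topspace (tau_topology \<Phi> \<M> u)"
    by (rule openin_subset)
qed

end

theory Submission
  imports Defs
begin

text \<open>
  The proof only uses the closed invariant subsets of powers of the flows. Saturation and homogeneity
  yield automorphisms of \<open>C'\<close> that move any finite set into \<open>C\<close> while fixing a given finite
  subset of \<open>C\<close>, and make finite restrictions of automorphisms of \<open>C\<close> and of \<open>C'\<close> (when they stay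
  in \<open>C\<close>) interchangeable. Hence \<open>Z' \<mapsto> r(Z')\<close> is, for every index set \<open>A\<close>, an order isomorphism
  from the closed invariant subsets of \<open>S\<^sub>X(C')\<^sup>A\<close> onto those of \<open>S\<^sub>X(C)\<^sup>A\<close>, and compatibility of
  \<open>F'\<close> and \<open>F\<close> lets this isomorphism descend to the quotients.

  The Ellis group with its \<open>\<tau>\<close>-topology can be read off from these lattices: a minimal left ideal
  \<open>M\<close> is a minimal subset of a power of the flow, the minimal subsets of \<open>M \<times> M\<close> are the graphs of
  the right multiplications by elements \<open>b\<close> of \<open>u M\<close>, and \<open>c\<close> lies in the \<open>\<tau>\<close>-closure of \<open>B\<close> iff
  the graph of \<open>c\<close> lies in the closure of the union of the graphs of the \<open>b \<in> B\<close>.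
\<close>

section \<open>Closed invariant sets of tuples\<close>

text \<open>The obstacle is that \<open>r\<close> intertwines no group actions: an automorphism of
  \<open>C'\<close> need not preserve \<open>C\<close>, and one of \<open>C\<close> need not extend
  to \<open>C'\<close>. So \<open>r\<close> induces no homomorphism of Ellis semigroups. Index sets
  must be arbitrary because the two semigroups live in different powers: the image under
  \<open>r\<close> of an ideal in Y'^Y' lies in Y^Y', not in Y^Y. It is a minimal set there and is
  identified with \<open>M\<close> by evaluation at a base point \<open>z\<close>; the element
  \<open>m0\<close> corrects for the fact that \<open>r\<close> need not send \<open>u'\<close> to a
  point fixed by \<open>u\<close>. The cardinal aleph_0 suffices because a basic open set of types
  mentions finitely many parameters. In passing to quotients the difficulty is that images under
  \<open>r\<close> do not commute with intersections; an isomorphism of lattices nevertheless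
  preserves meets, and this lets equivalences of tuples be lifted.\<close>

definition closed_inv :: "'y topology \<Rightarrow> ('y \<Rightarrow> 'y) set \<Rightarrow> 'j set \<Rightarrow> ('j \<Rightarrow> 'y) set \<Rightarrow> bool" where
  "closed_inv Y H A Z \<longleftrightarrow> closedin (product_topology (\<lambda>_. Y) A) Z \<and>
     (\<forall>h\<in>H. \<forall>x\<in>Z. compose A h x \<in> Z)"

lemma closed_inv_closedin: "closed_inv Y H A Z \<Longrightarrow> closedin (product_topology (\<lambda>_. Y) A) Z"
  by (simp add: closed_inv_def)

lemma closed_inv_PiE: "closed_inv Y H A Z \<Longrightarrow> x \<in> Z \<Longrightarrow> x \<in> A \<rightarrow>\<^sub>E topspace Y"
  using closedin_subset by (fastforce simp: closed_inv_def)

lemma closed_inv_Int: "closed_inv Y H A Z1 \<Longrightarrow> closed_inv Y H A Z2 \<Longrightarrow> closed_inv Y H A (Z1 \<inter> Z2)"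
  by (simp add: closed_inv_def closedin_Int)

lemma compose_PiE: "x \<in> A \<rightarrow>\<^sub>E B \<Longrightarrow> g \<in> B \<rightarrow> C \<Longrightarrow> compose A g x \<in> A \<rightarrow>\<^sub>E C"
  by (auto simp: compose_def)

lemma compose_onto:
  assumes onto: "g ` B = C" and y: "y \<in> A \<rightarrow>\<^sub>E C"
  obtains x where "x \<in> A \<rightarrow>\<^sub>E B" "compose A g x = y"
proof
  let ?x = "\<lambda>i\<in>A. inv_into B g (y i)"
  show "?x \<in> A \<rightarrow>\<^sub>E B"
    using assms by (auto intro!: inv_into_into)
  have "g (inv_into B g (y i)) = y i" if "i \<in> A" for i
    using assms that by (intro f_inv_into_f) auto
  then show "compose A g ?x = y"
    using y by (auto simp: compose_def fun_eq_iff PiE_def extensional_def)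
qed

lemma compose_restrict: "x \<in> A \<rightarrow> B \<Longrightarrow> compose A (restrict g B) x = compose A g x"
  by (auto simp: compose_def fun_eq_iff)

lemma compose_compose:
  assumes "x \<in> A \<rightarrow>\<^sub>E B"
  shows "compose A h (compose A g x) = compose A (compose B h g) x"
  by (rule compose_assoc) (use assms in auto)

text \<open>Coding a pair of \<open>A\<close>-tuples as one tuple indexed by \<open>A <+> A\<close>
  makes relations between tuples closed invariant sets in a power again, so that the correspondence
  applies to them.\<close>

definition pairing :: "'j set \<Rightarrow> ('j \<Rightarrow> 'y) \<Rightarrow> ('j \<Rightarrow> 'y) \<Rightarrow> 'j + 'j \<Rightarrow> 'y" where
  "pairing A x y = restrict (case_sum x y) (A <+> A)"

lemma pairing_simps [simp]:
  "i \<in> A \<Longrightarrow> pairing A x y (Inl i) = x i" "i \<in> A \<Longrightarrow> pairing A x y (Inr i) = y i"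
  by (auto simp: pairing_def)

lemma compose_pairing: "compose (A <+> A) g (pairing A x y) = pairing A (compose A g x) (compose A g y)"
  by (auto simp: pairing_def compose_def fun_eq_iff split: sum.splits)

lemma pairing_PiE: "x \<in> A \<rightarrow>\<^sub>E B \<Longrightarrow> y \<in> A \<rightarrow>\<^sub>E B \<Longrightarrow> pairing A x y \<in> (A <+> A) \<rightarrow>\<^sub>E B"
  by (auto simp: pairing_def)

lemma pairing_eq_iff:
  assumes "x \<in> extensional A" "y \<in> extensional A" "x' \<in> extensional A" "y' \<in> extensional A"
  shows "pairing A x y = pairing A x' y' \<longleftrightarrow> x = x' \<and> y = y'"
proof
  assume eq: "pairing A x y = pairing A x' y'"
  have "x i = x' i" "y i = y' i" if "i \<in> A" for i
    using that fun_cong[OF eq, of "Inl i"] fun_cong[OF eq, of "Inr i"] by simp_all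
  then show "x = x' \<and> y = y'"
    using assms by (auto intro: extensionalityI)
qed simp

lemma pairing_cases:
  assumes "w \<in> (A <+> A) \<rightarrow>\<^sub>E B"
  obtains x y where "x \<in> A \<rightarrow>\<^sub>E B" "y \<in> A \<rightarrow>\<^sub>E B" "w = pairing A x y"
proof
  show "(\<lambda>i\<in>A. w (Inl i)) \<in> A \<rightarrow>\<^sub>E B" "(\<lambda>i\<in>A. w (Inr i)) \<in> A \<rightarrow>\<^sub>E B"
    using assms by auto
  have "w i = undefined" if "i \<notin> A <+> A" for i
    using assms that by (auto simp: PiE_def extensional_def)
  then show "w = pairing A (\<lambda>i\<in>A. w (Inl i)) (\<lambda>i\<in>A. w (Inr i))"
    by (auto simp: pairing_def fun_eq_iff split: sum.splits)
qed

lemma continuous_map_pairing: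
  assumes f: "continuous_map X (product_topology (\<lambda>_. Y) A) f"
    and g: "continuous_map X (product_topology (\<lambda>_. Y) A) g"
  shows "continuous_map X (product_topology (\<lambda>_. Y) (A <+> A)) (\<lambda>x. pairing A (f x) (g x))"
  unfolding continuous_map_componentwise
proof (intro conjI ballI)
  show "(\<lambda>x. pairing A (f x) (g x)) ` topspace X \<subseteq> extensional (A <+> A)"
    by (auto simp: pairing_def)
  fix k assume "k \<in> A <+> A"
  then show "continuous_map X Y (\<lambda>x. pairing A (f x) (g x) k)"
    using f g by (auto simp: continuous_map_componentwise)
qed

lemma continuous_map_left_part:
  "continuous_map (product_topology (\<lambda>_. Y) (A <+> A)) (product_topology (\<lambda>_. Y) A)
     (\<lambda>w. \<lambda>i\<in>A. w (Inl i))"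
  by (auto simp: continuous_map_componentwise intro: continuous_map_product_projection)

lemma continuous_map_right_part:
  "continuous_map (product_topology (\<lambda>_. Y) (A <+> A)) (product_topology (\<lambda>_. Y) A)
     (\<lambda>w. \<lambda>i\<in>A. w (Inr i))"
  by (auto simp: continuous_map_componentwise intro: continuous_map_product_projection)

lemma pairing_left_part [simp]: "x \<in> extensional A \<Longrightarrow> (\<lambda>i\<in>A. pairing A x y (Inl i)) = x"
  by (auto simp: fun_eq_iff extensional_def)

lemma pairing_right_part [simp]: "y \<in> extensional A \<Longrightarrow> (\<lambda>i\<in>A. pairing A x y (Inr i)) = y"
  by (auto simp: fun_eq_iff extensional_def)

lemma continuous_map_compose_left:
  assumes "continuous_map Y Y' g"
  shows "continuous_map (product_topology (\<lambda>_. Y) A) (product_topology (\<lambda>_. Y') A) (compose A g)"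
  unfolding continuous_map_componentwise
proof (intro conjI ballI)
  show "compose A g ` topspace (product_topology (\<lambda>_. Y) A) \<subseteq> extensional A"
    by auto
  fix i assume "i \<in> A"
  then show "continuous_map (product_topology (\<lambda>_. Y) A) Y' (\<lambda>x. compose A g x i)"
    using continuous_map_compose[OF continuous_map_product_projection[of i A "\<lambda>_. Y"] assms]
    by (simp add: compose_eq o_def)
qed

lemma continuous_map_compose_right:
  assumes "x \<in> A \<rightarrow> B"
  shows "continuous_map (product_topology (\<lambda>_. Y) B) (product_topology (\<lambda>_. Y) A) (\<lambda>e. compose A e x)"
  unfolding continuous_map_componentwise
  using assms by (auto simp: compose_eq intro: continuous_map_product_projection)

lemma closedin_compose_image:
  assumes "compact_space Y" "Hausdorff_space Q" "continuous_map Y Q g"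
    and W: "closedin (product_topology (\<lambda>_. Y) A) W"
  shows "closedin (product_topology (\<lambda>_. Q) A) (compose A g ` W)"
proof -
  have "compactin (product_topology (\<lambda>_. Y) A) W"
    using assms by (intro closedin_compact_space) (simp_all add: compact_space_product_topology)
  then have "compactin (product_topology (\<lambda>_. Q) A) (compose A g ` W)"
    using continuous_map_compose_left[OF assms(3)] by (rule image_compactin)
  then show ?thesis
    using assms by (intro compactin_imp_closedin) (simp_all add: Hausdorff_space_product_topology)
qed

lemma closed_inv_Times:
  assumes Z: "closed_inv Y H A Z1" "closed_inv Y H A Z2" and H: "H \<subseteq> topspace Y \<rightarrow> topspace Y"
  shows "closed_inv Y H (A <+> A) {pairing A x y |x y. x \<in> Z1 \<and> y \<in> Z2}" (is "closed_inv _ _ _ ?Z")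
proof -
  let ?P = "product_topology (\<lambda>_. Y) (A <+> A)"
  have eq: "?Z = {w \<in> topspace ?P. (\<lambda>i\<in>A. w (Inl i)) \<in> Z1} \<inter> {w \<in> topspace ?P. (\<lambda>i\<in>A. w (Inr i)) \<in> Z2}"
    (is "_ = ?R")
  proof
    show "?Z \<subseteq> ?R"
    proof
      fix w assume "w \<in> ?Z"
      then obtain x y where xy: "x \<in> Z1" "y \<in> Z2" "w = pairing A x y" by auto
      then have xyP: "x \<in> A \<rightarrow>\<^sub>E topspace Y" "y \<in> A \<rightarrow>\<^sub>E topspace Y"
        using closed_inv_PiE[OF Z(1)] closed_inv_PiE[OF Z(2)] by blast+
      then have "w \<in> topspace ?P"
        using xy by (simp add: pairing_PiE)
      then show "w \<in> ?R"
        using xy xyP by (simp add: PiE_def)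
    qed
    show "?R \<subseteq> ?Z"
    proof
      fix w assume w: "w \<in> ?R"
      then obtain x y where "x \<in> A \<rightarrow>\<^sub>E topspace Y" "y \<in> A \<rightarrow>\<^sub>E topspace Y" "w = pairing A x y"
        using pairing_cases[of w A "topspace Y"] by auto
      with w show "w \<in> ?Z"
        by (auto simp: PiE_def)
    qed
  qed
  have "closedin ?P ?Z"
    unfolding eq using Z
    by (intro closedin_Int closedin_continuous_map_preimage[OF continuous_map_left_part]
         closedin_continuous_map_preimage[OF continuous_map_right_part]) (auto simp: closed_inv_def)
  then show ?thesis
    using Z unfolding closed_inv_def by (fastforce simp: compose_pairing)
qed

section \<open>The Ellis semigroup and its minimal left ideals\<close>

text \<open>The action is recorded by its maps alone: \<open>H\<close> is a monoid of continuous
  self-maps, and the Ellis semigroup is its closure.\<close>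

locale compact_flow =
  fixes \<Phi> :: "('g, 'y) flow"
  assumes compact: "compact_space (flow_space \<Phi>)"
    and Hausdorff: "Hausdorff_space (flow_space \<Phi>)"
    and cont: "h \<in> flow_maps \<Phi> \<Longrightarrow> continuous_map (flow_space \<Phi>) (flow_space \<Phi>) h"
    and id_maps: "(\<lambda>y\<in>flow_carrier \<Phi>. y) \<in> flow_maps \<Phi>"
    and compose_maps:
      "g \<in> flow_maps \<Phi> \<Longrightarrow> h \<in> flow_maps \<Phi> \<Longrightarrow> compose (flow_carrier \<Phi>) g h \<in> flow_maps \<Phi>"
begin

abbreviation "Y \<equiv> flow_carrier \<Phi>"
abbreviation "H \<equiv> flow_maps \<Phi>"
abbreviation "E \<equiv> ellis_semigroup \<Phi>"
abbreviation "Ypow A \<equiv> product_topology (\<lambda>_. flow_space \<Phi>) A"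
abbreviation "cinv A \<equiv> closed_inv (flow_space \<Phi>) (flow_maps \<Phi>) A"

lemma topspace_power: "topspace (Ypow A) = A \<rightarrow>\<^sub>E Y"
  by (simp add: flow_carrier_def)

lemma compact_power: "compact_space (Ypow A)"
  using compact by (simp add: compact_space_product_topology)

lemma Hausdorff_power: "Hausdorff_space (Ypow A)"
  using Hausdorff by (simp add: Hausdorff_space_product_topology)

lemma maps_PiE: "H \<subseteq> Y \<rightarrow>\<^sub>E Y"
proof
  fix h assume h: "h \<in> H"
  then have "h \<in> Y \<rightarrow> Y"
    using continuous_map_funspace[OF cont[OF h]] by (simp add: flow_carrier_def)
  then show "h \<in> Y \<rightarrow>\<^sub>E Y"
    using h by (auto simp: flow_maps_def)
qed

lemma maps_funcset: "H \<subseteq> Y \<rightarrow> Y"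
  using maps_PiE by (auto simp: PiE_def)

lemma cinv_PiE: "cinv A Z \<Longrightarrow> x \<in> Z \<Longrightarrow> x \<in> A \<rightarrow>\<^sub>E Y"
  using closed_inv_PiE by (simp add: flow_carrier_def) blast

lemma cinv_closure:
  assumes "Z \<subseteq> A \<rightarrow>\<^sub>E Y" and inv: "\<And>h x. h \<in> H \<Longrightarrow> x \<in> Z \<Longrightarrow> compose A h x \<in> Z"
  shows "cinv A (Ypow A closure_of Z)"
  unfolding closed_inv_def
proof (intro conjI ballI)
  show "closedin (Ypow A) (Ypow A closure_of Z)" by simp
  fix h x assume h: "h \<in> H" and x: "x \<in> Ypow A closure_of Z"
  have "compose A h ` (Ypow A closure_of Z) \<subseteq> Ypow A closure_of (compose A h ` Z)"
    by (intro continuous_map_image_closure_subset continuous_map_compose_left cont h)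
  also have "\<dots> \<subseteq> Ypow A closure_of Z"
    using inv[OF h] by (intro closure_of_mono) auto
  finally show "compose A h x \<in> Ypow A closure_of Z"
    using x by blast
qed

lemma E_closure: "E = Ypow Y closure_of H"
  by (simp add: ellis_semigroup_def self_maps_def)

lemma E_cinv: "cinv Y E"
  unfolding E_closure by (rule cinv_closure) (use maps_PiE compose_maps in auto)

lemma E_PiE: "e \<in> E \<Longrightarrow> e \<in> Y \<rightarrow>\<^sub>E Y"
  using E_cinv cinv_PiE by blast

lemma E_fun: "e \<in> E \<Longrightarrow> e \<in> Y \<rightarrow> Y"
  using E_PiE by (auto simp: PiE_def)

lemma maps_in_E: "H \<subseteq> E"
  unfolding E_closure using maps_PiE by (intro closure_of_subset) (simp only: topspace_power)

lemma id_in_E: "(\<lambda>y\<in>Y. y) \<in> E"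
  using id_maps maps_in_E by blast

lemma compose_id: "x \<in> A \<rightarrow>\<^sub>E Y \<Longrightarrow> compose A (\<lambda>y\<in>Y. y) x = x"
  by (rule Id_compose) (auto simp: PiE_def)

lemma compose_EE: "x \<in> A \<rightarrow>\<^sub>E Y \<Longrightarrow> compose A e (compose A f x) = compose A (compose Y e f) x"
  by (rule compose_compose)

text \<open>Evaluation of \<open>e\<close> at \<open>x\<close> is continuous in \<open>e\<close> and
  maps \<open>H\<close> into the closed set \<open>Z\<close>, hence also the closure
  \<open>E\<close> of \<open>H\<close>.\<close>

lemma cinv_E:
  assumes Z: "cinv A Z" and e: "e \<in> E" and x: "x \<in> Z"
  shows "compose A e x \<in> Z"
proof -
  have xP: "x \<in> A \<rightarrow>\<^sub>E Y" by (rule cinv_PiE[OF Z x])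
  have "continuous_map (Ypow Y) (Ypow A) (\<lambda>e. compose A e x)"
    by (rule continuous_map_compose_right) (use xP in auto)
  then have "(\<lambda>e. compose A e x) ` (Ypow Y closure_of H) \<subseteq> Ypow A closure_of ((\<lambda>e. compose A e x) ` H)"
    by (rule continuous_map_image_closure_subset)
  also have "\<dots> \<subseteq> Z"
    using Z x by (intro closure_of_minimal) (auto simp: closed_inv_def)
  finally show ?thesis
    using e E_closure by blast
qed

lemma E_mult: "e \<in> E \<Longrightarrow> f \<in> E \<Longrightarrow> compose Y e f \<in> E"
  using cinv_E[OF E_cinv] .

text \<open>Evaluation at \<open>x\<close> is continuous and commutes with composition on the left;
  compactness of \<open>K\<close> makes the image closed.\<close>

lemma cinv_image:
  assumes K: "cinv Y K" and x: "x \<in> A \<rightarrow>\<^sub>E Y"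
  shows "cinv A ((\<lambda>e. compose A e x) ` K)"
  unfolding closed_inv_def
proof (intro conjI ballI)
  have "compactin (Ypow Y) K"
    using K compact_power closedin_compact_space closed_inv_closedin by blast
  moreover have "continuous_map (Ypow Y) (Ypow A) (\<lambda>e. compose A e x)"
    by (rule continuous_map_compose_right) (use x in auto)
  ultimately show "closedin (Ypow A) ((\<lambda>e. compose A e x) ` K)"
    using Hausdorff_power compactin_imp_closedin image_compactin by blast
  fix h w assume h: "h \<in> H" and "w \<in> (\<lambda>e. compose A e x) ` K"
  then obtain e where e: "e \<in> K" "w = compose A e x" by auto
  then have "compose A h w = compose A (compose Y h e) x"
    using x by (simp add: compose_EE)
  moreover have "compose Y h e \<in> K"
    using K h e by (auto simp: closed_inv_def)
  ultimately show "compose A h w \<in> (\<lambda>e. compose A e x) ` K"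
    by blast
qed

text \<open>The orbit closure of \<open>x\<close>, obtained as the image of the compact
  \<open>E\<close>; by \<open>orb_minimal\<close> it is the least closed invariant set containing
  \<open>x\<close>.\<close>

definition orb :: "'j set \<Rightarrow> ('j \<Rightarrow> 'y) \<Rightarrow> ('j \<Rightarrow> 'y) set" where
  "orb A x = (\<lambda>e. compose A e x) ` E"

lemma orb_cinv: "x \<in> A \<rightarrow>\<^sub>E Y \<Longrightarrow> cinv A (orb A x)"
  unfolding orb_def by (rule cinv_image[OF E_cinv])

lemma orb_self: "x \<in> A \<rightarrow>\<^sub>E Y \<Longrightarrow> x \<in> orb A x"
  unfolding orb_def using id_in_E compose_id by force

lemma orb_minimal: "cinv A Z \<Longrightarrow> x \<in> Z \<Longrightarrow> orb A x \<subseteq> Z"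
  unfolding orb_def using cinv_E by blast

lemma ellis_mult_eq: "ellis_mult \<Phi> = compose Y"
  by (simp add: ellis_mult_def)

end

section \<open>Minimal left ideals and the group inside them\<close>

locale ellis_ideal = compact_flow +
  fixes M u
  assumes minimal: "minimal_left_ideal \<Phi> M" and u_in: "u \<in> M" and idem: "compose Y u u = u"
begin

definition "G = compose Y u ` M"

lemma M_left_ideal: "left_ideal \<Phi> M"
  using minimal by (simp add: minimal_left_ideal_def)

lemma M_E: "m \<in> M \<Longrightarrow> m \<in> E"
  using M_left_ideal by (auto simp: left_ideal_def)

lemma M_mult: "e \<in> E \<Longrightarrow> m \<in> M \<Longrightarrow> compose Y e m \<in> M"
  using M_left_ideal by (auto simp: left_ideal_def ellis_mult_eq)

lemma u_E: "u \<in> E"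
  using u_in M_E by blast

lemma assoc: "x \<in> E \<Longrightarrow> compose Y e (compose Y f x) = compose Y (compose Y e f) x"
  by (rule compose_EE) (rule E_PiE)

lemma M_eq:
  assumes m: "m \<in> M"
  shows "(\<lambda>e. compose Y e m) ` E = M"
proof -
  have "left_ideal \<Phi> ((\<lambda>e. compose Y e m) ` E)"
    unfolding left_ideal_def ellis_mult_eq
    using id_in_E M_E[OF m] E_mult by (auto simp: assoc)
  moreover have "(\<lambda>e. compose Y e m) ` E \<subseteq> M"
    using m M_mult by auto
  ultimately show ?thesis
    using minimal by (auto simp: minimal_left_ideal_def)
qed

text \<open>Being \<open>E u\<close>, the ideal is a continuous image of a compact set, hence
  closed.\<close>

lemma M_cinv: "cinv Y M"
  using cinv_image[OF E_cinv, of u Y] M_eq[OF u_in] E_PiE[OF u_E] by simp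

lemma M_minimal:
  assumes "cinv Y Z" "Z \<subseteq> M" "Z \<noteq> {}"
  shows "Z = M"
proof -
  have "left_ideal \<Phi> Z"
    unfolding left_ideal_def ellis_mult_eq
    using assms cinv_E M_E by auto
  then show ?thesis
    using minimal assms by (auto simp: minimal_left_ideal_def)
qed

text \<open>Every element of \<open>M = E u\<close> ends in the idempotent \<open>u\<close>.\<close>

lemma M_u: "m \<in> M \<Longrightarrow> compose Y m u = m"
proof -
  assume "m \<in> M"
  then obtain e where "e \<in> E" "m = compose Y e u"
    using M_eq[OF u_in] by auto
  then show ?thesis
    using assoc[OF u_E, of e u] idem by simp
qed

lemma G_M: "g \<in> G \<Longrightarrow> g \<in> M"
  unfolding G_def using M_mult u_E by auto

lemma G_E: "g \<in> G \<Longrightarrow> g \<in> E"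
  using G_M M_E by blast

lemma u_G: "g \<in> G \<Longrightarrow> compose Y u g = g"
  unfolding G_def using idem by (auto simp: assoc M_E)

lemma G_iff: "g \<in> G \<longleftrightarrow> g \<in> M \<and> compose Y u g = g"
proof
  assume "g \<in> M \<and> compose Y u g = g"
  then show "g \<in> G"
    unfolding G_def by (intro image_eqI[of _ _ g]) simp_all
qed (simp add: G_M u_G)

lemma u_mult_G: "m \<in> M \<Longrightarrow> compose Y u m \<in> G"
  by (simp add: G_def)

lemma G_mult:
  assumes "g \<in> G" "k \<in> G"
  shows "compose Y g k \<in> G"
proof -
  have "compose Y u (compose Y g k) = compose Y g k"
    using assoc[OF G_E[OF assms(2)], of u g] u_G[OF assms(1)] by simp
  then show ?thesis
    using M_mult[OF G_E[OF assms(1)] G_M[OF assms(2)]] by (simp add: G_iff)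
qed

text \<open>Here \<open>m\<close> ranges over all of \<open>M\<close>, not just the group:
  \<open>E (u m) = M\<close> yields \<open>f\<close> with \<open>f u m = u\<close>, and
  \<open>u f u\<close> is a left inverse inside \<open>G\<close>.\<close>

lemma left_inverse:
  assumes "m \<in> M"
  obtains k where "k \<in> G" "compose Y k m = u"
proof -
  have um: "compose Y u m \<in> M" using M_mult[OF u_E assms] .
  have "u \<in> (\<lambda>e. compose Y e (compose Y u m)) ` E"
    unfolding M_eq[OF um] by (rule u_in)
  then obtain f where f: "f \<in> E" "compose Y f (compose Y u m) = u"
    by auto
  let ?l = "compose Y u (compose Y f u)"
  have l: "?l \<in> G"
    using f u_in by (intro u_mult_G M_mult)
  have "compose Y ?l m = compose Y u (compose Y f (compose Y u m))"
    by (simp add: assoc[OF M_E[OF assms]])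
  also have "\<dots> = u"
    using f idem by simp
  finally show ?thesis
    using that[OF l] by blast
qed

text \<open>An element \<open>k\<close> with \<open>k m = u\<close> undoes \<open>m\<close> on the
  points that \<open>u\<close> fixes.\<close>

lemma left_cancel:
  assumes m: "m \<in> M" and x: "x \<in> A \<rightarrow>\<^sub>E Y" and y: "y \<in> A \<rightarrow>\<^sub>E Y"
    and ux: "compose A u x = x" and uy: "compose A u y = y"
    and eq: "compose A m x = compose A m y"
  shows "x = y"
proof -
  obtain k where k: "k \<in> G" "compose Y k m = u" using left_inverse[OF m] .
  have "compose A k (compose A m x) = compose A k (compose A m y)"
    using eq by simp
  then show ?thesis
    using k ux uy x y by (simp add: compose_EE)
qed

text \<open>The usual group argument: a left inverse of the left inverse \<open>k\<close> of
  \<open>g\<close> must be \<open>g\<close> itself.\<close>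

lemma right_inverse:
  assumes "g \<in> G"
  obtains k where "k \<in> G" "compose Y g k = u"
proof -
  obtain k where k: "k \<in> G" "compose Y k g = u" using left_inverse[OF G_M[OF assms]] .
  obtain l where l: "l \<in> G" "compose Y l k = u" using left_inverse[OF G_M[OF k(1)]] .
  have "l = compose Y l (compose Y k g)"
    using k l M_u G_M by simp
  also have "\<dots> = g"
    using l u_G[OF assms] by (simp add: assoc[OF G_E[OF assms]])
  finally show ?thesis
    using that k l by blast
qed

text \<open>\<open>v\<close> need not be invertible, but \<open>u v u\<close> lies in the group, and
  \<open>m v u = m (u v u)\<close> because \<open>m = m u\<close>.\<close>

lemma right_cancel:
  assumes v: "v \<in> E" and m: "m \<in> M" "n \<in> M" and eq: "compose Y m v = compose Y n v"
  shows "m = n"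
proof -
  let ?g = "compose Y u (compose Y v u)"
  have "?g \<in> G"
    using v u_in by (intro u_mult_G M_mult)
  then obtain k where k: "k \<in> G" "compose Y ?g k = u"
    by (rule right_inverse)
  have "compose Y m' ?g = compose Y (compose Y m' v) u" if "m' \<in> M" for m'
    using that M_u u_E assoc[of "compose Y v u" m' u] assoc[of u m' v] E_mult[OF v u_E] by simp
  then have "compose Y m ?g = compose Y n ?g"
    using m eq by simp
  then have "compose Y m (compose Y ?g k) = compose Y n (compose Y ?g k)"
    by (simp add: assoc[OF G_E[OF k(1)]])
  then show ?thesis
    using k m M_u by simp
qed

lemma carrier_ellis: "carrier (ellis_group \<Phi> M u) = G"
  by (simp add: ellis_group_def G_def ellis_mult_eq)

end

section \<open>The circle operation and the tau-closure as closures in powers\<close>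

context compact_flow
begin

lemma translates_subset_topspace:
  assumes "B \<subseteq> E"
  shows "{(h, compose Y h b) |h b. h \<in> H \<and> b \<in> B} \<subseteq> topspace (prod_topology (Ypow Y) (Ypow Y))"
proof clarsimp
  fix h b assume h: "h \<in> H" and "b \<in> B"
  then have "h \<in> E" "b \<in> E"
    using assms maps_in_E by auto
  then show "h \<in> Y \<rightarrow>\<^sub>E topspace (flow_space \<Phi>) \<and> compose Y h b \<in> Y \<rightarrow>\<^sub>E topspace (flow_space \<Phi>)"
    using E_PiE E_mult by (simp add: flow_carrier_def)
qed

text \<open>Recording a net by the pairs \<open>(h, h b)\<close> merges its two limit conditions
  into one closure in a product, which replaces the filters from here on.\<close>

lemma ellis_circ_iff:
  assumes B: "B \<subseteq> E"
  shows "c \<in> ellis_circ \<Phi> a B \<longleftrightarrow>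
    (a, c) \<in> prod_topology (Ypow Y) (Ypow Y) closure_of {(h, compose Y h b) |h b. h \<in> H \<and> b \<in> B}"
    (is "_ \<longleftrightarrow> _ \<in> ?T closure_of ?P")
proof
  assume "c \<in> ellis_circ \<Phi> a B"
  then obtain \<F> :: "(('y \<Rightarrow> 'y) \<times> ('y \<Rightarrow> 'y)) filter" where ne: "\<F> \<noteq> bot"
    and ev: "\<forall>\<^sub>F (g, b) in \<F>. g \<in> H \<and> b \<in> B"
    and la: "limitin (Ypow Y) (\<lambda>(g, b). g) a \<F>"
    and lc: "limitin (Ypow Y) (\<lambda>(g, b). compose Y g b) c \<F>"
    unfolding ellis_circ_def self_maps_def ellis_mult_eq by blast
  have PT: "?P \<subseteq> topspace ?T"
    by (rule translates_subset_topspace[OF B])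
  have lim: "limitin ?T (\<lambda>(g, b). (g, compose Y g b)) (a, c) \<F>"
    using la lc by (simp add: limitin_pairwise o_def case_prod_unfold)
  have "\<forall>\<^sub>F x in \<F>. (\<lambda>(g, b). (g, compose Y g b)) x \<in> ?T closure_of ?P"
    using ev
  proof (rule eventually_mono)
    fix x :: "('y \<Rightarrow> 'y) \<times> ('y \<Rightarrow> 'y)"
    assume "case x of (g, b) \<Rightarrow> g \<in> H \<and> b \<in> B"
    then have "(\<lambda>(g, b). (g, compose Y g b)) x \<in> ?P" by auto
    then show "(\<lambda>(g, b). (g, compose Y g b)) x \<in> ?T closure_of ?P"
      using closure_of_subset[OF PT] by blast
  qed
  then show "(a, c) \<in> ?T closure_of ?P"
    using limitin_closedin[OF lim closedin_closure_of] ne by blast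
next
  assume ac: "(a, c) \<in> ?T closure_of ?P"
  \<comment> \<open>The trace on \<open>?P\<close> of the neighbourhood filter of
    \<open>(a, c)\<close>; it is proper because \<open>(a, c)\<close> lies in the closure.\<close>
  define \<N> where "\<N> = inf (nhdsin ?T (a, c)) (principal ?P)"
  have acT: "(a, c) \<in> topspace ?T"
    by (rule subsetD[OF closure_of_subset_topspace ac])
  have N: "\<N> \<noteq> bot"
  proof
    assume "\<N> = bot"
    then have "\<forall>\<^sub>F w in nhdsin ?T (a, c). w \<notin> ?P"
      by (simp add: \<N>_def trivial_limit_def eventually_inf_principal)
    then obtain S where "openin ?T S" "(a, c) \<in> S" "\<forall>w\<in>S. w \<notin> ?P"
      using acT unfolding eventually_nhdsin by auto
    then show False
      using ac unfolding in_closure_of by blast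
  qed
  have lim: "limitin ?T (\<lambda>w. w) (a, c) \<N>"
    unfolding limitin_def \<N>_def
    using acT by (auto simp: eventually_inf_principal eventually_nhdsin)
  \<comment> \<open>A pair in \<open>?P\<close> only shows the product \<open>h b\<close>;
    \<open>k\<close> chooses a factor \<open>b\<close>, since the filter in the definition lives on
    the pairs \<open>(h, b)\<close>.\<close>
  define k where "k w = (fst w, SOME b. b \<in> B \<and> compose Y (fst w) b = snd w)" for w :: "('y \<Rightarrow> 'y) \<times> ('y \<Rightarrow> 'y)"
  have k: "fst (k w) = fst w" "fst w \<in> H" "snd (k w) \<in> B" "compose Y (fst w) (snd (k w)) = snd w"
    if "w \<in> ?P" for w
  proof -
    have "\<exists>b. b \<in> B \<and> compose Y (fst w) b = snd w" using that by auto
    then have "snd (k w) \<in> B \<and> compose Y (fst w) (snd (k w)) = snd w"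
      unfolding k_def snd_conv by (rule someI_ex)
    then show "snd (k w) \<in> B" "compose Y (fst w) (snd (k w)) = snd w" by auto
    show "fst (k w) = fst w" "fst w \<in> H" using that by (auto simp: k_def)
  qed
  have evP: "\<forall>\<^sub>F w in \<N>. w \<in> ?P"
    by (simp add: \<N>_def eventually_inf_principal)
  have l: "limitin (Ypow Y) fst a \<N>" "limitin (Ypow Y) snd c \<N>"
    using lim by (simp_all add: limitin_pairwise o_def)
  show "c \<in> ellis_circ \<Phi> a B"
    unfolding ellis_circ_def mem_Collect_eq self_maps_def ellis_mult_eq
  proof (intro exI conjI)
    show "filtermap k \<N> \<noteq> bot"
      using N by (simp add: filtermap_bot_iff)
    show "\<forall>\<^sub>F (g, b) in filtermap k \<N>. g \<in> H \<and> b \<in> B"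
      unfolding eventually_filtermap
      using evP by (rule eventually_mono) (use k in \<open>auto simp: case_prod_unfold\<close>)
    have "limitin (Ypow Y) (\<lambda>w. fst (k w)) a \<N>"
      using l(1) by (simp add: k_def)
    then show "limitin (Ypow Y) (\<lambda>(g, b). g) a (filtermap k \<N>)"
      by (simp add: limitin_def eventually_filtermap case_prod_unfold)
    have "\<forall>\<^sub>F w in \<N>. snd w = compose Y (fst (k w)) (snd (k w))"
      using evP
    proof (rule eventually_mono)
      fix w assume "w \<in> ?P"
      from k[OF this] show "snd w = compose Y (fst (k w)) (snd (k w))" by simp
    qed
    from limitin_transform_eventually[OF this l(2)]
    have "limitin (Ypow Y) (\<lambda>w. compose Y (fst (k w)) (snd (k w))) c \<N>" .
    then show "limitin (Ypow Y) (\<lambda>(g, b). compose Y g b) c (filtermap k \<N>)"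
      by (simp add: limitin_def eventually_filtermap case_prod_unfold)
  qed
qed

end

context ellis_ideal
begin

text \<open>
  This describes the \<open>\<tau>\<close>-closure by closed invariant subsets alone: right multiplication by \<open>c\<close>
  belongs to the closure iff its graph lies in the closure of the union of the graphs.
\<close>

lemma tau_closure_iff:
  fixes A :: "'j set"
  assumes z: "z \<in> A \<rightarrow>\<^sub>E Y" and uz: "compose A u z = z"
    and inj: "\<And>m n. m \<in> M \<Longrightarrow> n \<in> M \<Longrightarrow> compose A m z = compose A n z \<Longrightarrow> m = n"
    and B: "B \<subseteq> G" and c: "c \<in> G"
  shows "c \<in> tau_closure \<Phi> M u B \<longleftrightarrow>
    (\<forall>V. cinv (A <+> A) V \<and> (\<forall>b\<in>B. pairing A z (compose A b z) \<in> V) \<longrightarrow> pairing A z (compose A c z) \<in> V)"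
proof -
  let ?T = "prod_topology (Ypow Y) (Ypow Y)"
  define P where "P = {(h, compose Y h b) |h b. h \<in> H \<and> b \<in> B}"
  define K where "K = ?T closure_of P"
  \<comment> \<open>\<open>K\<close> computes the circle operation inside the square of Y^Y;
    \<open>\<phi>\<close> evaluates both coordinates at \<open>z\<close> and so carries it into the
    power indexed by \<open>A <+> A\<close>.\<close>
  define \<phi> where "\<phi> w = pairing A (compose A (fst w) z) (compose A (snd w) z)" for w :: "('b \<Rightarrow> 'b) \<times> ('b \<Rightarrow> 'b)"
  have zF: "z \<in> A \<rightarrow> Y" using z by auto
  have BE: "B \<subseteq> E" using B G_E by blast
  have PT: "P \<subseteq> topspace ?T"
    unfolding P_def by (rule translates_subset_topspace[OF BE])
  have PK: "P \<subseteq> K"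
    unfolding K_def by (rule closure_of_subset[OF PT])
  have K_closed: "closedin ?T K" by (simp add: K_def)
  have K_sub: "K \<subseteq> E \<times> M"
    unfolding K_def
  proof (rule closure_of_minimal)
    show "P \<subseteq> E \<times> M"
      unfolding P_def using maps_in_E B G_M M_mult by blast
    show "closedin ?T (E \<times> M)"
      using E_cinv M_cinv by (simp add: closedin_prod_Times_iff closed_inv_def)
  qed
  have cont_eval: "continuous_map (Ypow Y) (Ypow A) (\<lambda>e. compose A e z)"
    by (rule continuous_map_compose_right[OF zF])
  have cont_\<phi>: "continuous_map ?T (Ypow (A <+> A)) \<phi>"
    unfolding \<phi>_def
    by (intro continuous_map_pairing continuous_map_compose[OF continuous_map_fst cont_eval, unfolded o_def]
          continuous_map_compose[OF continuous_map_snd cont_eval, unfolded o_def])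
  have step: "\<phi> (compose Y h e, compose Y h f) = compose (A <+> A) h (\<phi> (e, f))" for h e f
    using z by (simp add: \<phi>_def compose_pairing compose_EE)
  have K_inv: "(compose Y h e, compose Y h f) \<in> K" if h: "h \<in> H" and ef: "(e, f) \<in> K" for h e f
  proof -
    let ?g = "\<lambda>w. (compose Y h (fst w), compose Y h (snd w))"
    have ch: "continuous_map (Ypow Y) (Ypow Y) (compose Y h)"
      by (rule continuous_map_compose_left[OF cont[OF h]])
    have "continuous_map ?T ?T ?g"
      by (intro continuous_map_pairedI continuous_map_compose[OF continuous_map_fst ch, unfolded o_def]
          continuous_map_compose[OF continuous_map_snd ch, unfolded o_def])
    then have "?g ` K \<subseteq> ?T closure_of (?g ` P)"
      unfolding K_def by (rule continuous_map_image_closure_subset)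
    also have "\<dots> \<subseteq> K"
    proof -
      have "?g ` P \<subseteq> P"
      proof
        fix w assume "w \<in> ?g ` P"
        then obtain k b where "k \<in> H" "b \<in> B" "w = (compose Y h k, compose Y h (compose Y k b))"
          by (auto simp: P_def)
        then show "w \<in> P"
          unfolding P_def using assoc[of b h k] BE compose_maps[OF h] by blast
      qed
      then show ?thesis
        unfolding K_def by (rule closure_of_mono)
    qed
    finally show ?thesis using ef by force
  qed
  \<comment> \<open>As \<open>b = u b\<close>, the pair \<open>(h u, h b)\<close> is the limit of the pairs \<open>(h g, h g b)\<close> for \<open>g \<rightarrow> u\<close>.\<close>
  have K_u: "(compose Y e u, f) \<in> K" if ef: "(e, f) \<in> K" for e f
  proof -
    let ?g = "\<lambda>w. (compose Y (fst w) u, snd w)"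
    have "continuous_map (Ypow Y) (Ypow Y) (\<lambda>e. compose Y e u)"
      by (rule continuous_map_compose_right[OF E_fun[OF u_E]])
    from continuous_map_compose[OF continuous_map_fst this, unfolded o_def]
    have "continuous_map ?T ?T ?g"
      by (intro continuous_map_pairedI continuous_map_snd)
    then have "?g ` K \<subseteq> ?T closure_of (?g ` P)"
      unfolding K_def by (rule continuous_map_image_closure_subset)
    also have "\<dots> \<subseteq> K"
    proof (rule closure_of_minimal[OF _ K_closed])
      show "?g ` P \<subseteq> K"
      proof
        fix w assume "w \<in> ?g ` P"
        then obtain h b where hb: "h \<in> H" "b \<in> B" "w = (compose Y h u, compose Y h b)"
          by (auto simp: P_def)
        have bE: "b \<in> E" using hb BE by blast
        let ?k = "\<lambda>e. (compose Y h e, compose Y (compose Y h e) b)"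
        have c1: "continuous_map (Ypow Y) (Ypow Y) (compose Y h)"
          by (rule continuous_map_compose_left[OF cont[OF hb(1)]])
        have c2: "continuous_map (Ypow Y) (Ypow Y) (\<lambda>e. compose Y e b)"
          by (rule continuous_map_compose_right[OF E_fun[OF bE]])
        have "continuous_map (Ypow Y) ?T ?k"
          by (intro continuous_map_pairedI c1 continuous_map_compose[OF c1 c2, unfolded o_def])
        then have "?k ` E \<subseteq> ?T closure_of (?k ` H)"
          unfolding E_closure by (rule continuous_map_image_closure_subset)
        also have "\<dots> \<subseteq> K"
          unfolding K_def
          by (rule closure_of_mono) (use hb compose_maps in \<open>auto simp: P_def\<close>)
        finally have "?k u \<in> K" using u_E by blast
        moreover have "compose Y (compose Y h u) b = compose Y h b"
          using assoc[OF bE, of h u] u_G[of b] hb B by auto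
        ultimately show "w \<in> K" using hb by simp
      qed
    qed
    finally show ?thesis using ef by force
  qed
  have mem: "c \<in> tau_closure \<Phi> M u B \<longleftrightarrow> (u, c) \<in> K"
    using c ellis_circ_iff[OF BE, of c u]
    by (simp add: tau_closure_def carrier_ellis K_def P_def)
  show ?thesis
    unfolding mem
  proof (intro iffI allI impI)
    fix V assume uc: "(u, c) \<in> K" and V: "cinv (A <+> A) V \<and> (\<forall>b\<in>B. pairing A z (compose A b z) \<in> V)"
    have "\<phi> ` K \<subseteq> Ypow (A <+> A) closure_of (\<phi> ` P)"
      unfolding K_def by (rule continuous_map_image_closure_subset[OF cont_\<phi>])
    also have "\<dots> \<subseteq> V"
    proof (rule closure_of_minimal)
      show "closedin (Ypow (A <+> A)) V" using V by (simp add: closed_inv_def)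
      show "\<phi> ` P \<subseteq> V"
      proof
        fix w assume "w \<in> \<phi> ` P"
        then obtain h b where hb: "h \<in> H" "b \<in> B" "w = \<phi> (h, compose Y h b)"
          by (auto simp: P_def)
        then have "w = compose (A <+> A) h (pairing A z (compose A b z))"
          using z by (simp add: \<phi>_def compose_pairing compose_EE)
        then show "w \<in> V"
          using V hb by (auto simp: closed_inv_def)
      qed
    qed
    finally have "\<phi> (u, c) \<in> V" using uc by blast
    then show "pairing A z (compose A c z) \<in> V"
      by (simp add: \<phi>_def uz)
  next
    assume R: "\<forall>V. cinv (A <+> A) V \<and> (\<forall>b\<in>B. pairing A z (compose A b z) \<in> V) \<longrightarrow> pairing A z (compose A c z) \<in> V"
    \<comment> \<open>For the converse, the assumption is tested on the image of \<open>K\<close>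
      itself, which is closed because \<open>K\<close> is compact.\<close>
    have "cinv (A <+> A) (\<phi> ` K)"
      unfolding closed_inv_def
    proof (intro conjI ballI)
      have "compact_space ?T"
        using compact_power[of Y] by (simp add: compact_space_prod_topology)
      then have "compactin ?T K"
        using K_closed closedin_compact_space by blast
      then show "closedin (Ypow (A <+> A)) (\<phi> ` K)"
        using image_compactin[OF _ cont_\<phi>] compactin_imp_closedin[OF Hausdorff_power] by blast
      fix h w assume h: "h \<in> H" and "w \<in> \<phi> ` K"
      then obtain e f where ef: "(e, f) \<in> K" "w = \<phi> (e, f)" by auto
      then show "compose (A <+> A) h w \<in> \<phi> ` K"
        using K_inv[OF h ef(1)] step[of h e f] by (metis imageI)
    qed
    moreover have "pairing A z (compose A b z) \<in> \<phi> ` K" if b: "b \<in> B" for b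
    proof -
      have "(\<lambda>y\<in>Y. y, compose Y (\<lambda>y\<in>Y. y) b) \<in> K"
        using PK b id_maps by (auto simp: P_def)
      moreover have "compose Y (\<lambda>y\<in>Y. y) b = b"
        using b BE by (intro compose_id E_PiE) auto
      ultimately have "\<phi> (\<lambda>y\<in>Y. y, b) \<in> \<phi> ` K" by auto
      then show ?thesis
        using compose_id[OF z] by (simp add: \<phi>_def)
    qed
    ultimately have "pairing A z (compose A c z) \<in> \<phi> ` K"
      using R by blast
    then obtain e f where ef: "(e, f) \<in> K" "pairing A z (compose A c z) = \<phi> (e, f)" by auto
    then have e: "e \<in> E" and f: "f \<in> M" using K_sub by auto
    have "z \<in> extensional A" using z by (auto simp: PiE_def)
    then have ez: "compose A e z = z" and fz: "compose A f z = compose A c z"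
      using ef(2) by (auto simp: \<phi>_def pairing_eq_iff)
    have "f = c" by (rule inj[OF f G_M[OF c] fz])
    \<comment> \<open>\<open>e\<close> fixes \<open>z\<close> but need not equal \<open>u\<close>;
      injectivity only yields \<open>e u = u\<close>, and \<open>K_u\<close> then replaces
      \<open>e\<close> by \<open>e u\<close>.\<close>
    moreover have "compose Y e u = u"
    proof (rule inj[OF M_mult[OF e u_in] u_in])
      show "compose A (compose Y e u) z = compose A u z"
        using ez uz compose_EE[OF z, of e u] by simp
    qed
    ultimately show "(u, c) \<in> K"
      using K_u[OF ef(1)] by simp
  qed
qed

end

section \<open>Flows with the same closed invariant sets\<close>

text \<open>Images always preserve inclusion, so these clauses (well defined, onto, order
  reflecting) amount to an isomorphism of lattices.\<close>

definition flow_corresp ::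
  "'w topology \<Rightarrow> ('w \<Rightarrow> 'w) set \<Rightarrow> 'y topology \<Rightarrow> ('y \<Rightarrow> 'y) set \<Rightarrow> ('w \<Rightarrow> 'y) \<Rightarrow> 'j set \<Rightarrow> bool" where
  "flow_corresp Y' H' Y H r A \<longleftrightarrow>
     (\<forall>Z'. closed_inv Y' H' A Z' \<longrightarrow> closed_inv Y H A (compose A r ` Z')) \<and>
     (\<forall>Z. closed_inv Y H A Z \<longrightarrow> (\<exists>Z'. closed_inv Y' H' A Z' \<and> compose A r ` Z' = Z)) \<and>
     (\<forall>Z1 Z2. closed_inv Y' H' A Z1 \<longrightarrow> closed_inv Y' H' A Z2 \<longrightarrow>
        compose A r ` Z1 \<subseteq> compose A r ` Z2 \<longrightarrow> Z1 \<subseteq> Z2)"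

lemma
  assumes "flow_corresp Y' H' Y H r A"
  shows flow_corresp_image: "closed_inv Y' H' A Z' \<Longrightarrow> closed_inv Y H A (compose A r ` Z')"
    and flow_corresp_lift:
      "closed_inv Y H A Z \<Longrightarrow> \<exists>Z'. closed_inv Y' H' A Z' \<and> compose A r ` Z' = Z"
    and flow_corresp_subset:
      "closed_inv Y' H' A Z1 \<Longrightarrow> closed_inv Y' H' A Z2 \<Longrightarrow>
        compose A r ` Z1 \<subseteq> compose A r ` Z2 \<Longrightarrow> Z1 \<subseteq> Z2"
  using assms unfolding flow_corresp_def by simp_all

context ellis_ideal
begin

text \<open>A point fixed by \<open>u\<close> has a minimal orbit closure: from
  \<open>w = e x = e u x\<close> a left inverse of \<open>e u\<close> leads back to
  \<open>x\<close>.\<close>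

lemma orb_return:
  assumes x: "x \<in> A \<rightarrow>\<^sub>E Y" and ux: "compose A u x = x"
    and Z: "cinv A Z" and w: "w \<in> Z" "w \<in> orb A x"
  shows "x \<in> Z"
proof -
  obtain e where e: "e \<in> E" "w = compose A e x"
    using w by (auto simp: orb_def)
  obtain k where k: "k \<in> G" "compose Y k (compose Y e u) = u"
    using left_inverse[OF M_mult[OF e(1) u_in]] .
  have "w = compose A (compose Y e u) x"
    using e ux compose_EE[OF x, of e u] by simp
  then have "compose A k w = x"
    using k ux by (simp add: compose_EE[OF x])
  then show ?thesis
    using cinv_E[OF Z G_E[OF k(1)] w(1)] by simp
qed

end

text \<open>Each index set has its task: \<open>M'\<close> lies in the power over the carrier of
  \<open>\<Phi>'\<close>, graphs of right multiplications lie over its double, and the carrier of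
  \<open>\<Phi>\<close> serves to lift the identity map of the target.\<close>

locale corresponding_ellis_ideals =
  tgt: ellis_ideal \<Phi> M u + src: ellis_ideal \<Phi>' M' u'
  for \<Phi> :: "('g, 'y) flow" and M u and \<Phi>' :: "('h, 'w) flow" and M' u' +
  fixes r :: "'w \<Rightarrow> 'y"
  assumes r_fun: "r \<in> flow_carrier \<Phi>' \<rightarrow> flow_carrier \<Phi>"
    and corr_src: "flow_corresp (flow_space \<Phi>') (flow_maps \<Phi>') (flow_space \<Phi>) (flow_maps \<Phi>) r
      (flow_carrier \<Phi>')"
    and corr_pair: "flow_corresp (flow_space \<Phi>') (flow_maps \<Phi>') (flow_space \<Phi>) (flow_maps \<Phi>) r
      (flow_carrier \<Phi>' <+> flow_carrier \<Phi>')"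
    and corr_tgt: "flow_corresp (flow_space \<Phi>') (flow_maps \<Phi>') (flow_space \<Phi>) (flow_maps \<Phi>) r
      (flow_carrier \<Phi>)"
begin

abbreviation "A \<equiv> flow_carrier \<Phi>'"
abbreviation "AA \<equiv> A <+> A"

abbreviation act :: "('b \<Rightarrow> 'c) \<Rightarrow> ('w \<Rightarrow> 'b) \<Rightarrow> 'w \<Rightarrow> 'c" (infixr "\<rhd>" 75) where
  "g \<rhd> x \<equiv> compose A g x"

abbreviation mul :: "('y \<Rightarrow> 'y) \<Rightarrow> ('y \<Rightarrow> 'y) \<Rightarrow> 'y \<Rightarrow> 'y" (infixr "\<cdot>" 75) where
  "g \<cdot> x \<equiv> compose (flow_carrier \<Phi>) g x"

definition "N = compose A r ` M'"
definition "z0 = r \<rhd> u'"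
text \<open>As \<open>r\<close> does not commute with the actions, \<open>z0\<close> need not be
  fixed by \<open>u\<close>; \<open>z\<close> is the corrected base point of
  \<open>N\<close>.\<close>

definition "z = u \<rhd> z0"

lemma N_cinv: "tgt.cinv A N"
  unfolding N_def by (rule flow_corresp_image[OF corr_src src.M_cinv])

lemma N_PiE: "x \<in> N \<Longrightarrow> x \<in> A \<rightarrow>\<^sub>E tgt.Y"
  using N_cinv tgt.cinv_PiE by blast

text \<open>Minimality only speaks of closed invariant subsets, so it passes from \<open>M'\<close>
  through the correspondence.\<close>

lemma N_minimal:
  assumes Z: "tgt.cinv A Z" "Z \<subseteq> N" "Z \<noteq> {}"
  shows "Z = N"
proof -
  obtain Z' where Z': "src.cinv A Z'" "compose A r ` Z' = Z"
    using flow_corresp_lift[OF corr_src Z(1)] by blast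
  have "Z' \<subseteq> M'"
    by (rule flow_corresp_subset[OF corr_src Z'(1) src.M_cinv]) (use Z Z' in \<open>simp add: N_def\<close>)
  then have "Z' = M'"
    using src.M_minimal[OF Z'(1)] Z Z' by blast
  then show ?thesis
    using Z' by (simp add: N_def)
qed

lemma z0_N: "z0 \<in> N"
  unfolding z0_def N_def using src.u_in by blast

lemma z_N: "z \<in> N"
  unfolding z_def by (rule tgt.cinv_E[OF N_cinv tgt.u_E z0_N])

lemma z_PiE: "z \<in> A \<rightarrow>\<^sub>E tgt.Y"
  by (rule N_PiE[OF z_N])

lemma u_z: "u \<rhd> z = z"
  unfolding z_def by (simp add: tgt.compose_EE[OF N_PiE[OF z0_N]] tgt.idem)

text \<open>
  Lifting the identity of \<open>Y\<close> to a point \<open>s\<close> of \<open>Y'\<^sup>Y\<close> makes \<open>r \<circ> u' \<circ> s\<close> an element of the Ellis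
  semigroup of \<open>Y\<close>, and right multiplication by such elements is injective on \<open>M\<close>.
\<close>

lemma z0_inj:
  assumes m: "m \<in> M" "n \<in> M" and eq: "m \<rhd> z0 = n \<rhd> z0"
  shows "m = n"
proof -
  obtain E' where E': "src.cinv tgt.Y E'" "compose tgt.Y r ` E' = tgt.E"
    using flow_corresp_lift[OF corr_tgt tgt.E_cinv] by blast
  then obtain s where s: "s \<in> E'" "compose tgt.Y r s = (\<lambda>y\<in>tgt.Y. y)"
    using tgt.id_in_E by (metis imageE)
  have s_fun: "s \<in> tgt.Y \<rightarrow>\<^sub>E A"
    by (rule src.cinv_PiE[OF E'(1) s(1)])
  let ?v = "compose tgt.Y r (compose tgt.Y u' s)"
  have v: "?v \<in> tgt.E"
    using src.cinv_E[OF E'(1) src.u_E s(1)] E'(2) by blast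
  \<comment> \<open>Associativity of the composite of \<open>m'\<close>, \<open>r\<close>,
    \<open>u'\<close> and \<open>s\<close>: it is bracketed once around \<open>?v\<close> and once
    around \<open>z0\<close>.\<close>
  have "m' \<cdot> ?v = compose tgt.Y (m' \<rhd> z0) s" for m'
    using s_fun by (auto simp: compose_def z0_def fun_eq_iff)
  then have "m \<cdot> ?v = n \<cdot> ?v"
    using eq by simp
  then show ?thesis
    using tgt.right_cancel[OF v m] by blast
qed

lemma z_inj:
  assumes m: "m \<in> M" "n \<in> M" and eq: "m \<rhd> z = n \<rhd> z"
  shows "m = n"
proof (rule z0_inj[OF m])
  show "m \<rhd> z0 = n \<rhd> z0"
    using eq m unfolding z_def
    by (simp add: tgt.compose_EE[OF N_PiE[OF z0_N]] tgt.M_u)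
qed

text \<open>\<open>M z\<close> is a nonempty closed invariant subset of the minimal set
  \<open>N\<close>. With \<open>z_inj\<close>, evaluation at \<open>z\<close> is a bijection from
  \<open>M\<close> onto \<open>N\<close>.\<close>

lemma N_eq: "N = (\<lambda>m. m \<rhd> z) ` M"
proof (rule N_minimal[symmetric])
  show "tgt.cinv A ((\<lambda>m. m \<rhd> z) ` M)"
    by (rule tgt.cinv_image[OF tgt.M_cinv z_PiE])
  show "(\<lambda>m. m \<rhd> z) ` M \<subseteq> N"
    using tgt.cinv_E[OF N_cinv tgt.M_E z_N] by blast
  show "(\<lambda>m. m \<rhd> z) ` M \<noteq> {}"
    using tgt.u_in by blast
qed

text \<open>The element of \<open>M\<close> leading from the base point \<open>z\<close> back to the
  image \<open>z0\<close> of \<open>u'\<close>; it is unique by \<open>z_inj\<close>.\<close>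

definition "m0 = (SOME m. m \<in> M \<and> m \<rhd> z = z0)"

lemma m0: "m0 \<in> M" "m0 \<rhd> z = z0"
proof -
  have "\<exists>m. m \<in> M \<and> m \<rhd> z = z0"
    using z0_N unfolding N_eq by (elim imageE) (metis (mono_tags))
  from someI_ex[OF this] show "m0 \<in> M" "m0 \<rhd> z = z0"
    by (simp_all add: m0_def)
qed

text \<open>The orbit closure of \<open>pt b\<close> consists of the pairs
  \<open>(e z, e b z)\<close>: read through evaluation at \<open>z\<close>, it is the graph of right
  multiplication by \<open>b\<close> when \<open>b\<close> is in the group.\<close>

definition pt :: "('y \<Rightarrow> 'y) \<Rightarrow> 'w + 'w \<Rightarrow> 'y" where
  "pt b = pairing A z (b \<rhd> z)"

text \<open>The same with base point \<open>u'\<close> in place of \<open>z\<close>; the second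
  coordinate \<open>b\<close> is \<open>b u'\<close>.\<close>

definition pt' :: "('w \<Rightarrow> 'w) \<Rightarrow> 'w + 'w \<Rightarrow> 'w" where
  "pt' b = pairing A u' b"

lemma act_z_PiE: "e \<in> tgt.E \<Longrightarrow> e \<rhd> z \<in> A \<rightarrow>\<^sub>E tgt.Y"
  by (rule compose_PiE[OF z_PiE tgt.E_fun])

lemma pt_PiE: "b \<in> tgt.E \<Longrightarrow> pt b \<in> AA \<rightarrow>\<^sub>E tgt.Y"
  unfolding pt_def by (intro pairing_PiE z_PiE act_z_PiE)

lemma u_pt: "b \<in> tgt.G \<Longrightarrow> compose AA u (pt b) = pt b"
  unfolding pt_def compose_pairing u_z tgt.compose_EE[OF z_PiE] by (simp add: tgt.u_G)

lemma act_pt: "compose AA e (pt b) = pairing A (e \<rhd> z) ((e \<cdot> b) \<rhd> z)"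
  unfolding pt_def compose_pairing tgt.compose_EE[OF z_PiE] ..

lemma pt'_PiE: "b \<in> src.G \<Longrightarrow> pt' b \<in> AA \<rightarrow>\<^sub>E A"
  unfolding pt'_def by (intro pairing_PiE src.E_PiE src.u_E src.G_E)

lemma u_pt': "b \<in> src.G \<Longrightarrow> compose AA u' (pt' b) = pt' b"
  unfolding pt'_def compose_pairing src.idem by (simp add: src.u_G)

text \<open>A nonempty closed invariant \<open>Z\<close> inside the image of the orbit closure of
  \<open>pt' b\<close> lifts to a subset of that orbit closure, and by \<open>orb_return\<close>
  this subset contains \<open>pt' b\<close>.\<close>

lemma r_pt'_minimal:
  assumes b: "b \<in> src.G" and Z: "tgt.cinv AA Z" "Z \<subseteq> tgt.orb AA (compose AA r (pt' b))" "Z \<noteq> {}"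
  shows "compose AA r (pt' b) \<in> Z"
proof -
  have P: "pt' b \<in> AA \<rightarrow>\<^sub>E A" by (rule pt'_PiE[OF b])
  obtain Z' where Z': "src.cinv AA Z'" "compose AA r ` Z' = Z"
    using flow_corresp_lift[OF corr_pair Z(1)] by blast
  have "tgt.orb AA (compose AA r (pt' b)) \<subseteq> compose AA r ` src.orb AA (pt' b)"
    by (intro tgt.orb_minimal flow_corresp_image[OF corr_pair] src.orb_cinv P imageI src.orb_self)
  then have "Z' \<subseteq> src.orb AA (pt' b)"
    using Z(2) Z'(2) by (intro flow_corresp_subset[OF corr_pair Z'(1) src.orb_cinv[OF P]]) blast
  moreover obtain w where "w \<in> Z'"
    using Z(3) Z'(2) by blast
  ultimately have "pt' b \<in> Z'"
    using src.orb_return[OF P u_pt'[OF b] Z'(1)] by blast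
  then show ?thesis
    using Z'(2) by blast
qed

text \<open>
  A minimal subset of \<open>N \<times> N\<close> contains a point \<open>(z, y)\<close> with \<open>u y = y\<close>, and then \<open>y = b z\<close>
  for some \<open>b\<close> in the Ellis group: all minimal subsets are graphs of right multiplications.
\<close>

lemma ex_h:
  assumes b': "b' \<in> src.G"
  shows "\<exists>b\<in>tgt.G. r \<rhd> b' = (m0 \<cdot> b) \<rhd> z"
proof -
  let ?x = "compose AA r (pt' b')"
  have x: "?x = pairing A z0 (r \<rhd> b')"
    by (simp add: pt'_def compose_pairing z0_def)
  have rb: "r \<rhd> b' \<in> N"
    unfolding N_def using src.G_M[OF b'] by blast
  have xP: "?x \<in> AA \<rightarrow>\<^sub>E tgt.Y"
    unfolding x by (intro pairing_PiE N_PiE z0_N rb)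
  \<comment> \<open>Inverting \<open>m0\<close> on the left carries the first coordinate
    \<open>z0\<close> of \<open>?x\<close> to the base point \<open>z\<close>.\<close>
  obtain k where k: "k \<in> tgt.G" "k \<cdot> m0 = u"
    using tgt.left_inverse[OF m0(1)] .
  have kz0: "k \<rhd> z0 = z"
    using m0(2) tgt.compose_EE[OF z_PiE, of k m0] k(2) u_z by simp
  have "k \<rhd> (r \<rhd> b') \<in> N"
    by (rule tgt.cinv_E[OF N_cinv tgt.G_E[OF k(1)] rb])
  then obtain b where b: "b \<in> M" "k \<rhd> (r \<rhd> b') = b \<rhd> z"
    unfolding N_eq by blast
  have "(u \<cdot> b) \<rhd> z = u \<rhd> (k \<rhd> (r \<rhd> b'))"
    using b by (simp add: tgt.compose_EE[OF z_PiE])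
  also have "\<dots> = b \<rhd> z"
    using b k tgt.compose_EE[OF N_PiE[OF rb], of u k] tgt.u_G by simp
  finally have "u \<cdot> b = b"
    using z_inj[OF tgt.M_mult[OF tgt.u_E b(1)] b(1)] by blast
  then have bG: "b \<in> tgt.G"
    using b by (simp add: tgt.G_iff)
  have kx: "compose AA k ?x = pt b"
    unfolding x compose_pairing kz0 b(2) pt_def ..
  have "compose AA k ?x \<in> tgt.orb AA ?x"
    unfolding tgt.orb_def using tgt.G_E[OF k(1)] by blast
  then have "pt b \<in> tgt.orb AA ?x"
    by (simp add: kx)
  then have "tgt.orb AA (pt b) \<subseteq> tgt.orb AA ?x"
    by (rule tgt.orb_minimal[OF tgt.orb_cinv[OF xP]])
  moreover have P: "pt b \<in> AA \<rightarrow>\<^sub>E tgt.Y"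
    by (rule pt_PiE[OF tgt.G_E[OF bG]])
  \<comment> \<open>Minimality reverses the passage from \<open>?x\<close> to
    \<open>pt b\<close>.\<close>
  ultimately have "?x \<in> tgt.orb AA (pt b)"
    using r_pt'_minimal[OF b' tgt.orb_cinv[OF P]] tgt.orb_self[OF P] by blast
  then obtain e where e: "e \<in> tgt.E" "?x = compose AA e (pt b)"
    by (auto simp: tgt.orb_def)
  have eq: "z0 = e \<rhd> z" "r \<rhd> b' = (e \<cdot> b) \<rhd> z"
    using e(2) N_PiE[OF z0_N] N_PiE[OF rb] unfolding x act_pt by (simp_all add: pairing_eq_iff PiE_def)
  \<comment> \<open>\<open>e\<close> matters only through \<open>e u\<close>, which the first
    coordinate identifies as \<open>m0\<close>.\<close>
  have "(e \<cdot> u) \<rhd> z = m0 \<rhd> z"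
    using eq(1) m0(2) tgt.compose_EE[OF z_PiE, of e u] u_z by simp
  then have "e \<cdot> u = m0"
    by (intro z_inj tgt.M_mult e tgt.u_in m0)
  then have "m0 \<cdot> b = e \<cdot> b"
    using tgt.assoc[OF tgt.G_E[OF bG], of e u] tgt.u_G[OF bG] by simp
  then show ?thesis
    using bG eq(2) by (intro bexI[of _ b]) simp_all
qed

text \<open>The factor \<open>m0\<close> is a normalisation: \<open>r\<close> maps \<open>u'\<close>
  to \<open>z0 = m0 z\<close>, so that \<open>u'\<close> corresponds to \<open>u\<close>.\<close>

definition "h b' = (SOME b. b \<in> tgt.G \<and> r \<rhd> b' = (m0 \<cdot> b) \<rhd> z)"

lemma h:
  assumes "b' \<in> src.G"
  shows "h b' \<in> tgt.G" "r \<rhd> b' = (m0 \<cdot> h b') \<rhd> z"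
proof -
  have "\<exists>b. b \<in> tgt.G \<and> r \<rhd> b' = (m0 \<cdot> b) \<rhd> z"
    using ex_h[OF assms] by blast
  from someI_ex[OF this] show "h b' \<in> tgt.G" "r \<rhd> b' = (m0 \<cdot> h b') \<rhd> z"
    by (simp_all add: h_def)
qed

lemma h_unique:
  assumes b': "b' \<in> src.G" and b: "b \<in> tgt.G" "r \<rhd> b' = (m0 \<cdot> b) \<rhd> z"
  shows "h b' = b"
proof -
  have "m0 \<cdot> h b' = m0 \<cdot> b"
    using h[OF b'] b by (intro z_inj tgt.M_mult tgt.M_E m0 tgt.G_M) simp_all
  then show ?thesis
    using tgt.left_cancel[OF m0(1) tgt.E_PiE tgt.E_PiE tgt.u_G tgt.u_G] h(1)[OF b'] b(1) tgt.G_E by blast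
qed

lemma r_pt': "b' \<in> src.G \<Longrightarrow> compose AA r (pt' b') = compose AA m0 (pt (h b'))"
  unfolding act_pt m0 by (simp add: h(2)[symmetric] pt'_def compose_pairing z0_def)

text \<open>\<open>pt' b'\<close> and \<open>pt (h b')\<close> are fixed by the respective
  idempotents, so each lies in every closed invariant set that meets its orbit closure. This makes
  membership transferable although \<open>r\<close> need not be injective.\<close>

lemma pt'_iff:
  assumes V: "src.cinv AA V" and b': "b' \<in> src.G"
  shows "pt' b' \<in> V \<longleftrightarrow> pt (h b') \<in> compose AA r ` V"
proof -
  have rV: "tgt.cinv AA (compose AA r ` V)"
    by (rule flow_corresp_image[OF corr_pair V])
  have hb: "h b' \<in> tgt.G" by (rule h(1)[OF b'])
  have P: "pt (h b') \<in> AA \<rightarrow>\<^sub>E tgt.Y"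
    by (rule pt_PiE[OF tgt.G_E[OF hb]])
  have P': "pt' b' \<in> AA \<rightarrow>\<^sub>E A" by (rule pt'_PiE[OF b'])
  have rP: "compose AA r (pt' b') \<in> AA \<rightarrow>\<^sub>E tgt.Y"
    by (rule compose_PiE[OF P' r_fun])
  show ?thesis
  proof
    assume "pt' b' \<in> V"
    then have "compose AA m0 (pt (h b')) \<in> compose AA r ` V"
      using r_pt'[OF b'] by (metis imageI)
    moreover have "compose AA m0 (pt (h b')) \<in> tgt.orb AA (pt (h b'))"
      unfolding tgt.orb_def using tgt.M_E[OF m0(1)] by blast
    ultimately show "pt (h b') \<in> compose AA r ` V"
      using tgt.orb_return[OF P u_pt[OF hb] rV] by blast
  next
    assume "pt (h b') \<in> compose AA r ` V"
    then have x: "compose AA r (pt' b') \<in> compose AA r ` V"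
      unfolding r_pt'[OF b'] by (rule tgt.cinv_E[OF rV tgt.M_E[OF m0(1)]])
    \<comment> \<open>The image of \<open>pt' b'\<close> might come from another point of
      \<open>V\<close>. Lifting its orbit closure gives a nonempty set \<open>W\<close> inside both
      \<open>V\<close> and the orbit closure of \<open>pt' b'\<close>.\<close>
    obtain W where W: "src.cinv AA W" "compose AA r ` W = tgt.orb AA (compose AA r (pt' b'))"
      using flow_corresp_lift[OF corr_pair tgt.orb_cinv[OF rP]] by blast
    have "W \<subseteq> V"
      using tgt.orb_minimal[OF rV x] by (intro flow_corresp_subset[OF corr_pair W(1) V]) (simp add: W)
    have "W \<subseteq> src.orb AA (pt' b')"
      by (intro flow_corresp_subset[OF corr_pair W(1) src.orb_cinv[OF P']])
        (simp add: W, intro tgt.orb_minimal flow_corresp_image[OF corr_pair] src.orb_cinv P' imageI src.orb_self)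
    moreover obtain w where "w \<in> W"
      using W(2) tgt.orb_self[OF rP] by blast
    ultimately have "pt' b' \<in> W"
      using src.orb_return[OF P' u_pt'[OF b'] W(1)] by blast
    then show "pt' b' \<in> V"
      using \<open>W \<subseteq> V\<close> by blast
  qed
qed

text \<open>Acting by \<open>a\<close> on \<open>(u', b)\<close> gives \<open>(a, a b)\<close>,
  which stays in the lift of the graph of right multiplication by \<open>h b\<close>. So its image
  is \<open>(e z, e (h b) z)\<close> for some \<open>e\<close>, and the first coordinate forces
  \<open>e u = m0 (h a)\<close>.\<close>

lemma h_mult:
  assumes a: "a \<in> src.G" and b: "b \<in> src.G"
  shows "h (compose A a b) = h a \<cdot> h b"
proof (rule h_unique)
  show "compose A a b \<in> src.G" by (rule src.G_mult[OF a b])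
  show ab: "h a \<cdot> h b \<in> tgt.G" using h(1) a b tgt.G_mult by blast
  have P: "pt (h b) \<in> AA \<rightarrow>\<^sub>E tgt.Y"
    by (rule pt_PiE[OF tgt.G_E[OF h(1)[OF b]]])
  obtain W where W: "src.cinv AA W" "compose AA r ` W = tgt.orb AA (pt (h b))"
    using flow_corresp_lift[OF corr_pair tgt.orb_cinv[OF P]] by blast
  then have "pt' b \<in> W"
    using pt'_iff[OF W(1) b] tgt.orb_self[OF P] by simp
  then have "compose AA a (pt' b) \<in> W"
    by (rule src.cinv_E[OF W(1) src.G_E[OF a]])
  moreover have "compose AA a (pt' b) = pairing A a (compose A a b)"
    using src.M_u[OF src.G_M[OF a]] by (simp add: pt'_def compose_pairing)
  ultimately have "pairing A (r \<rhd> a) (r \<rhd> compose A a b) \<in> tgt.orb AA (pt (h b))"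
    unfolding W(2)[symmetric] compose_pairing[symmetric] by (metis imageI)
  then obtain e where e: "e \<in> tgt.E" "pairing A (r \<rhd> a) (r \<rhd> compose A a b) = pairing A (e \<rhd> z) ((e \<cdot> h b) \<rhd> z)"
    unfolding tgt.orb_def act_pt by blast
  then have eq: "r \<rhd> a = e \<rhd> z" "r \<rhd> compose A a b = (e \<cdot> h b) \<rhd> z"
    by (simp_all add: pairing_eq_iff)
  have "(e \<cdot> u) \<rhd> z = (m0 \<cdot> h a) \<rhd> z"
    using eq(1) h(2)[OF a] tgt.compose_EE[OF z_PiE, of e u] u_z by simp
  then have "e \<cdot> u = m0 \<cdot> h a"
    by (intro z_inj tgt.M_mult[OF e(1) tgt.u_in] tgt.M_mult[OF tgt.M_E[OF m0(1)] tgt.G_M[OF h(1)[OF a]]])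
  then have "e \<cdot> h b = (m0 \<cdot> h a) \<cdot> h b"
    using tgt.assoc[OF tgt.G_E[OF h(1)[OF b]], of e u] tgt.u_G[OF h(1)[OF b]] by simp
  also have "\<dots> = m0 \<cdot> (h a \<cdot> h b)"
    using tgt.assoc[OF tgt.G_E[OF h(1)[OF b]], of m0 "h a"] by simp
  finally show "r \<rhd> compose A a b = (m0 \<cdot> (h a \<cdot> h b)) \<rhd> z"
    using eq(2) by simp
qed

text \<open>Equal values put \<open>pt' a\<close> into the orbit closure of \<open>pt' b\<close>;
  thus \<open>a = e b\<close> with \<open>e u' = u'\<close>, and \<open>b = u' b\<close> gives
  \<open>a = b\<close>.\<close>

lemma h_inj: "inj_on h src.G"
proof (rule inj_onI)
  fix a b assume a: "a \<in> src.G" and b: "b \<in> src.G" and eq: "h a = h b"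
  have P': "pt' b \<in> AA \<rightarrow>\<^sub>E A" by (rule pt'_PiE[OF b])
  have "pt' a \<in> src.orb AA (pt' b)"
    using pt'_iff[OF src.orb_cinv[OF P'] a] pt'_iff[OF src.orb_cinv[OF P'] b] eq src.orb_self[OF P'] by simp
  then obtain e where e: "e \<in> src.E" "pairing A u' a = pairing A (compose A e u') (compose A e b)"
    unfolding src.orb_def pt'_def compose_pairing by blast
  then have "u' = compose A e u'" "a = compose A e b"
    using src.E_PiE[OF src.u_E] src.E_PiE[OF src.G_E[OF a]] by (simp_all add: pairing_eq_iff PiE_def)
  then show "a = b"
    using src.assoc[OF src.G_E[OF b], of e u'] src.u_G[OF b] by simp
qed

text \<open>The graph of \<open>b\<close> lifts to a set \<open>W\<close> of pairs from
  \<open>M'\<close>. A left inverse of \<open>x\<close> moves a point \<open>(x, y)\<close> of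
  \<open>W\<close> to one of the form \<open>(u', b')\<close>, and \<open>b'\<close> is the preimage
  sought.\<close>

lemma h_surj: "h ` src.G = tgt.G"
proof
  show "h ` src.G \<subseteq> tgt.G" using h(1) by blast
  show "tgt.G \<subseteq> h ` src.G"
  proof
    fix b assume b: "b \<in> tgt.G"
    have P: "pt b \<in> AA \<rightarrow>\<^sub>E tgt.Y"
      by (rule pt_PiE[OF tgt.G_E[OF b]])
    obtain W where W: "src.cinv AA W" "compose AA r ` W = tgt.orb AA (pt b)"
      using flow_corresp_lift[OF corr_pair tgt.orb_cinv[OF P]] by blast
    let ?MM = "{pairing A x y |x y. x \<in> M' \<and> y \<in> M'}"
    have MM: "src.cinv AA ?MM"
      using src.maps_funcset
      by (intro closed_inv_Times src.M_cinv) (simp add: flow_carrier_def)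
    have "pt b \<in> compose AA r ` ?MM"
    proof -
      have "z \<in> N" "b \<rhd> z \<in> N"
        using z_N tgt.cinv_E[OF N_cinv tgt.G_E[OF b] z_N] by auto
      then obtain x y where "x \<in> M'" "y \<in> M'" "z = r \<rhd> x" "b \<rhd> z = r \<rhd> y"
        unfolding N_def by blast
      then have "pt b = compose AA r (pairing A x y)"
        by (simp add: pt_def compose_pairing)
      then show ?thesis
        using \<open>x \<in> M'\<close> \<open>y \<in> M'\<close> by blast
    qed
    then have "tgt.orb AA (pt b) \<subseteq> compose AA r ` ?MM"
      by (rule tgt.orb_minimal[OF flow_corresp_image[OF corr_pair MM]])
    then have "W \<subseteq> ?MM"
      by (intro flow_corresp_subset[OF corr_pair W(1) MM]) (simp add: W)
    moreover obtain w where "w \<in> W"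
      using W(2) tgt.orb_self[OF P] by blast
    ultimately obtain x y where xy: "pairing A x y \<in> W" "x \<in> M'" "y \<in> M'" by blast
    obtain k where k: "k \<in> src.G" "compose A k x = u'"
      using src.left_inverse[OF xy(2)] .
    let ?b = "compose A k y"
    have "compose A u' ?b = ?b"
      using src.assoc[OF src.M_E[OF xy(3)], of u' k] src.u_G[OF k(1)] by simp
    then have bG: "?b \<in> src.G"
      using src.M_mult[OF src.G_E[OF k(1)] xy(3)] by (simp add: src.G_iff)
    have "pt' ?b \<in> W"
      using src.cinv_E[OF W(1) src.G_E[OF k(1)] xy(1)] k(2) by (simp add: pt'_def compose_pairing)
    then have "pt (h ?b) \<in> tgt.orb AA (pt b)"
      using pt'_iff[OF W(1) bG] W(2) by simp
    then obtain e where e: "e \<in> tgt.E" "pairing A z (h ?b \<rhd> z) = pairing A (e \<rhd> z) ((e \<cdot> b) \<rhd> z)"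
      unfolding tgt.orb_def act_pt unfolding pt_def by blast
    then have eq: "z = e \<rhd> z" "h ?b \<rhd> z = (e \<cdot> b) \<rhd> z"
      using z_PiE by (simp_all add: pairing_eq_iff PiE_def)
    have "(e \<cdot> u) \<rhd> z = u \<rhd> z"
      using eq(1) tgt.compose_EE[OF z_PiE, of e u] u_z by simp
    then have "e \<cdot> u = u"
      by (intro z_inj tgt.M_mult e tgt.u_in)
    then have "e \<cdot> b = b"
      using tgt.assoc[OF tgt.G_E[OF b], of e u] tgt.u_G[OF b] by simp
    then have "h ?b = b"
      using eq(2) h(1)[OF bG] b by (intro z_inj tgt.G_M) simp_all
    then show "b \<in> h ` src.G"
      using bG by blast
  qed
qed

text \<open>\<open>tau_closure_iff\<close> is used with base point \<open>u'\<close> in the source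
  and \<open>z\<close> in the target; \<open>pt'_iff\<close> exchanges the test sets
  \<open>V\<close> on the two sides.\<close>

lemma h_tau_closure:
  assumes B: "B \<subseteq> src.G" and c: "c \<in> src.G"
  shows "c \<in> tau_closure \<Phi>' M' u' B \<longleftrightarrow> h c \<in> tau_closure \<Phi> M u (h ` B)"
proof -
  have ua: "compose A g u' = g" if "g \<in> src.G" for g
    using src.M_u[OF src.G_M[OF that]] .
  have "c \<in> tau_closure \<Phi>' M' u' B \<longleftrightarrow>
      (\<forall>V. src.cinv AA V \<and> (\<forall>b\<in>B. pairing A u' (compose A b u') \<in> V) \<longrightarrow> pairing A u' (compose A c u') \<in> V)"
    by (rule src.tau_closure_iff[OF src.E_PiE[OF src.u_E] src.idem _ B c]) (simp add: src.M_u)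
  also have "\<dots> \<longleftrightarrow> (\<forall>V. src.cinv AA V \<and> (\<forall>b\<in>B. pt' b \<in> V) \<longrightarrow> pt' c \<in> V)"
  proof -
    have "(\<forall>b\<in>B. pairing A u' (compose A b u') \<in> V) \<longleftrightarrow> (\<forall>b\<in>B. pt' b \<in> V)" for V
      using B ua by (intro ball_cong) (auto simp: pt'_def)
    then show ?thesis
      using ua[OF c] by (simp add: pt'_def)
  qed
  also have "\<dots> \<longleftrightarrow> (\<forall>V. src.cinv AA V \<and> (\<forall>b\<in>B. pt (h b) \<in> compose AA r ` V) \<longrightarrow> pt (h c) \<in> compose AA r ` V)"
    using pt'_iff c B by (meson subsetD)
  also have "\<dots> \<longleftrightarrow> (\<forall>V. tgt.cinv AA V \<and> (\<forall>b\<in>h ` B. pt b \<in> V) \<longrightarrow> pt (h c) \<in> V)"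
  proof (intro iffI allI impI)
    fix V assume L: "\<forall>V. src.cinv AA V \<and> (\<forall>b\<in>B. pt (h b) \<in> compose AA r ` V) \<longrightarrow> pt (h c) \<in> compose AA r ` V"
      and V: "tgt.cinv AA V \<and> (\<forall>b\<in>h ` B. pt b \<in> V)"
    obtain W where "src.cinv AA W" "compose AA r ` W = V"
      using flow_corresp_lift[OF corr_pair] V by blast
    then show "pt (h c) \<in> V"
      using L[rule_format, of W] V by auto
  next
    fix V assume L: "\<forall>V. tgt.cinv AA V \<and> (\<forall>b\<in>h ` B. pt b \<in> V) \<longrightarrow> pt (h c) \<in> V"
      and V: "src.cinv AA V \<and> (\<forall>b\<in>B. pt (h b) \<in> compose AA r ` V)"
    have "tgt.cinv AA (compose AA r ` V)"
      using flow_corresp_image[OF corr_pair] V by blast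
    then show "pt (h c) \<in> compose AA r ` V"
      using L V by blast
  qed
  also have "\<dots> \<longleftrightarrow> h c \<in> tau_closure \<Phi> M u (h ` B)"
    unfolding pt_def
    by (rule tgt.tau_closure_iff[OF z_PiE u_z z_inj _ h(1)[OF c], symmetric]) (use B h(1) in auto)
  finally show ?thesis .
qed

lemma h_tau_closure_image:
  assumes B: "B \<subseteq> src.G"
  shows "h ` tau_closure \<Phi>' M' u' B = tau_closure \<Phi> M u (h ` B)"
proof
  have sub: "tau_closure \<Phi>' M' u' B \<subseteq> src.G" "tau_closure \<Phi> M u (h ` B) \<subseteq> tgt.G"
    by (auto simp: tau_closure_def src.carrier_ellis tgt.carrier_ellis)
  show "h ` tau_closure \<Phi>' M' u' B \<subseteq> tau_closure \<Phi> M u (h ` B)"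
    using h_tau_closure[OF B] sub by blast
  show "tau_closure \<Phi> M u (h ` B) \<subseteq> h ` tau_closure \<Phi>' M' u' B"
  proof
    fix x assume x: "x \<in> tau_closure \<Phi> M u (h ` B)"
    then obtain c where c: "c \<in> src.G" "x = h c"
      using sub(2) h_surj by blast
    then show "x \<in> h ` tau_closure \<Phi>' M' u' B"
      using h_tau_closure[OF B c(1)] x by blast
  qed
qed

lemma h_openin:
  assumes U: "U \<subseteq> src.G"
  shows "openin (tau_topology \<Phi>' M' u') U \<longleftrightarrow> openin (tau_topology \<Phi> M u) (h ` U)"
proof -
  have o': "openin (tau_topology \<Phi>' M' u') U \<longleftrightarrow> tau_closure \<Phi>' M' u' (src.G - U) = src.G - U"
    using openin_tau_topology[OF src.M_left_ideal src.u_in] src.idem U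
    by (simp add: src.ellis_mult_eq src.carrier_ellis)
  have img: "h ` (src.G - U) = tgt.G - h ` U"
    using inj_on_image_set_diff[OF h_inj Diff_subset U] h_surj by simp
  have o: "openin (tau_topology \<Phi> M u) (h ` U) \<longleftrightarrow> tau_closure \<Phi> M u (tgt.G - h ` U) = tgt.G - h ` U"
    using openin_tau_topology[OF tgt.M_left_ideal tgt.u_in] tgt.idem U h(1)
    by (auto simp: tgt.ellis_mult_eq tgt.carrier_ellis)
  have "tau_closure \<Phi>' M' u' (src.G - U) = src.G - U \<longleftrightarrow>
      h ` tau_closure \<Phi>' M' u' (src.G - U) = h ` (src.G - U)"
    by (rule inj_on_image_eq_iff[OF h_inj, symmetric])
      (auto simp: tau_closure_def src.carrier_ellis)
  then show ?thesis
    unfolding o o' img[symmetric] by (simp add: h_tau_closure_image)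
qed

theorem ellis_groups_isomorphic:
  "h \<in> iso (ellis_group \<Phi>' M' u') (ellis_group \<Phi> M u)"
  "homeomorphic_map (tau_topology \<Phi>' M' u') (tau_topology \<Phi> M u) h"
proof -
  show "h \<in> iso (ellis_group \<Phi>' M' u') (ellis_group \<Phi> M u)"
    unfolding iso_def hom_def mem_Collect_eq src.carrier_ellis tgt.carrier_ellis
    using h(1) h_mult h_inj h_surj
    by (auto simp: bij_betw_def ellis_group_def src.ellis_mult_eq tgt.ellis_mult_eq)
  have top: "topspace (tau_topology \<Phi>' M' u') = src.G" "topspace (tau_topology \<Phi> M u) = tgt.G"
    using topspace_tau_topology[OF src.M_left_ideal src.u_in] src.idem
      topspace_tau_topology[OF tgt.M_left_ideal tgt.u_in] tgt.idem
    by (simp_all add: src.ellis_mult_eq src.carrier_ellis tgt.ellis_mult_eq tgt.carrier_ellis)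
  show "homeomorphic_map (tau_topology \<Phi>' M' u') (tau_topology \<Phi> M u) h"
  proof (rule bijective_open_imp_homeomorphic_map)
    show "continuous_map (tau_topology \<Phi>' M' u') (tau_topology \<Phi> M u) h"
      unfolding continuous_map_def top
    proof (intro conjI allI impI)
      show "h \<in> src.G \<rightarrow> tgt.G" using h(1) by blast
      fix U assume U: "openin (tau_topology \<Phi> M u) U"
      let ?U = "{x \<in> src.G. h x \<in> U}"
      have "U \<subseteq> h ` src.G" using openin_subset[OF U] by (simp only: top h_surj)
      then have "h ` ?U = U" by auto
      then show "openin (tau_topology \<Phi>' M' u') ?U"
        using h_openin[of ?U] U by auto
    qed
    show "open_map (tau_topology \<Phi>' M' u') (tau_topology \<Phi> M u) h"
      unfolding open_map_def
    proof (intro allI impI)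
      fix U assume U: "openin (tau_topology \<Phi>' M' u') U"
      then have "U \<subseteq> src.G" using openin_subset top by blast
      then show "openin (tau_topology \<Phi> M u) (h ` U)"
        using h_openin U by simp
    qed
    show "h ` topspace (tau_topology \<Phi>' M' u') = topspace (tau_topology \<Phi> M u)"
      "inj_on h (topspace (tau_topology \<Phi>' M' u'))"
      using h_inj h_surj top by simp_all
  qed
qed

end

section \<open>Quotients of flows\<close>

text \<open>\<open>maps_down\<close> and \<open>maps_up\<close> are the two halves of equivariance
  of \<open>\<kappa>\<close>, phrased for sets of maps instead of groups.\<close>

locale flow_quotient =
  fixes Y :: "'y topology" and H :: "('y \<Rightarrow> 'y) set"
    and Q :: "'q topology" and K :: "('q \<Rightarrow> 'q) set" and \<kappa> :: "'y \<Rightarrow> 'q"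
  assumes compact: "compact_space Y" and Hausdorff: "Hausdorff_space Q"
    and maps_fun: "H \<subseteq> topspace Y \<rightarrow> topspace Y"
    and cont: "continuous_map Y Q \<kappa>" and onto: "\<kappa> ` topspace Y = topspace Q"
    and maps_down: "h \<in> H \<Longrightarrow> \<exists>k\<in>K. \<forall>y\<in>topspace Y. k (\<kappa> y) = \<kappa> (h y)"
    and maps_up: "k \<in> K \<Longrightarrow> \<exists>h\<in>H. \<forall>y\<in>topspace Y. k (\<kappa> y) = \<kappa> (h y)"
begin

lemma \<kappa>_fun: "\<kappa> \<in> topspace Y \<rightarrow> topspace Q"
  using onto by blast

lemma compose_\<kappa>_commute:
  assumes "\<forall>y\<in>topspace Y. k (\<kappa> y) = \<kappa> (h y)" "x \<in> A \<rightarrow>\<^sub>E topspace Y"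
  shows "compose A k (compose A \<kappa> x) = compose A \<kappa> (compose A h x)"
  using assms by (auto simp: compose_def fun_eq_iff)

lemma preimage_closed_inv:
  assumes Z: "closed_inv Q K A Z"
  shows "closed_inv Y H A {x \<in> A \<rightarrow>\<^sub>E topspace Y. compose A \<kappa> x \<in> Z}"
  unfolding closed_inv_def
proof (intro conjI ballI)
  show "closedin (product_topology (\<lambda>_. Y) A) {x \<in> A \<rightarrow>\<^sub>E topspace Y. compose A \<kappa> x \<in> Z}"
    using closedin_continuous_map_preimage[OF continuous_map_compose_left[OF cont] closed_inv_closedin[OF Z]]
    by simp
  fix h x assume h: "h \<in> H" and x: "x \<in> {x \<in> A \<rightarrow>\<^sub>E topspace Y. compose A \<kappa> x \<in> Z}"
  obtain k where k: "k \<in> K" "\<forall>y\<in>topspace Y. k (\<kappa> y) = \<kappa> (h y)"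
    using maps_down[OF h] by blast
  have "compose A k (compose A \<kappa> x) \<in> Z"
    using Z x k(1) by (auto simp: closed_inv_def)
  moreover have "compose A h x \<in> A \<rightarrow>\<^sub>E topspace Y"
    using x compose_PiE[OF _ subsetD[OF maps_fun h]] by blast
  ultimately show "compose A h x \<in> {x \<in> A \<rightarrow>\<^sub>E topspace Y. compose A \<kappa> x \<in> Z}"
    using compose_\<kappa>_commute[OF k(2), of x A] x by simp
qed

lemma image_closed_inv:
  assumes W: "closed_inv Y H A W"
  shows "closed_inv Q K A (compose A \<kappa> ` W)"
  unfolding closed_inv_def
proof (intro conjI ballI)
  show "closedin (product_topology (\<lambda>_. Q) A) (compose A \<kappa> ` W)"
    by (rule closedin_compose_image[OF compact Hausdorff cont closed_inv_closedin[OF W]])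
  fix k x assume k: "k \<in> K" and "x \<in> compose A \<kappa> ` W"
  then obtain w where w: "w \<in> W" "x = compose A \<kappa> w" by blast
  obtain h where h: "h \<in> H" "\<forall>y\<in>topspace Y. k (\<kappa> y) = \<kappa> (h y)"
    using maps_up[OF k] by blast
  have "compose A k x = compose A \<kappa> (compose A h w)"
    unfolding w by (rule compose_\<kappa>_commute[OF h(2) closed_inv_PiE[OF W w(1)]])
  then show "compose A k x \<in> compose A \<kappa> ` W"
    using W w(1) h(1) by (auto simp: closed_inv_def)
qed

text \<open>As the equaliser of two continuous maps into a Hausdorff space, coordinatewise
  equivalence of tuples is a closed set of pairs.\<close>

lemma kernel_closed_inv:
  "closed_inv Y H (A <+> A) {pairing A x y |x y. x \<in> A \<rightarrow>\<^sub>E topspace Y \<and> y \<in> A \<rightarrow>\<^sub>E topspace Y \<and>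
     compose A \<kappa> x = compose A \<kappa> y}" (is "closed_inv _ _ _ ?D")
proof -
  let ?P = "product_topology (\<lambda>_. Y) (A <+> A)"
  let ?l = "\<lambda>w. compose A \<kappa> (\<lambda>i\<in>A. w (Inl i))" and ?r = "\<lambda>w. compose A \<kappa> (\<lambda>i\<in>A. w (Inr i))"
  have D: "?D = {w \<in> topspace ?P. ?l w = ?r w}" (is "_ = ?D'")
  proof
    show "?D \<subseteq> ?D'"
    proof
      fix w assume "w \<in> ?D"
      then obtain x y where xy: "w = pairing A x y" "x \<in> A \<rightarrow>\<^sub>E topspace Y" "y \<in> A \<rightarrow>\<^sub>E topspace Y"
        "compose A \<kappa> x = compose A \<kappa> y"
        by blast
      then show "w \<in> ?D'"
        using pairing_PiE[OF xy(2,3)] by (auto simp: PiE_def)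
    qed
    show "?D' \<subseteq> ?D"
    proof
      fix w assume w: "w \<in> ?D'"
      then obtain x y where "x \<in> A \<rightarrow>\<^sub>E topspace Y" "y \<in> A \<rightarrow>\<^sub>E topspace Y" "w = pairing A x y"
        using pairing_cases[of w A "topspace Y"] by auto
      with w show "w \<in> ?D"
        by (auto simp: PiE_def)
    qed
  qed
  have c: "continuous_map ?P (product_topology (\<lambda>_. Q) A) ?l" "continuous_map ?P (product_topology (\<lambda>_. Q) A) ?r"
    using continuous_map_compose[OF continuous_map_left_part continuous_map_compose_left[OF cont]]
      continuous_map_compose[OF continuous_map_right_part continuous_map_compose_left[OF cont]]
    by (simp_all add: o_def)
  show ?thesis
    unfolding closed_inv_def
  proof (intro conjI ballI)
    show "closedin ?P ?D"
      unfolding D using Hausdorff c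
      by (intro closedin_continuous_maps_eq) (auto simp: Hausdorff_space_product_topology)
    fix h w assume h: "h \<in> H" and "w \<in> ?D"
    then obtain x y where xy: "w = pairing A x y" "x \<in> A \<rightarrow>\<^sub>E topspace Y" "y \<in> A \<rightarrow>\<^sub>E topspace Y"
        "compose A \<kappa> x = compose A \<kappa> y"
      by blast
    obtain k where k: "k \<in> K" "\<forall>y\<in>topspace Y. k (\<kappa> y) = \<kappa> (h y)"
      using maps_down[OF h] by blast
    have "compose A \<kappa> (compose A h x) = compose A \<kappa> (compose A h y)"
      using xy compose_\<kappa>_commute[OF k(2)] by metis
    moreover have "compose A h x \<in> A \<rightarrow>\<^sub>E topspace Y" "compose A h y \<in> A \<rightarrow>\<^sub>E topspace Y"
      using xy(2,3) compose_PiE[OF _ subsetD[OF maps_fun h]] by blast+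
    ultimately show "compose (A <+> A) h w \<in> ?D"
      unfolding xy(1) compose_pairing by blast
  qed
qed

end

text \<open>The two inclusions of compatibility: \<open>\<rho>\<close> expresses that restriction
  respects the relations, \<open>compatible\<close> that equivalent points have equivalent
  lifts.\<close>

locale compatible_quotients =
  base: flow_quotient Y H Q K \<kappa> + top: flow_quotient Y' H' Q' K' \<kappa>'
  for Y :: "'y topology" and H and Q :: "'q topology" and K \<kappa>
    and Y' :: "'w topology" and H' and Q' :: "'v topology" and K' \<kappa>' +
  fixes r :: "'w \<Rightarrow> 'y" and \<rho> :: "'v \<Rightarrow> 'q"
  assumes r_onto: "r ` topspace Y' = topspace Y"
    and \<rho>: "y \<in> topspace Y' \<Longrightarrow> \<rho> (\<kappa>' y) = \<kappa> (r y)"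
    and compatible: "a \<in> topspace Y \<Longrightarrow> b \<in> topspace Y \<Longrightarrow> \<kappa> a = \<kappa> b \<Longrightarrow>
      \<exists>a'\<in>topspace Y'. \<exists>b'\<in>topspace Y'. \<kappa>' a' = \<kappa>' b' \<and> r a' = a \<and> r b' = b"
begin

lemma compose_\<rho>:
  "x \<in> A \<rightarrow>\<^sub>E topspace Y' \<Longrightarrow> compose A \<rho> (compose A \<kappa>' x) = compose A \<kappa> (compose A r x)"
  using \<rho> by (auto simp: compose_def fun_eq_iff)

text \<open>An isomorphism of lattices preserves meets even where images do not commute with
  intersections. Applied to pairs with first half in \<open>W\<close> and equal
  \<open>\<kappa>\<close>-images, it lifts \<open>(r w, y)\<close> to a pair \<open>(a, b)\<close>
  with \<open>a\<close> in \<open>W\<close> and \<open>b\<close> equivalent to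
  \<open>a\<close>.\<close>

lemma saturation:
  assumes corr2: "flow_corresp Y' H' Y H r (A <+> A)" and W: "closed_inv Y' H' A W"
    and y: "y \<in> A \<rightarrow>\<^sub>E topspace Y" "compose A \<kappa> y \<in> compose A \<kappa> ` compose A r ` W"
  shows "\<exists>x\<in>A \<rightarrow>\<^sub>E topspace Y'. compose A r x = y \<and> compose A \<kappa>' x \<in> compose A \<kappa>' ` W"
proof -
  let ?AA = "A <+> A"
  let ?D = "{pairing A x y |x y. x \<in> A \<rightarrow>\<^sub>E topspace Y \<and> y \<in> A \<rightarrow>\<^sub>E topspace Y \<and> compose A \<kappa> x = compose A \<kappa> y}"
  let ?D' = "{pairing A x y |x y. x \<in> A \<rightarrow>\<^sub>E topspace Y' \<and> y \<in> A \<rightarrow>\<^sub>E topspace Y' \<and> compose A \<kappa>' x = compose A \<kappa>' y}"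
  let ?W = "{pairing A x y |x y. x \<in> W \<and> y \<in> A \<rightarrow>\<^sub>E topspace Y'}"
  have full: "closed_inv Y' H' A (A \<rightarrow>\<^sub>E topspace Y')"
    unfolding closed_inv_def using closedin_topspace[of "product_topology (\<lambda>_. Y') A"]
    by (intro conjI ballI compose_PiE[OF _ subsetD[OF top.maps_fun]]) simp_all
  have W2: "closed_inv Y' H' ?AA ?W"
    by (rule closed_inv_Times[OF W full top.maps_fun])
  have V: "closed_inv Y H ?AA (compose ?AA r ` ?W \<inter> ?D)"
    by (intro closed_inv_Int flow_corresp_image[OF corr2 W2] base.kernel_closed_inv)
  obtain V' where V': "closed_inv Y' H' ?AA V'" "compose ?AA r ` V' = compose ?AA r ` ?W \<inter> ?D"
    using flow_corresp_lift[OF corr2 V] by blast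
  have VW: "V' \<subseteq> ?W"
    by (rule flow_corresp_subset[OF corr2 V'(1) W2]) (simp add: V'(2))
  \<comment> \<open>Compatibility speaks of single points, but equivalence of tuples is
    coordinatewise, so lifts may be chosen independently for each index in \<open>A\<close>.\<close>
  have "compose ?AA r ` V' \<subseteq> compose ?AA r ` ?D'"
  proof
    fix d assume "d \<in> compose ?AA r ` V'"
    then have "d \<in> ?D" using V'(2) by blast
    then obtain a b where ab: "d = pairing A a b" "a \<in> A \<rightarrow>\<^sub>E topspace Y" "b \<in> A \<rightarrow>\<^sub>E topspace Y"
        "compose A \<kappa> a = compose A \<kappa> b"
      by blast
    have "\<exists>a' b'. a' \<in> topspace Y' \<and> b' \<in> topspace Y' \<and> \<kappa>' a' = \<kappa>' b' \<and> r a' = a i \<and> r b' = b i"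
      if "i \<in> A" for i
    proof -
      have "\<kappa> (a i) = \<kappa> (b i)"
        using fun_cong[OF ab(4), of i] that by (simp add: compose_eq)
      then show ?thesis
        using compatible[of "a i" "b i"] ab(2,3) that by blast
    qed
    then obtain f g where fg: "\<And>i. i \<in> A \<Longrightarrow> f i \<in> topspace Y' \<and> g i \<in> topspace Y' \<and>
        \<kappa>' (f i) = \<kappa>' (g i) \<and> r (f i) = a i \<and> r (g i) = b i"
      by metis
    have "pairing A (restrict f A) (restrict g A) \<in> ?D'"
      using fg by (intro CollectI exI conjI) (auto simp: compose_def fun_eq_iff)
    moreover have "compose A r (restrict f A) = a" "compose A r (restrict g A) = b"
      using fg ab(2,3) by (auto simp: compose_def fun_eq_iff PiE_def extensional_def)
    then have "compose ?AA r (pairing A (restrict f A) (restrict g A)) = d"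
      by (simp add: compose_pairing ab(1))
    ultimately show "d \<in> compose ?AA r ` ?D'" by blast
  qed
  then have VD: "V' \<subseteq> ?D'"
    by (rule flow_corresp_subset[OF corr2 V'(1) top.kernel_closed_inv])
  obtain w where w: "w \<in> W" "compose A \<kappa> y = compose A \<kappa> (compose A r w)"
    using y(2) by blast
  have wP: "w \<in> A \<rightarrow>\<^sub>E topspace Y'" by (rule closed_inv_PiE[OF W w(1)])
  have rw: "compose A r w \<in> A \<rightarrow>\<^sub>E topspace Y"
    using r_onto by (intro compose_PiE[OF wP]) blast
  obtain y' where y': "y' \<in> A \<rightarrow>\<^sub>E topspace Y'" "compose A r y' = y"
    using compose_onto[OF r_onto y(1)] .
  have "pairing A (compose A r w) y = compose ?AA r (pairing A w y')"
    by (simp add: compose_pairing y'(2))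
  then have "pairing A (compose A r w) y \<in> compose ?AA r ` ?W"
    using w(1) y'(1) by blast
  moreover have "pairing A (compose A r w) y \<in> ?D"
    using rw y(1) w(2)[symmetric] by blast
  ultimately have "pairing A (compose A r w) y \<in> compose ?AA r ` V'"
    using V'(2) by blast
  then obtain v where v: "v \<in> V'" "pairing A (compose A r w) y = compose ?AA r v"
    by blast
  obtain a b where ab: "a \<in> W" "b \<in> A \<rightarrow>\<^sub>E topspace Y'" "v = pairing A a b"
    using v(1) VW by blast
  have aP: "a \<in> A \<rightarrow>\<^sub>E topspace Y'" by (rule closed_inv_PiE[OF W ab(1)])
  obtain a2 b2 where ab2: "v = pairing A a2 b2" "a2 \<in> A \<rightarrow>\<^sub>E topspace Y'" "b2 \<in> A \<rightarrow>\<^sub>E topspace Y'"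
      "compose A \<kappa>' a2 = compose A \<kappa>' b2"
    using v(1) VD by blast
  have "a = a2" "b = b2"
    using ab(2,3) ab2(1-3) aP by (simp_all add: pairing_eq_iff PiE_def)
  then have "compose A \<kappa>' b \<in> compose A \<kappa>' ` W"
    using ab2(4) ab(1) by (metis imageI)
  moreover have "compose A r b = y"
    using v(2) y(1) unfolding ab(3) compose_pairing by (simp add: pairing_eq_iff PiE_def)
  ultimately show ?thesis
    using ab(2) by blast
qed

text \<open>Sets are pulled back along \<open>\<kappa>'\<close>, restricted by \<open>r\<close> and
  pushed forward along \<open>\<kappa>\<close>. Order reflection requires that \<open>r\<close> maps
  full preimages under \<open>\<kappa>'\<close> to sets closed under
  \<open>\<kappa>\<close>-equivalence, which is \<open>saturation\<close>.\<close>

theorem flow_corresp_quotient: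
  assumes corr2: "flow_corresp Y' H' Y H r (A <+> A)" and corr: "flow_corresp Y' H' Y H r A"
  shows "flow_corresp Q' K' Q K \<rho> A"
proof -
  let ?pre = "\<lambda>Z. {x \<in> A \<rightarrow>\<^sub>E topspace Y'. compose A \<kappa>' x \<in> Z}"
  have pre_img: "compose A \<kappa>' ` ?pre Z = Z" if Z: "closed_inv Q' K' A Z" for Z
  proof
    show "Z \<subseteq> compose A \<kappa>' ` ?pre Z"
    proof
      fix q assume q: "q \<in> Z"
      obtain x where "x \<in> A \<rightarrow>\<^sub>E topspace Y'" "compose A \<kappa>' x = q"
        using compose_onto[OF top.onto closed_inv_PiE[OF Z q]] .
      then show "q \<in> compose A \<kappa>' ` ?pre Z"
        using q by blast
    qed
  qed blast
  have img: "compose A \<rho> ` compose A \<kappa>' ` W = compose A \<kappa> ` compose A r ` W"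
    if "W \<subseteq> A \<rightarrow>\<^sub>E topspace Y'" for W
    unfolding image_image by (intro image_cong refl compose_\<rho>) (use that in blast)
  have img_pre: "compose A \<rho> ` Z = compose A \<kappa> ` compose A r ` ?pre Z" if "closed_inv Q' K' A Z" for Z
    using img[of "?pre Z"] pre_img[OF that] by auto
  have cinv_pre: "closed_inv Y' H' A (?pre Z)" if "closed_inv Q' K' A Z" for Z
    by (rule top.preimage_closed_inv[OF that])
  show ?thesis
    unfolding flow_corresp_def
  proof (intro conjI allI impI)
    fix Z assume "closed_inv Q' K' A Z"
    then show "closed_inv Q K A (compose A \<rho> ` Z)"
      unfolding img_pre[OF \<open>closed_inv Q' K' A Z\<close>]
      by (intro base.image_closed_inv flow_corresp_image[OF corr] cinv_pre)
  next
    fix Z assume Z: "closed_inv Q K A Z"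
    let ?X = "{x \<in> A \<rightarrow>\<^sub>E topspace Y. compose A \<kappa> x \<in> Z}"
    obtain W where W: "closed_inv Y' H' A W" "compose A r ` W = ?X"
      using flow_corresp_lift[OF corr base.preimage_closed_inv[OF Z]] by blast
    have "compose A \<kappa> ` ?X = Z"
    proof
      show "Z \<subseteq> compose A \<kappa> ` ?X"
      proof
        fix q assume q: "q \<in> Z"
        obtain x where "x \<in> A \<rightarrow>\<^sub>E topspace Y" "compose A \<kappa> x = q"
          using compose_onto[OF base.onto closed_inv_PiE[OF Z q]] .
        then show "q \<in> compose A \<kappa> ` ?X"
          using q by blast
      qed
    qed blast
    moreover have "W \<subseteq> A \<rightarrow>\<^sub>E topspace Y'"
      using closed_inv_PiE[OF W(1)] by blast
    ultimately have "compose A \<rho> ` compose A \<kappa>' ` W = Z"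
      using img[of W] W(2) by simp
    then show "\<exists>Z'. closed_inv Q' K' A Z' \<and> compose A \<rho> ` Z' = Z"
      using top.image_closed_inv[OF W(1)] by blast
  next
    fix Z1 Z2
    assume Z: "closed_inv Q' K' A Z1" "closed_inv Q' K' A Z2" and sub: "compose A \<rho> ` Z1 \<subseteq> compose A \<rho> ` Z2"
    have "compose A r ` ?pre Z1 \<subseteq> compose A r ` ?pre Z2"
    proof
      fix y assume "y \<in> compose A r ` ?pre Z1"
      then obtain x where x: "x \<in> ?pre Z1" "y = compose A r x" by blast
      have yP: "y \<in> A \<rightarrow>\<^sub>E topspace Y"
        unfolding x(2) using x(1) r_onto by (intro compose_PiE[of x A "topspace Y'"]) auto
      have "compose A \<kappa> y \<in> compose A \<rho> ` Z1"
        unfolding img_pre[OF Z(1)] using x by blast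
      then have "compose A \<kappa> y \<in> compose A \<kappa> ` compose A r ` ?pre Z2"
        using sub img_pre[OF Z(2)] by blast
      then obtain x2 where x2: "x2 \<in> A \<rightarrow>\<^sub>E topspace Y'" "compose A r x2 = y"
          "compose A \<kappa>' x2 \<in> compose A \<kappa>' ` ?pre Z2"
        using saturation[OF corr2 cinv_pre[OF Z(2)] yP] by blast
      then have "x2 \<in> ?pre Z2"
        using pre_img[OF Z(2)] by simp
      then show "y \<in> compose A r ` ?pre Z2"
        using x2(2) by blast
    qed
    then have "?pre Z1 \<subseteq> ?pre Z2"
      by (rule flow_corresp_subset[OF corr cinv_pre[OF Z(1)] cinv_pre[OF Z(2)]])
    from image_mono[OF this, of "compose A \<kappa>'"] show "Z1 \<subseteq> Z2"
      unfolding pre_img[OF Z(1)] pre_img[OF Z(2)] .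
  qed
qed

end

section \<open>Quotients of compact Hausdorff spaces by closed equivalence relations\<close>

lemma continuous_map_quotient_topology:
  "continuous_map Y (quotient_topology Y R) (\<lambda>y. R `` {y})"
  by (auto simp: continuous_map_def openin_quotient_topology topspace_quotient_topology intro: quotientI)

text \<open>The quotient map is closed: the union of the classes meeting a closed \<open>S\<close>
  is the projection of the compact set \<open>R \<inter> (S \<times> topspace Y)\<close>. A closed
  continuous map from a normal Hausdorff space has a Hausdorff image.\<close>

lemma Hausdorff_quotient_topology:
  assumes comp: "compact_space Y" and Haus: "Hausdorff_space Y"
    and R: "equiv (topspace Y) R" and cl: "closedin (prod_topology Y Y) R"
  shows "Hausdorff_space (quotient_topology Y R)"
proof -
  let ?\<kappa> = "\<lambda>y. R `` {y}" and ?Q = "quotient_topology Y R"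
  have "closed_map Y ?Q ?\<kappa>"
    unfolding closed_map_def
  proof (intro allI impI)
    fix S assume S: "closedin Y S"
    have SY: "S \<subseteq> topspace Y" by (rule closedin_subset[OF S])
    have RY: "R \<subseteq> topspace Y \<times> topspace Y"
      using R by (auto simp: equiv_def refl_on_def)
    have "compactin (prod_topology Y Y) (R \<inter> (S \<times> topspace Y))"
      using comp cl S
      by (intro closedin_compact_space closedin_Int)
         (auto simp: compact_space_prod_topology closedin_prod_Times_iff)
    then have "closedin Y (snd ` (R \<inter> (S \<times> topspace Y)))"
      using image_compactin[OF _ continuous_map_snd] compactin_imp_closedin[OF Haus] by blast
    also have "snd ` (R \<inter> (S \<times> topspace Y)) = {y \<in> topspace Y. ?\<kappa> y \<in> ?\<kappa> ` S}"
    proof -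
      have "y \<in> snd ` (R \<inter> (S \<times> topspace Y)) \<longleftrightarrow> y \<in> topspace Y \<and> ?\<kappa> y \<in> ?\<kappa> ` S" for y
      proof
        assume "y \<in> snd ` (R \<inter> (S \<times> topspace Y))"
        then obtain s where s: "s \<in> S" "(s, y) \<in> R" by auto
        then show "y \<in> topspace Y \<and> ?\<kappa> y \<in> ?\<kappa> ` S"
          using equiv_class_eq[OF R s(2)] RY by (metis (no_types, lifting) SigmaD2 imageI subsetD)
      next
        assume y: "y \<in> topspace Y \<and> ?\<kappa> y \<in> ?\<kappa> ` S"
        then obtain s where s: "s \<in> S" "?\<kappa> y = ?\<kappa> s" by blast
        then have "(s, y) \<in> R"
          using eq_equiv_class[OF s(2)[symmetric] R] y by blast
        then show "y \<in> snd ` (R \<inter> (S \<times> topspace Y))"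
          using s y by force
      qed
      then show ?thesis by blast
    qed
    finally have cS: "closedin Y {y \<in> topspace Y. ?\<kappa> y \<in> ?\<kappa> ` S}" .
    have "{y \<in> topspace Y. ?\<kappa> y \<in> topspace Y // R - ?\<kappa> ` S} = topspace Y - {y \<in> topspace Y. ?\<kappa> y \<in> ?\<kappa> ` S}"
      by (auto intro: quotientI)
    then have "openin Y {y \<in> topspace Y. ?\<kappa> y \<in> topspace Y // R - ?\<kappa> ` S}"
      using cS by auto
    then show "closedin ?Q (?\<kappa> ` S)"
      using SY by (auto simp: closedin_def openin_quotient_topology topspace_quotient_topology intro: quotientI)
  qed
  moreover have "normal_space Y"
    by (rule compact_Hausdorff_or_regular_imp_normal_space) (use comp Haus in auto)
  moreover have "?\<kappa> ` topspace Y = topspace ?Q"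
    by (auto simp: topspace_quotient_topology quotient_def)
  ultimately show ?thesis
    using normal_Hausdorff_space_closed_continuous_map_image[OF _ Haus _ continuous_map_quotient_topology]
    by blast
qed

section \<open>Formulas and automorphisms\<close>

lemma teval_rename: "teval M v e (trename w t) = teval M (\<lambda>x. v (w x)) e t"
proof (induction t)
  case (Fn f ts)
  then have "map (teval M v e \<circ> trename w) ts = map (teval M (\<lambda>x. v (w x)) e) ts"
    by simp
  then show ?case by (simp only: tm.map teval.simps list.map_comp)
qed auto

lemma sat_rename: "sat M v e (rename w \<phi>) \<longleftrightarrow> sat M (\<lambda>x. v (w x)) e \<phi>"
proof (induction \<phi> arbitrary: e)
  case (Rel P ts)
  have "map (teval M v e \<circ> trename w) ts = map (teval M (\<lambda>x. v (w x)) e) ts"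
    by (simp add: teval_rename)
  then show ?case by (simp only: fm.map sat.simps list.map_comp)
qed (auto simp: teval_rename)

lemma holds_rename: "holds M v (rename w \<phi>) \<longleftrightarrow> holds M (v \<circ> w) \<phi>"
  by (simp add: holds_def sat_rename o_def)

lemma teval_cong:
  "\<forall>x\<in>tatoms t. v x = v' x \<Longrightarrow> \<forall>n\<in>bvars_tm t. e n = e' n \<Longrightarrow> teval M v e t = teval M v' e' t"
proof (induction t)
  case (Fn f ts)
  have "map (teval M v e) ts = map (teval M v' e') ts"
    by (intro map_cong refl Fn.IH) (use Fn.prems in auto)
  then show ?case by (simp only: teval.simps)
qed auto

lemma sat_cong:
  "\<forall>x\<in>atoms \<phi>. v x = v' x \<Longrightarrow> \<forall>n\<in>unbound \<phi>. e n = e' n \<Longrightarrow> sat M v e \<phi> \<longleftrightarrow> sat M v' e' \<phi>"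
proof (induction \<phi> arbitrary: e e')
  case (Eq s t)
  then show ?case using teval_cong[of s v v' e e' M] teval_cong[of t v v' e e' M] by simp
next
  case (Rel P ts)
  have "map (teval M v e) ts = map (teval M v' e') ts"
    by (intro map_cong refl teval_cong) (use Rel.prems in auto)
  then show ?case by (simp only: sat.simps)
next
  case (Conj \<phi> \<psi>)
  have "sat M v e \<phi> \<longleftrightarrow> sat M v' e' \<phi>" "sat M v e \<psi> \<longleftrightarrow> sat M v' e' \<psi>"
    using Conj.prems by (auto intro!: Conj.IH)
  then show ?case by simp
next
  case (Ex n \<phi>)
  have "sat M v (e(n := d)) \<phi> \<longleftrightarrow> sat M v' (e'(n := d)) \<phi>" for d
    using Ex.prems by (intro Ex.IH) auto
  then show ?case by simp
qed auto

lemma holds_cong: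
  assumes "\<phi> \<in> fmls L V" "\<And>x. x \<in> V \<Longrightarrow> v x = v' x"
  shows "holds M v \<phi> \<longleftrightarrow> holds M v' \<phi>"
  unfolding holds_def using assms by (intro sat_cong) (auto simp: fmls_def)

lemma sat_holds: "\<phi> \<in> fmls L V \<Longrightarrow> sat M v e \<phi> \<longleftrightarrow> holds M v \<phi>"
  unfolding holds_def by (intro sat_cong) (auto simp: fmls_def)

lemma holds_Neg [simp]: "holds M v (Neg \<phi>) \<longleftrightarrow> \<not> holds M v \<phi>"
  and holds_Conj [simp]: "holds M v (Conj \<phi> \<psi>) \<longleftrightarrow> holds M v \<phi> \<and> holds M v \<psi>"
  by (simp_all add: holds_def)

lemma wf_tm_rename [simp]: "wf_tm L (trename w t) \<longleftrightarrow> wf_tm L t"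
  by (induction t) auto

lemma wf_fm_rename [simp]: "wf_fm L (rename w \<phi>) \<longleftrightarrow> wf_fm L \<phi>"
  by (induction \<phi>) auto

lemma bvars_tm_rename [simp]: "bvars_tm (trename w t) = bvars_tm t"
  by (induction t) auto

lemma unbound_rename [simp]: "unbound (rename w \<phi>) = unbound \<phi>"
  by (induction \<phi>) auto

lemma fmls_rename: "\<phi> \<in> fmls L V \<Longrightarrow> w ` V \<subseteq> V' \<Longrightarrow> rename w \<phi> \<in> fmls L V'"
  by (auto simp: fmls_def fm.set_map)

lemma fmls_mono: "V \<subseteq> V' \<Longrightarrow> fmls L V \<subseteq> fmls L V'"
  by (auto simp: fmls_def)

lemma rename_cong: "\<phi> \<in> fmls L V \<Longrightarrow> (\<And>x. x \<in> V \<Longrightarrow> w x = w' x) \<Longrightarrow> rename w \<phi> = rename w' \<phi>"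
  by (intro fm.map_cong refl) (auto simp: fmls_def)

lemma rename_idI: "\<phi> \<in> fmls L V \<Longrightarrow> (\<And>x. x \<in> V \<Longrightarrow> w x = x) \<Longrightarrow> rename w \<phi> = \<phi>"
  using rename_cong[of \<phi> L V w id] by (simp add: fm.map_id)

lemma rename_rename: "rename w (rename w' \<phi>) = rename (w \<circ> w') \<phi>"
  by (simp add: fm.map_comp)

lemma Neg_fmls [simp]: "Neg \<phi> \<in> fmls L V \<longleftrightarrow> \<phi> \<in> fmls L V"
  and Conj_fmls [simp]: "Conj \<phi> \<psi> \<in> fmls L V \<longleftrightarrow> \<phi> \<in> fmls L V \<and> \<psi> \<in> fmls L V"
  by (auto simp: fmls_def)

lemma finite_tatoms: "finite (tatoms t)"
  by (induction t) auto

lemma finite_atoms: "finite (atoms \<phi>)"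
  by (induction \<phi>) (auto simp: finite_tatoms)

lemma finite_params:
  assumes "\<phi> \<in> fmls L (I <+> A)"
  obtains a where "finite a" "a \<subseteq> A" "\<phi> \<in> fmls L (I <+> a)"
proof
  show "finite (Inr -` atoms \<phi>)"
    by (rule finite_vimageI[OF finite_atoms]) (simp add: inj_on_def)
  show "Inr -` atoms \<phi> \<subseteq> A" "\<phi> \<in> fmls L (I <+> (Inr -` atoms \<phi>))"
    using assms by (auto simp: fmls_def)
qed

text \<open>One formula serves all structures at once, since it will be read both in
  \<open>C\<close> and in \<open>C'\<close>.\<close>

lemma finite_conjunction:
  assumes "finite q" "q \<subseteq> fmls L V"
  shows "\<exists>\<xi>\<in>fmls L V. \<forall>(M :: ('f, 'p, 'a) struct) v. holds M v \<xi> \<longleftrightarrow> (\<forall>\<phi>\<in>q. holds M v \<phi>)"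
  using assms
proof (induction q rule: finite_induct)
  case empty
  \<comment> \<open>\<open>?t\<close> fails when the universe is empty, which is possible for an
    arbitrary record \<open>M\<close>; hence the tautology is propositional in
    \<open>?t\<close>.\<close>
  let ?t = "Ex 0 (Eq (BVar 0) (BVar 0)) :: ('f, 'p, 'c) fm"
  have "?t \<in> fmls L V" by (simp add: fmls_def)
  then show ?case by (intro bexI[of _ "Neg (Conj ?t (Neg ?t))"]) auto
next
  case (insert \<phi> q)
  then obtain \<xi> where "\<xi> \<in> fmls L V"
    "\<forall>(M :: ('f, 'p, 'a) struct) v. holds M v \<xi> \<longleftrightarrow> (\<forall>\<phi>\<in>q. holds M v \<phi>)"
    by auto
  then show ?case
    using insert.prems by (intro bexI[of _ "Conj \<phi> \<xi>"]) auto
qed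

text \<open>Atoms are never quantified, so quantifying over an atom first requires replacing it by
  some \<open>BVar n\<close>.\<close>

fun tm_bind :: "'v \<Rightarrow> nat \<Rightarrow> ('f, 'v) tm \<Rightarrow> ('f, 'v) tm" where
  "tm_bind k n (BVar m) = BVar m"
| "tm_bind k n (Atom x) = (if x = k then BVar n else Atom x)"
| "tm_bind k n (Fn f ts) = Fn f (map (tm_bind k n) ts)"

fun fm_bind :: "'v \<Rightarrow> nat \<Rightarrow> ('f, 'p, 'v) fm \<Rightarrow> ('f, 'p, 'v) fm" where
  "fm_bind k n (Eq s t) = Eq (tm_bind k n s) (tm_bind k n t)"
| "fm_bind k n (Rel P ts) = Rel P (map (tm_bind k n) ts)"
| "fm_bind k n (Neg \<phi>) = Neg (fm_bind k n \<phi>)"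
| "fm_bind k n (Conj \<phi> \<psi>) = Conj (fm_bind k n \<phi>) (fm_bind k n \<psi>)"
| "fm_bind k n (Ex m \<phi>) = Ex m (fm_bind k n \<phi>)"

text \<open>The indices that could capture a newly inserted \<open>BVar n\<close>.\<close>

fun quantified :: "('f, 'p, 'v) fm \<Rightarrow> nat set" where
  "quantified (Neg \<phi>) = quantified \<phi>"
| "quantified (Conj \<phi> \<psi>) = quantified \<phi> \<union> quantified \<psi>"
| "quantified (Ex m \<phi>) = insert m (quantified \<phi>)"
| "quantified _ = {}"

lemma finite_quantified: "finite (quantified \<phi>)"
  by (induction \<phi> rule: quantified.induct) auto

lemma teval_bind: "teval M v e (tm_bind k n t) = teval M (v(k := e n)) e t"
proof (induction t)
  case (Fn f ts)
  have "map (teval M v e) (map (tm_bind k n) ts) = map (teval M (v(k := e n)) e) ts"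
    unfolding map_map by (rule map_cong[OF refl]) (simp only: o_apply Fn.IH)
  then show ?case by (simp only: tm_bind.simps teval.simps)
qed auto

lemma sat_bind: "n \<notin> quantified \<phi> \<Longrightarrow> sat M v e (fm_bind k n \<phi>) \<longleftrightarrow> sat M (v(k := e n)) e \<phi>"
proof (induction \<phi> arbitrary: e)
  case (Rel P ts)
  have "map (teval M v e \<circ> tm_bind k n) ts = map (teval M (v(k := e n)) e) ts"
    by (simp add: teval_bind)
  then show ?case by (simp only: fm_bind.simps sat.simps list.map_comp)
qed (auto simp: teval_bind)

lemma wf_tm_bind: "wf_tm L (tm_bind k n t) \<longleftrightarrow> wf_tm L t"
  by (induction t) auto

lemma wf_fm_bind: "wf_fm L (fm_bind k n \<phi>) \<longleftrightarrow> wf_fm L \<phi>"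
  by (induction \<phi>) (auto simp: wf_tm_bind)

lemma tatoms_bind: "tatoms (tm_bind k n t) = tatoms t - {k}"
  by (induction t) auto

lemma atoms_bind: "atoms (fm_bind k n \<phi>) = atoms \<phi> - {k}"
  by (induction \<phi>) (auto simp: tatoms_bind)

lemma bvars_bind: "bvars_tm (tm_bind k n t) \<subseteq> insert n (bvars_tm t)"
  by (induction t) auto

lemma unbound_bind: "unbound (fm_bind k n \<phi>) \<subseteq> insert n (unbound \<phi>)"
proof (induction \<phi>)
  case (Eq s t)
  then show ?case using bvars_bind[of k n s] bvars_bind[of k n t] by auto
next
  case (Rel P ts)
  then show ?case using bvars_bind[of k n] by fastforce
qed auto

lemma ex_atom:
  assumes \<phi>: "\<phi> \<in> fmls L (insert k V)"
  shows "\<exists>\<psi>\<in>fmls L V. \<forall>(M :: ('f, 'p, 'a) struct) v. holds M v \<psi> \<longleftrightarrow> (\<exists>d\<in>univ M. holds M (v(k := d)) \<phi>)"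
proof -
  obtain n where n: "n \<notin> quantified \<phi>"
    using ex_new_if_finite[OF infinite_UNIV_nat finite_quantified] by blast
  have "Ex n (fm_bind k n \<phi>) \<in> fmls L V"
    using \<phi> unbound_bind[of k n \<phi>] by (auto simp: fmls_def wf_fm_bind atoms_bind)
  moreover have "holds M v (Ex n (fm_bind k n \<phi>)) \<longleftrightarrow> (\<exists>d\<in>univ M. holds M (v(k := d)) \<phi>)"
    for M :: "('f, 'p, 'a) struct" and v
    by (simp add: holds_def[of M v] sat_bind[OF n] sat_holds[OF \<phi>])
  ultimately show ?thesis by (intro bexI[of _ "Ex n (fm_bind k n \<phi>)"] allI)
qed

lemma ex_atoms:
  assumes "finite K" "\<phi> \<in> fmls L (K \<union> V)"
  shows "\<exists>\<psi>\<in>fmls L V. \<forall>(M :: ('f, 'p, 'a) struct) v. holds M v \<psi> \<longleftrightarrow>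
    (\<exists>w. (\<forall>k\<in>K. w k \<in> univ M) \<and> (\<forall>x. x \<notin> K \<longrightarrow> w x = v x) \<and> holds M w \<phi>)"
  using assms
proof (induction K arbitrary: V rule: finite_induct)
  case empty
  have *: "(\<forall>x. w x = v x) \<longleftrightarrow> w = v" for w v :: "'c \<Rightarrow> 'a"
    by (simp add: fun_eq_iff)
  show ?case
    by (rule bexI[of _ \<phi>]) (use empty in \<open>simp_all add: *\<close>)
next
  case (insert k K)
  have "\<phi> \<in> fmls L (K \<union> insert k V)" using insert.prems by simp
  from insert.IH[OF this] obtain \<psi> where \<psi>: "\<psi> \<in> fmls L (insert k V)"
    and "\<forall>(M :: ('f, 'p, 'a) struct) v. holds M v \<psi> \<longleftrightarrow>
      (\<exists>w. (\<forall>k\<in>K. w k \<in> univ M) \<and> (\<forall>x. x \<notin> K \<longrightarrow> w x = v x) \<and> holds M w \<phi>)"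
    by (rule bexE)
  note h = this(2)[THEN spec, THEN spec]
  from ex_atom[OF \<psi>] obtain \<theta> where \<theta>: "\<theta> \<in> fmls L V"
    and "\<forall>(M :: ('f, 'p, 'a) struct) v. holds M v \<theta> \<longleftrightarrow> (\<exists>d\<in>univ M. holds M (v(k := d)) \<psi>)"
    by (rule bexE)
  note h' = this(2)[THEN spec, THEN spec]
  have "holds M v \<theta> \<longleftrightarrow> (\<exists>w. (\<forall>k\<in>insert k K. w k \<in> univ M) \<and> (\<forall>x. x \<notin> insert k K \<longrightarrow> w x = v x) \<and> holds M w \<phi>)"
    (is "?l \<longleftrightarrow> ?r") for M :: "('f, 'p, 'a) struct" and v
  proof
    assume ?l
    then obtain d w where dw: "d \<in> univ M" "\<forall>k\<in>K. w k \<in> univ M" "\<forall>x. x \<notin> K \<longrightarrow> w x = (v(k := d)) x" "holds M w \<phi>"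
      unfolding h' h by blast
    moreover have "w k = d" using dw(3) insert.hyps(2) by simp
    ultimately show ?r by (intro exI[of _ w]) auto
  next
    assume ?r
    then obtain w where w: "\<forall>k\<in>insert k K. w k \<in> univ M" "\<forall>x. x \<notin> insert k K \<longrightarrow> w x = v x" "holds M w \<phi>"
      by blast
    have "w k \<in> univ M \<and> (\<forall>k\<in>K. w k \<in> univ M) \<and> (\<forall>x. x \<notin> K \<longrightarrow> w x = (v(k := w k)) x) \<and> holds M w \<phi>"
      using w by auto
    then show ?l
      unfolding h' h by blast
  qed
  then show ?case using \<theta> by (intro bexI[of _ \<theta>] allI)
qed

text \<open>Elementarity is given for the identity assignment; renaming atoms by \<open>v\<close>
  turns an arbitrary assignment into parameters.\<close>

lemma elementary_holds:
  assumes el: "elementary_substruct L C C'" and \<phi>: "\<phi> \<in> fmls L V" and v: "v ` V \<subseteq> univ C"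
  shows "holds C v \<phi> \<longleftrightarrow> holds C' v \<phi>"
proof -
  have "holds C (\<lambda>a. a) (rename v \<phi>) \<longleftrightarrow> holds C' (\<lambda>a. a) (rename v \<phi>)"
    using el fmls_rename[OF \<phi> v] by (auto simp: elementary_substruct_def)
  then show ?thesis by (simp add: holds_rename o_def)
qed

text \<open>Conjoin the formulas, quantify the variables away, transfer the resulting formula over
  \<open>A\<close> by elementarity, and read off witnesses in \<open>C\<close>.\<close>

lemma elementary_satisfiable:
  assumes el: "elementary_substruct L C C'" and ne: "univ C \<noteq> {}"
    and q: "finite q" "q \<subseteq> fmls L (I <+> A)" and A: "A \<subseteq> univ C"
    and c: "c \<in> I \<rightarrow> univ C'" "\<forall>\<phi>\<in>q. holds C' (case_sum c (\<lambda>a. a)) \<phi>"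
  shows "\<exists>c\<in>I \<rightarrow> univ C. \<forall>\<phi>\<in>q. holds C (case_sum c (\<lambda>a. a)) \<phi>"
proof -
  from finite_conjunction[OF q] obtain \<xi> where "\<xi> \<in> fmls L (I <+> A)"
    and "\<forall>(M :: ('a, 'b, 'c) struct) v. holds M v \<xi> \<longleftrightarrow> (\<forall>\<phi>\<in>q. holds M v \<phi>)"
    by (rule bexE)
  note \<xi> = this(1) this(2)[THEN spec, THEN spec]
  \<comment> \<open>\<open>I\<close> may be infinite, so only the variables occurring in
    \<open>\<xi>\<close> are quantified.\<close>
  define K where "K = atoms \<xi> \<inter> range Inl"
  have fin: "finite K" by (simp add: K_def finite_atoms)
  have KI: "K \<subseteq> Inl ` I" using \<xi>(1) by (auto simp: K_def fmls_def)
  have "atoms \<xi> \<subseteq> K \<union> Inr ` A"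
    using \<xi>(1) by (auto simp: K_def fmls_def)
  then have \<xi>K: "\<xi> \<in> fmls L (K \<union> Inr ` A)"
    using \<xi>(1) by (simp add: fmls_def)
  from ex_atoms[OF fin \<xi>K] obtain \<psi> where \<psi>: "\<psi> \<in> fmls L (Inr ` A)"
    and "\<forall>(M :: ('a, 'b, 'c) struct) v. holds M v \<psi> \<longleftrightarrow>
      (\<exists>w. (\<forall>k\<in>K. w k \<in> univ M) \<and> (\<forall>x. x \<notin> K \<longrightarrow> w x = v x) \<and> holds M w \<xi>)"
    by (rule bexE)
  note h = this(2)[THEN spec, THEN spec]
  let ?v = "case_sum (\<lambda>_. undefined) (\<lambda>a. a) :: 'd + 'c \<Rightarrow> 'c"
  let ?w = "\<lambda>x. if x \<in> K then case_sum c (\<lambda>a. a) x else ?v x"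
  have "holds C' ?w \<xi> \<longleftrightarrow> holds C' (case_sum c (\<lambda>a. a)) \<xi>"
    by (rule holds_cong[OF \<xi>K]) auto
  moreover have "\<forall>k\<in>K. ?w k \<in> univ C'"
    using KI c(1) by (auto simp: Pi_def)
  ultimately have "holds C' ?v \<psi>"
    unfolding h using c(2) \<xi>(2) by (intro exI[of _ ?w]) auto
  then have "holds C ?v \<psi>"
    using elementary_holds[OF el \<psi>, of ?v] A by (simp add: image_image)
  then obtain w where w: "\<forall>k\<in>K. w k \<in> univ C" "\<forall>x. x \<notin> K \<longrightarrow> w x = ?v x" "holds C w \<xi>"
    unfolding h by blast
  obtain d where d: "d \<in> univ C" using ne by blast
  \<comment> \<open>The remaining variables take the arbitrary value \<open>d\<close>, as all of
    \<open>I\<close> must be sent into the universe.\<close>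
  let ?c = "\<lambda>i. if Inl i \<in> K then w (Inl i) else d"
  have "w x = case_sum ?c (\<lambda>a. a) x" if "x \<in> K \<union> Inr ` A" for x
    using that KI w(2) by (auto simp: K_def)
  then have "holds C (case_sum ?c (\<lambda>a. a)) \<xi>"
    using w(3) holds_cong[OF \<xi>K] by blast
  then show ?thesis
    using w(1) d \<xi>(2) by (intro bexI[of _ ?c]) auto
qed

section \<open>Automorphisms: group operations and preservation of truth\<close>

lemma Aut_Bij: "\<sigma> \<in> Aut L M \<Longrightarrow> \<sigma> \<in> Bij (univ M)"
  by (simp add: Aut_def)

lemma Aut_bij: "\<sigma> \<in> Aut L M \<Longrightarrow> bij_betw \<sigma> (univ M) (univ M)"
  by (auto simp: Aut_def Bij_def)

lemma Aut_in: "\<sigma> \<in> Aut L M \<Longrightarrow> a \<in> univ M \<Longrightarrow> \<sigma> a \<in> univ M"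
  using Aut_bij[of \<sigma> L M] by (auto simp: bij_betw_def)

lemma Aut_id: "is_struct L M \<Longrightarrow> (\<lambda>a\<in>univ M. a) \<in> Aut L M"
  unfolding Aut_def
proof (intro CollectI conjI ballI)
  show "(\<lambda>a\<in>univ M. a) \<in> Bij (univ M)" by (rule id_Bij)
  have "map (\<lambda>a\<in>univ M. a) xs = xs" if "xs \<in> tuples M n" for xs n
    using that by (intro map_idI) (auto simp: tuples_def)
  then show "pint M P (map (\<lambda>a\<in>univ M. a) xs) = pint M P xs" if "xs \<in> tuples M (parity L P)" for P xs
    using that by metis
  fix f xs assume M: "is_struct L M" and f: "f \<in> fsyms L" and xs: "xs \<in> tuples M (farity L f)"
  then have "fint M f xs \<in> univ M" by (auto simp: is_struct_def)
  then show "(\<lambda>a\<in>univ M. a) (fint M f xs) = fint M f (map (\<lambda>a\<in>univ M. a) xs)"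
    using \<open>\<And>xs n. xs \<in> tuples M n \<Longrightarrow> map (\<lambda>a\<in>univ M. a) xs = xs\<close>[OF xs] by simp
qed

lemma Aut_tuples: "\<sigma> \<in> Aut L M \<Longrightarrow> xs \<in> tuples M n \<Longrightarrow> map \<sigma> xs \<in> tuples M n"
  using Aut_in by (fastforce simp: tuples_def)

lemma Aut_compose:
  assumes M: "is_struct L M" and \<sigma>: "\<sigma> \<in> Aut L M" and \<tau>: "\<tau> \<in> Aut L M"
  shows "compose (univ M) \<sigma> \<tau> \<in> Aut L M"
proof -
  have m: "map (compose (univ M) \<sigma> \<tau>) xs = map \<sigma> (map \<tau> xs)" if "xs \<in> tuples M n" for xs n
    using that by (auto simp: tuples_def compose_def)
  show ?thesis
    unfolding Aut_def
  proof (intro CollectI conjI ballI)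
    show "compose (univ M) \<sigma> \<tau> \<in> Bij (univ M)"
      by (rule compose_Bij[OF Aut_Bij[OF \<sigma>] Aut_Bij[OF \<tau>]])
    fix f xs assume f: "f \<in> fsyms L" and xs: "xs \<in> tuples M (farity L f)"
    then have "fint M f xs \<in> univ M" using M by (auto simp: is_struct_def)
    then show "compose (univ M) \<sigma> \<tau> (fint M f xs) = fint M f (map (compose (univ M) \<sigma> \<tau>) xs)"
      unfolding m[OF xs] using \<sigma> \<tau> f xs Aut_tuples[OF \<tau> xs] by (auto simp: Aut_def compose_eq)
  next
    fix P xs assume P: "P \<in> psyms L" and xs: "xs \<in> tuples M (parity L P)"
    show "pint M P (map (compose (univ M) \<sigma> \<tau>) xs) = pint M P xs"
      unfolding m[OF xs] using \<sigma> \<tau> P xs Aut_tuples[OF \<tau> xs] by (simp add: Aut_def del: map_map)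
  qed
qed

text \<open>Members of \<open>Bij\<close> are extensional, hence the restriction of the
  inverse.\<close>

definition Aut_inv :: "('f, 'p, 'a) struct \<Rightarrow> ('a \<Rightarrow> 'a) \<Rightarrow> 'a \<Rightarrow> 'a" where
  "Aut_inv M \<sigma> = (\<lambda>a\<in>univ M. inv_into (univ M) \<sigma> a)"

lemma Aut_inv_left: "\<sigma> \<in> Aut L M \<Longrightarrow> a \<in> univ M \<Longrightarrow> Aut_inv M \<sigma> (\<sigma> a) = a"
  using Aut_bij Aut_in by (fastforce simp: Aut_inv_def bij_betw_def)

lemma Aut_inv_right: "\<sigma> \<in> Aut L M \<Longrightarrow> a \<in> univ M \<Longrightarrow> \<sigma> (Aut_inv M \<sigma> a) = a"
  using Aut_bij[of \<sigma> L M] by (auto simp: Aut_inv_def bij_betw_def intro: f_inv_into_f)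

lemma Aut_inv:
  assumes M: "is_struct L M" and \<sigma>: "\<sigma> \<in> Aut L M"
  shows "Aut_inv M \<sigma> \<in> Aut L M"
proof -
  let ?\<tau> = "Aut_inv M \<sigma>"
  have B: "?\<tau> \<in> Bij (univ M)"
    unfolding Aut_inv_def by (rule restrict_inv_into_Bij[OF Aut_Bij[OF \<sigma>]])
  then have in_M: "?\<tau> a \<in> univ M" if "a \<in> univ M" for a
    using that by (auto simp: Bij_def bij_betw_def)
  have tup: "map ?\<tau> xs \<in> tuples M n" if "xs \<in> tuples M n" for xs n
    using that in_M by (fastforce simp: tuples_def)
  have m: "map \<sigma> (map ?\<tau> xs) = xs" if "xs \<in> tuples M n" for xs n
    unfolding map_map using that Aut_inv_right[OF \<sigma>] by (intro map_idI) (auto simp: tuples_def)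
  show ?thesis
    unfolding Aut_def
  proof (intro CollectI conjI ballI B)
    fix f xs assume f: "f \<in> fsyms L" and xs: "xs \<in> tuples M (farity L f)"
    have "\<sigma> (fint M f (map ?\<tau> xs)) = fint M f (map \<sigma> (map ?\<tau> xs))"
      using \<sigma> f tup[OF xs] unfolding Aut_def by blast
    then have "fint M f xs = \<sigma> (fint M f (map ?\<tau> xs))"
      by (simp only: m[OF xs])
    moreover have "fint M f (map ?\<tau> xs) \<in> univ M"
      using M f tup[OF xs] by (auto simp: is_struct_def)
    ultimately show "?\<tau> (fint M f xs) = fint M f (map ?\<tau> xs)"
      using Aut_inv_left[OF \<sigma>] by simp
  next
    fix P xs assume P: "P \<in> psyms L" and xs: "xs \<in> tuples M (parity L P)"
    have "pint M P (map \<sigma> (map ?\<tau> xs)) = pint M P (map ?\<tau> xs)"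
      using \<sigma> P tup[OF xs] unfolding Aut_def by blast
    then show "pint M P (map ?\<tau> xs) = pint M P xs"
      by (simp only: m[OF xs])
  qed
qed

lemma teval_in:
  "is_struct L M \<Longrightarrow> wf_tm L t \<Longrightarrow> \<forall>x\<in>tatoms t. v x \<in> univ M \<Longrightarrow> range e \<subseteq> univ M \<Longrightarrow> teval M v e t \<in> univ M"
proof (induction t)
  case (Fn f ts)
  have "map (teval M v e) ts \<in> tuples M (farity L f)"
    using Fn by (auto simp: tuples_def)
  then show ?case
    using Fn.prems by (auto simp: is_struct_def)
qed auto

lemma teval_Aut:
  assumes M: "is_struct L M" and \<sigma>: "\<sigma> \<in> Aut L M"
  shows "wf_tm L t \<Longrightarrow> \<forall>x\<in>tatoms t. v x \<in> univ M \<Longrightarrow> range e \<subseteq> univ M \<Longrightarrow>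
    teval M (\<sigma> \<circ> v) (\<sigma> \<circ> e) t = \<sigma> (teval M v e t)"
proof (induction t)
  case (Fn f ts)
  have "map (teval M v e) ts \<in> tuples M (farity L f)"
    using Fn.prems by (auto simp: tuples_def intro!: teval_in[OF M])
  then have "\<sigma> (fint M f (map (teval M v e) ts)) = fint M f (map \<sigma> (map (teval M v e) ts))"
    using \<sigma> Fn.prems by (auto simp: Aut_def)
  moreover have "map (teval M (\<sigma> \<circ> v) (\<sigma> \<circ> e)) ts = map \<sigma> (map (teval M v e) ts)"
    unfolding map_map
  proof (rule map_cong[OF refl])
    fix t assume "t \<in> set ts"
    then show "teval M (\<sigma> \<circ> v) (\<sigma> \<circ> e) t = (\<sigma> \<circ> teval M v e) t"
      unfolding o_apply[of \<sigma> "teval M v e"] using Fn.prems by (intro Fn.IH) auto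
  qed
  ultimately show ?case by (simp only: teval.simps)
qed auto

lemma sat_Aut:
  assumes M: "is_struct L M" and \<sigma>: "\<sigma> \<in> Aut L M"
  shows "wf_fm L \<phi> \<Longrightarrow> \<forall>x\<in>atoms \<phi>. v x \<in> univ M \<Longrightarrow> range e \<subseteq> univ M \<Longrightarrow>
    sat M (\<sigma> \<circ> v) (\<sigma> \<circ> e) \<phi> \<longleftrightarrow> sat M v e \<phi>"
proof (induction \<phi> arbitrary: e)
  case (Eq s t)
  have ev: "teval M (\<sigma> \<circ> v) (\<sigma> \<circ> e) s = \<sigma> (teval M v e s)" "teval M (\<sigma> \<circ> v) (\<sigma> \<circ> e) t = \<sigma> (teval M v e t)"
    using Eq by (intro teval_Aut[OF M \<sigma>]; simp)+
  have mem: "teval M v e s \<in> univ M" "teval M v e t \<in> univ M"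
    using Eq by (intro teval_in[OF M]; simp)+
  show ?case
    unfolding sat.simps ev by (rule inj_on_eq_iff[OF bij_betw_imp_inj_on[OF Aut_bij[OF \<sigma>]] mem])
next
  case (Rel P ts)
  have "map (teval M v e) ts \<in> tuples M (parity L P)"
    using Rel.prems by (auto simp: tuples_def intro!: teval_in[OF M])
  then have "pint M P (map \<sigma> (map (teval M v e) ts)) = pint M P (map (teval M v e) ts)"
    using \<sigma> Rel.prems unfolding Aut_def by (auto simp del: map_map)
  moreover have "map (teval M (\<sigma> \<circ> v) (\<sigma> \<circ> e)) ts = map \<sigma> (map (teval M v e) ts)"
    unfolding map_map
  proof (rule map_cong[OF refl])
    fix t assume "t \<in> set ts"
    then show "teval M (\<sigma> \<circ> v) (\<sigma> \<circ> e) t = (\<sigma> \<circ> teval M v e) t"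
      unfolding o_apply[of \<sigma> "teval M v e"] using Rel.prems by (intro teval_Aut[OF M \<sigma>]) auto
  qed
  ultimately show ?case by (simp only: sat.simps)
next
  case (Ex n \<phi>)
  have step: "sat M (\<sigma> \<circ> v) ((\<sigma> \<circ> e)(n := \<sigma> d)) \<phi> \<longleftrightarrow> sat M v (e(n := d)) \<phi>" if "d \<in> univ M" for d
  proof -
    have eq: "(\<sigma> \<circ> e)(n := \<sigma> d) = \<sigma> \<circ> (e(n := d))" by auto
    have rng: "range (e(n := d)) \<subseteq> univ M" using Ex.prems that by auto
    show ?thesis unfolding eq by (rule Ex.IH[OF _ _ rng]) (use Ex.prems in auto)
  qed
  have img: "univ M = \<sigma> ` univ M" using Aut_bij[OF \<sigma>] by (simp add: bij_betw_def)
  have "(\<exists>d\<in>univ M. sat M (\<sigma> \<circ> v) ((\<sigma> \<circ> e)(n := d)) \<phi>) \<longleftrightarrow> (\<exists>d\<in>univ M. sat M (\<sigma> \<circ> v) ((\<sigma> \<circ> e)(n := \<sigma> d)) \<phi>)"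
    by (subst img) simp
  also have "\<dots> \<longleftrightarrow> (\<exists>d\<in>univ M. sat M v (e(n := d)) \<phi>)"
    by (intro bex_cong refl step)
  finally show ?case unfolding sat.simps .
qed auto

lemma holds_Aut:
  assumes M: "is_struct L M" and \<sigma>: "\<sigma> \<in> Aut L M" and \<phi>: "\<phi> \<in> fmls L V" and v: "v ` V \<subseteq> univ M"
  shows "holds M (\<sigma> \<circ> v) \<phi> \<longleftrightarrow> holds M v \<phi>"
proof -
  \<comment> \<open>The environment in \<open>holds\<close> is constantly \<open>undefined\<close>,
    possibly outside the universe; it is exchanged for a constant one inside, to which
    \<open>sat_Aut\<close> applies.\<close>
  obtain d where "d \<in> univ M" using M by (auto simp: is_struct_def)
  then have "sat M (\<sigma> \<circ> v) (\<sigma> \<circ> (\<lambda>_. d)) \<phi> \<longleftrightarrow> sat M v (\<lambda>_. d) \<phi>"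
    using \<phi> v by (intro sat_Aut[OF M \<sigma>]) (auto simp: fmls_def)
  then show ?thesis by (simp only: sat_holds[OF \<phi>])
qed

section \<open>Type spaces\<close>

abbreviation param_rename :: "('a \<Rightarrow> 'b) \<Rightarrow> ('f, 'p, 'i + 'a) fm \<Rightarrow> ('f, 'p, 'i + 'b) fm" where
  "param_rename \<sigma> \<equiv> rename (map_sum (\<lambda>i. i) \<sigma>)"

lemma param_rename_fmls: "\<phi> \<in> fmls L (I <+> A) \<Longrightarrow> \<sigma> ` A \<subseteq> B \<Longrightarrow> param_rename \<sigma> \<phi> \<in> fmls L (I <+> B)"
  by (erule fmls_rename) auto

lemma param_rename_cong:
  "\<phi> \<in> fmls L (I <+> A) \<Longrightarrow> (\<And>a. a \<in> A \<Longrightarrow> \<sigma> a = \<tau> a) \<Longrightarrow> param_rename \<sigma> \<phi> = param_rename \<tau> \<phi>"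
  by (erule rename_cong) auto

lemma param_rename_idI:
  "\<phi> \<in> fmls L (I <+> A) \<Longrightarrow> (\<And>a. a \<in> A \<Longrightarrow> \<sigma> a = a) \<Longrightarrow> param_rename \<sigma> \<phi> = \<phi>"
  by (erule rename_idI) auto

lemma param_rename_comp: "param_rename \<sigma> (param_rename \<tau> \<phi>) = param_rename (\<sigma> \<circ> \<tau>) \<phi>"
  unfolding rename_rename map_sum.comp by (simp add: o_def)

lemma type_spaceD:
  assumes "p \<in> type_space L I \<pi> M"
  shows "p \<subseteq> fmls L (I <+> univ M)" "\<pi> \<subseteq> p"
    and "\<And>q. finite q \<Longrightarrow> q \<subseteq> p \<Longrightarrow> \<exists>c\<in>I \<rightarrow> univ M. \<forall>\<phi>\<in>q. holds M (case_sum c (\<lambda>a. a)) \<phi>"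
    and "\<And>\<phi>. \<phi> \<in> fmls L (I <+> univ M) \<Longrightarrow> \<phi> \<in> p \<or> Neg \<phi> \<in> p"
  using assms by (auto simp: type_space_def complete_type_def partial_type_def)

lemma type_spaceI:
  assumes "p \<subseteq> fmls L (I <+> univ M)" "\<pi> \<subseteq> p"
    and "\<And>q. finite q \<Longrightarrow> q \<subseteq> p \<Longrightarrow> \<exists>c\<in>I \<rightarrow> univ M. \<forall>\<phi>\<in>q. holds M (case_sum c (\<lambda>a. a)) \<phi>"
    and "\<And>\<phi>. \<phi> \<in> fmls L (I <+> univ M) \<Longrightarrow> \<phi> \<in> p \<or> Neg \<phi> \<in> p"
  shows "p \<in> type_space L I \<pi> M"
  using assms by (auto simp: type_space_def complete_type_def partial_type_def)

lemma type_space_Neg: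
  assumes p: "p \<in> type_space L I \<pi> M" and \<phi>: "\<phi> \<in> fmls L (I <+> univ M)"
  shows "Neg \<phi> \<in> p \<longleftrightarrow> \<phi> \<notin> p"
proof -
  have "\<not> (\<phi> \<in> p \<and> Neg \<phi> \<in> p)"
    using type_spaceD(3)[OF p, of "{\<phi>, Neg \<phi>}"] by auto
  then show ?thesis
    using type_spaceD(4)[OF p \<phi>] by blast
qed

text \<open>Complete types are maximal: a formula missing from \<open>p\<close> has its negation in
  \<open>p\<close>, hence in \<open>q\<close>.\<close>

lemma type_space_eqI:
  assumes p: "p \<in> type_space L I \<pi> M" and q: "q \<in> type_space L I \<pi>' M" and "p \<subseteq> q"
  shows "p = q"
proof
  show "q \<subseteq> p"
  proof
    fix \<phi> assume "\<phi> \<in> q"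
    moreover from this have "\<phi> \<in> fmls L (I <+> univ M)" using type_spaceD(1)[OF q] by blast
    ultimately show "\<phi> \<in> p"
      using type_space_Neg[OF p] type_space_Neg[OF q] \<open>p \<subseteq> q\<close> by blast
  qed
qed fact

lemma realized_type:
  assumes "c \<in> I \<rightarrow> univ M"
  shows "{\<phi> \<in> fmls L (I <+> univ M). holds M (case_sum c (\<lambda>a. a)) \<phi>} \<in> type_space L I {} M"
  by (rule type_spaceI) (use assms in auto)

section \<open>The Stone topology: compactness and dependence on finitely many parameters\<close>

lemma openin_stone_basic:
  "\<phi> \<in> fmls L (I <+> univ M) \<Longrightarrow> openin (stone_topology L I \<pi> M) {p \<in> type_space L I \<pi> M. \<phi> \<in> p}"
  unfolding stone_topology_def by (rule topology_generated_by_Basis) blast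

lemma closedin_stone_basic:
  assumes "\<phi> \<in> fmls L (I <+> univ M)"
  shows "closedin (stone_topology L I \<pi> M) {p \<in> type_space L I \<pi> M. \<phi> \<in> p}"
proof -
  have "type_space L I \<pi> M - {p \<in> type_space L I \<pi> M. \<phi> \<in> p} = {p \<in> type_space L I \<pi> M. Neg \<phi> \<in> p}"
    using type_space_Neg[OF _ assms] by blast
  then show ?thesis
    using openin_stone_basic[of "Neg \<phi>" L I M \<pi>] assms
    by (auto simp: closedin_def topspace_stone_topology)
qed

lemma continuous_map_stone:
  assumes f: "f \<in> topspace X \<rightarrow> type_space L I \<pi> M"
    and op: "\<And>\<phi>. \<phi> \<in> fmls L (I <+> univ M) \<Longrightarrow> openin X {x \<in> topspace X. \<phi> \<in> f x}"
  shows "continuous_map X (stone_topology L I \<pi> M) f"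
  unfolding stone_topology_def
proof (rule continuous_on_generated_topo)
  fix U assume "U \<in> (\<lambda>\<phi>. {p \<in> type_space L I \<pi> M. \<phi> \<in> p}) ` fmls L (I <+> univ M)"
  then obtain \<phi> where \<phi>: "\<phi> \<in> fmls L (I <+> univ M)" "U = {p \<in> type_space L I \<pi> M. \<phi> \<in> p}" by blast
  then have "f -` U \<inter> topspace X = {x \<in> topspace X. \<phi> \<in> f x}"
    using f by auto
  then show "openin X (f -` U \<inter> topspace X)" using op[OF \<phi>(1)] by simp
next
  show "f ` topspace X \<subseteq> \<Union> ((\<lambda>\<phi>. {p \<in> type_space L I \<pi> M. \<phi> \<in> p}) ` fmls L (I <+> univ M))"
    using f topspace_stone_topology[of L I \<pi> M] by (auto simp: stone_topology_def)
qed

lemma Hausdorff_stone: "Hausdorff_space (stone_topology L I \<pi> M)"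
  unfolding Hausdorff_space_def topspace_stone_topology
proof (intro allI impI)
  fix p q assume pq: "p \<in> type_space L I \<pi> M \<and> q \<in> type_space L I \<pi> M \<and> p \<noteq> q"
  then obtain \<phi> where \<phi>: "\<phi> \<in> p" "\<phi> \<notin> q"
    using type_space_eqI by blast
  have F: "\<phi> \<in> fmls L (I <+> univ M)" using \<phi> pq type_spaceD(1) by blast
  let ?U = "{p \<in> type_space L I \<pi> M. \<phi> \<in> p}" and ?V = "{p \<in> type_space L I \<pi> M. Neg \<phi> \<in> p}"
  have "openin (stone_topology L I \<pi> M) ?U" "openin (stone_topology L I \<pi> M) ?V"
    using F by (simp_all add: openin_stone_basic)
  moreover have "p \<in> ?U" "q \<in> ?V" "disjnt ?U ?V"
    using pq \<phi> type_space_Neg[OF _ F] by (auto simp: disjnt_def)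
  ultimately show "\<exists>U V. openin (stone_topology L I \<pi> M) U \<and> openin (stone_topology L I \<pi> M) V \<and>
      p \<in> U \<and> q \<in> V \<and> disjnt U V"
    by blast
qed

text \<open>The type space is the continuous image of a closed subset of \<open>2\<^bsup>Fm\<^esup>\<close>.\<close>

lemma compact_stone:
  assumes \<pi>: "\<pi> \<subseteq> fmls L (I <+> univ M)"
  shows "compact_space (stone_topology L I \<pi> M)"
proof -
  let ?F = "fmls L (I <+> univ M)" and ?S = "type_space L I \<pi> M"
  let ?X = "product_topology (\<lambda>_. discrete_topology (UNIV :: bool set)) ?F"
  let ?V = "\<lambda>\<phi>. {f \<in> topspace ?X. f \<phi>}"
  define ty where "ty f = {\<phi> \<in> ?F. f \<phi>}" for f :: "_ \<Rightarrow> bool"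
  define K where "K = {f \<in> topspace ?X. ty f \<in> ?S}"
  \<comment> \<open>Finite satisfiability is an intersection of clopen conditions: for each of these
    forbidden finite sets, some member is left out.\<close>
  define unsat where "unsat = {q. finite q \<and> q \<subseteq> ?F \<and>
     \<not> (\<exists>c\<in>I \<rightarrow> univ M. \<forall>\<phi>\<in>q. holds M (case_sum c (\<lambda>a. a)) \<phi>)}"
  have val: "openin ?X (?V \<phi>)" "closedin ?X (?V \<phi>)" if "\<phi> \<in> ?F" for \<phi>
    using openin_continuous_map_preimage[OF continuous_map_product_projection[OF that], of "\<lambda>_. discrete_topology UNIV" "{True}"]
      closedin_continuous_map_preimage[OF continuous_map_product_projection[OF that], of "\<lambda>_. discrete_topology UNIV" "{True}"]
    by simp_all
  have K_eq: "K = topspace ?X \<inter> \<Inter> ((\<lambda>q. topspace ?X - (topspace ?X \<inter> \<Inter> (?V ` q))) ` unsat) \<inter>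
      \<Inter> ((\<lambda>\<phi>. ?V \<phi> \<union> ?V (Neg \<phi>)) ` ?F) \<inter>
      \<Inter> (?V ` \<pi>)" (is "K = ?R")
  proof
    show "K \<subseteq> ?R"
    proof
      fix f assume "f \<in> K"
      then have f: "f \<in> topspace ?X" and t: "ty f \<in> ?S" by (auto simp: K_def)
      have "\<exists>\<phi>\<in>q. \<not> f \<phi>" if "q \<in> unsat" for q
      proof (rule ccontr)
        assume "\<not> (\<exists>\<phi>\<in>q. \<not> f \<phi>)"
        then have "q \<subseteq> ty f" "finite q" using that by (auto simp: unsat_def ty_def)
        from type_spaceD(3)[OF t this(2,1)] show False
          using that unfolding unsat_def by blast
      qed
      moreover have "f \<phi> \<or> f (Neg \<phi>)" if "\<phi> \<in> ?F" for \<phi>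
        using type_spaceD(4)[OF t that] by (auto simp: ty_def)
      moreover have "f \<phi>" if "\<phi> \<in> \<pi>" for \<phi>
        using type_spaceD(2)[OF t] that by (auto simp: ty_def)
      ultimately show "f \<in> ?R" using f by auto
    qed
    show "?R \<subseteq> K"
    proof
      fix f assume f: "f \<in> ?R"
      have "ty f \<in> ?S"
      proof (rule type_spaceI)
        show "ty f \<subseteq> ?F" by (auto simp: ty_def)
        show "\<pi> \<subseteq> ty f" using f \<pi> by (auto simp: ty_def)
        fix q assume q: "finite q" "q \<subseteq> ty f"
        show "\<exists>c\<in>I \<rightarrow> univ M. \<forall>\<phi>\<in>q. holds M (case_sum c (\<lambda>a. a)) \<phi>"
        proof (rule ccontr)
          assume "\<not> ?thesis"
          then have "q \<in> unsat" using q by (auto simp: unsat_def ty_def)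
          then have "f \<in> topspace ?X - (topspace ?X \<inter> \<Inter> (?V ` q))"
            using f by blast
          then show False using q by (auto simp: ty_def)
        qed
      next
        fix \<phi> assume "\<phi> \<in> ?F"
        then show "\<phi> \<in> ty f \<or> Neg \<phi> \<in> ty f" using f by (auto simp: ty_def)
      qed
      then show "f \<in> K" using f by (simp add: K_def)
    qed
  qed
  have "closedin ?X ?R"
  proof -
    have o: "openin ?X (topspace ?X \<inter> \<Inter> (?V ` q))" if "q \<in> unsat" for q
    proof (cases "q = {}")
      case False
      then have "openin ?X (\<Inter> (?V ` q))"
        using that val(1) by (intro openin_Inter) (auto simp: unsat_def)
      then show ?thesis by (intro openin_Int openin_topspace)
    qed (simp del: topspace_product_topology)
    \<comment> \<open>Intersecting with \<open>topspace ?X\<close> covers the empty family, whose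
      intersection is \<open>UNIV\<close>.\<close>
    have 1: "closedin ?X (topspace ?X \<inter> \<Inter> \<K>)" if "\<And>T. T \<in> \<K> \<Longrightarrow> closedin ?X T" for \<K>
      using that by (cases "\<K> = {}") (auto simp del: topspace_product_topology intro!: closedin_Int closedin_Inter)
    have eq: "?R = (topspace ?X \<inter> \<Inter> ((\<lambda>q. topspace ?X - (topspace ?X \<inter> \<Inter> (?V ` q))) ` unsat)) \<inter>
      (topspace ?X \<inter> \<Inter> ((\<lambda>\<phi>. ?V \<phi> \<union> ?V (Neg \<phi>)) ` ?F)) \<inter>
      (topspace ?X \<inter> \<Inter> (?V ` \<pi>))" by blast
    show "closedin ?X ?R"
      unfolding eq
    proof (rule closedin_Int[OF closedin_Int[OF 1 1] 1])
      fix T assume "T \<in> (\<lambda>q. topspace ?X - (topspace ?X \<inter> \<Inter> (?V ` q))) ` unsat"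
      then show "closedin ?X T"
        using o by (auto simp del: topspace_product_topology intro!: closedin_diff)
    next
      fix T assume "T \<in> (\<lambda>\<phi>. ?V \<phi> \<union> ?V (Neg \<phi>)) ` ?F"
      then show "closedin ?X T"
        using val(2) by (auto simp del: topspace_product_topology intro!: closedin_Un)
    next
      fix T assume "T \<in> ?V ` \<pi>"
      then show "closedin ?X T" using val(2) \<pi> by blast
    qed
  qed
  then have "compactin ?X K"
    unfolding K_eq
    by (rule closedin_compact_space[rotated])
       (simp add: compact_space_product_topology compact_space_discrete_topology)
  then have comp: "compact_space (subtopology ?X K)"
    by (simp add: compactin_subspace)
  have K_top: "topspace (subtopology ?X K) = K"
    by (auto simp: K_def)
  have "continuous_map (subtopology ?X K) (stone_topology L I \<pi> M) ty"
  proof (rule continuous_map_stone)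
    show "ty \<in> topspace (subtopology ?X K) \<rightarrow> ?S"
      unfolding K_top by (auto simp: K_def)
    fix \<phi> assume \<phi>: "\<phi> \<in> ?F"
    have "{f \<in> topspace (subtopology ?X K). \<phi> \<in> ty f} = ?V \<phi> \<inter> K"
      unfolding K_top using \<phi> by (auto simp: K_def ty_def)
    then show "openin (subtopology ?X K) {f \<in> topspace (subtopology ?X K). \<phi> \<in> ty f}"
      using openin_subtopology_Int[OF val(1)[OF \<phi>]] by simp
  qed
  then have "compactin (stone_topology L I \<pi> M) (ty ` topspace (subtopology ?X K))"
    using comp image_compactin unfolding compact_space_def by blast
  moreover have "ty ` topspace (subtopology ?X K) = ?S"
  proof -
    have "p \<in> ty ` K" if p: "p \<in> ?S" for p
    proof -
      let ?f = "\<lambda>\<phi>\<in>?F. \<phi> \<in> p"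
      have "ty ?f = p" using type_spaceD(1)[OF p] by (auto simp: ty_def)
      moreover from this have "?f \<in> K" using p by (simp add: K_def)
      ultimately show ?thesis by (metis imageI)
    qed
    then show ?thesis unfolding K_top by (auto simp: K_def)
  qed
  ultimately show ?thesis
    by (simp add: compact_space_def topspace_stone_topology)
qed

text \<open>The types agreeing with \<open>p\<close> over a finite \<open>a\<close> form a closed
  set that need not be open. Hence an open \<open>U0\<close> is produced together with the
  parameters on which membership in it depends.\<close>

lemma stone_nbhd:
  assumes "openin (stone_topology L I \<pi> M) U" "p \<in> U"
  shows "\<exists>a U0. finite a \<and> a \<subseteq> univ M \<and> openin (stone_topology L I \<pi> M) U0 \<and> p \<in> U0 \<and> U0 \<subseteq> U \<and>
    (\<forall>q\<in>U0. \<forall>q'\<in>type_space L I \<pi> M. q \<inter> fmls L (I <+> a) = q' \<inter> fmls L (I <+> a) \<longrightarrow> q' \<in> U0)"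
  using assms(1)[unfolded stone_topology_def, THEN openin_topology_generated_by] assms(2)
proof (induction U arbitrary: p rule: generate_topology_on.induct)
  case Empty
  then show ?case by simp
next
  case (Int U V)
  obtain a U0 where U: "finite a" "a \<subseteq> univ M" "openin (stone_topology L I \<pi> M) U0" "p \<in> U0" "U0 \<subseteq> U"
    "\<forall>q\<in>U0. \<forall>q'\<in>type_space L I \<pi> M. q \<inter> fmls L (I <+> a) = q' \<inter> fmls L (I <+> a) \<longrightarrow> q' \<in> U0"
    using Int.IH(1)[OF IntD1[OF Int.prems]] by (elim exE conjE) (rule that)
  obtain b V0 where V: "finite b" "b \<subseteq> univ M" "openin (stone_topology L I \<pi> M) V0" "p \<in> V0" "V0 \<subseteq> V"
    "\<forall>q\<in>V0. \<forall>q'\<in>type_space L I \<pi> M. q \<inter> fmls L (I <+> b) = q' \<inter> fmls L (I <+> b) \<longrightarrow> q' \<in> V0"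
    using Int.IH(2)[OF IntD2[OF Int.prems]] by (elim exE conjE) (rule that)
  have sub: "fmls L (I <+> a) \<subseteq> fmls L (I <+> (a \<union> b))" "fmls L (I <+> b) \<subseteq> fmls L (I <+> (a \<union> b))"
    by (auto intro!: fmls_mono)
  have agree: "q' \<in> U0 \<inter> V0" if "q \<in> U0 \<inter> V0" "q' \<in> type_space L I \<pi> M"
    "q \<inter> fmls L (I <+> (a \<union> b)) = q' \<inter> fmls L (I <+> (a \<union> b))" for q q'
  proof -
    have "q \<inter> fmls L (I <+> a) = q' \<inter> fmls L (I <+> a)" "q \<inter> fmls L (I <+> b) = q' \<inter> fmls L (I <+> b)"
      using that(3) sub by blast+
    then show ?thesis using U(6) V(6) that by blast
  qed
  show ?case
  proof (rule exI[of _ "a \<union> b"], rule exI[of _ "U0 \<inter> V0"], intro conjI ballI impI)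
    show "finite (a \<union> b)" using U(1) V(1) by simp
    show "a \<union> b \<subseteq> univ M" using U(2) V(2) by simp
    show "openin (stone_topology L I \<pi> M) (U0 \<inter> V0)" using U(3) V(3) by (rule openin_Int)
    show "p \<in> U0 \<inter> V0" using U(4) V(4) by simp
    show "U0 \<inter> V0 \<subseteq> U \<inter> V" using U(5) V(5) by blast
  qed (rule agree)
next
  case (UN K)
  then obtain k where k: "k \<in> K" "p \<in> k" by blast
  obtain a U0 where "finite a" "a \<subseteq> univ M" "openin (stone_topology L I \<pi> M) U0" "p \<in> U0" "U0 \<subseteq> k"
    "\<forall>q\<in>U0. \<forall>q'\<in>type_space L I \<pi> M. q \<inter> fmls L (I <+> a) = q' \<inter> fmls L (I <+> a) \<longrightarrow> q' \<in> U0"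
    using UN.IH[OF k] by (elim exE conjE) (rule that)
  then show ?case using Union_upper[OF k(1)] by (intro exI[of _ a] exI[of _ U0] conjI) auto
next
  case (Basis U)
  then obtain \<phi> where \<phi>: "\<phi> \<in> fmls L (I <+> univ M)" "U = {p \<in> type_space L I \<pi> M. \<phi> \<in> p}" by blast
  obtain a where a: "finite a" "a \<subseteq> univ M" "\<phi> \<in> fmls L (I <+> a)"
    using finite_params[OF \<phi>(1)] .
  have "\<forall>q\<in>U. \<forall>q'\<in>type_space L I \<pi> M. q \<inter> fmls L (I <+> a) = q' \<inter> fmls L (I <+> a) \<longrightarrow> q' \<in> U"
    using a(3) \<phi>(2) by blast
  then show ?case
    using a(1,2) openin_stone_basic[OF \<phi>(1), of \<pi>] Basis.prems unfolding \<phi>(2)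
    by (intro exI[of _ a] exI[of _ "{p \<in> type_space L I \<pi> M. \<phi> \<in> p}"]) blast
qed

text \<open>A basic open box constrains finitely many coordinates, so one finite parameter set still
  works for all of \<open>A\<close>.\<close>

lemma stone_power_nbhd:
  fixes A :: "'j set"
  assumes W: "openin (product_topology (\<lambda>_. stone_topology L I \<pi> M) A) W" "x \<in> W"
  shows "\<exists>a W0. finite a \<and> a \<subseteq> univ M \<and> openin (product_topology (\<lambda>_. stone_topology L I \<pi> M) A) W0 \<and>
    x \<in> W0 \<and> W0 \<subseteq> W \<and> (\<forall>y\<in>W0. \<forall>y'\<in>A \<rightarrow>\<^sub>E type_space L I \<pi> M.
      (\<forall>i\<in>A. y i \<inter> fmls L (I <+> a) = y' i \<inter> fmls L (I <+> a)) \<longrightarrow> y' \<in> W0)"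
proof -
  let ?T = "stone_topology L I \<pi> M" and ?S = "type_space L I \<pi> M"
  obtain X where X: "x \<in> Pi\<^sub>E A X" "\<And>i. openin ?T (X i)" "finite {i. X i \<noteq> topspace ?T}" "Pi\<^sub>E A X \<subseteq> W"
    using product_topology_open_contains_basis[OF W] by blast
  let ?J = "{i. X i \<noteq> topspace ?T}"
  have ex: "\<exists>a U0. finite a \<and> a \<subseteq> univ M \<and> openin ?T U0 \<and> x i \<in> U0 \<and> U0 \<subseteq> X i \<and>
    (\<forall>q\<in>U0. \<forall>q'\<in>?S. q \<inter> fmls L (I <+> a) = q' \<inter> fmls L (I <+> a) \<longrightarrow> q' \<in> U0)" if "i \<in> A" for i
    by (rule stone_nbhd[OF X(2)]) (use X(1) that in auto)
  then obtain a U where aU: "\<And>i. i \<in> A \<Longrightarrow> finite (a i) \<and> a i \<subseteq> univ M \<and> openin ?T (U i) \<and> x i \<in> U i \<and> U i \<subseteq> X i \<and>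
    (\<forall>q\<in>U i. \<forall>q'\<in>?S. q \<inter> fmls L (I <+> a i) = q' \<inter> fmls L (I <+> a i) \<longrightarrow> q' \<in> U i)"
    by metis
  define V where "V i = (if i \<in> A \<inter> ?J then U i else topspace ?T)" for i
  define b where "b = (\<Union>i\<in>A \<inter> ?J. a i)"
  have xS: "x i \<in> topspace ?T" if "i \<in> A" for i
    using X(1,2) that openin_subset by blast
  have op: "openin (product_topology (\<lambda>_. ?T) A) (Pi\<^sub>E A V)"
  proof (rule product_topology_basis)
    show "openin ?T (V i)" for i using aU by (auto simp: V_def)
    show "finite {i. V i \<noteq> topspace ?T}"
      by (rule finite_subset[OF _ X(3)]) (auto simp: V_def)
  qed
  have fin: "finite b"
    using aU X(3) by (auto simp: b_def)
  have bM: "b \<subseteq> univ M"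
    unfolding b_def by (rule UN_least) (use aU in blast)
  have xV: "x \<in> Pi\<^sub>E A V"
    using X(1) aU xS by (auto simp: V_def PiE_def)
  have VW: "Pi\<^sub>E A V \<subseteq> W"
  proof -
    have "V i \<subseteq> X i" if "i \<in> A" for i
      using aU[OF that] that by (auto simp: V_def)
    then have "Pi\<^sub>E A V \<subseteq> Pi\<^sub>E A X" by (rule PiE_mono)
    then show ?thesis using X(4) by blast
  qed
  have agree: "y' \<in> Pi\<^sub>E A V" if y: "y \<in> Pi\<^sub>E A V" and y': "y' \<in> A \<rightarrow>\<^sub>E ?S"
    and ag: "\<forall>i\<in>A. y i \<inter> fmls L (I <+> b) = y' i \<inter> fmls L (I <+> b)" for y y'
  proof (rule PiE_I)
    fix i assume i: "i \<in> A"
    show "y' i \<in> V i"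
    proof (cases "i \<in> ?J")
      case True
      have "fmls L (I <+> a i) \<subseteq> fmls L (I <+> b)"
        using i True by (intro fmls_mono) (auto simp: b_def)
      then have "y i \<inter> fmls L (I <+> a i) = y' i \<inter> fmls L (I <+> a i)"
        using ag i by blast
      moreover have "y i \<in> U i" using PiE_mem[OF y i] i True by (simp add: V_def)
      moreover have "y' i \<in> ?S" using y' i by auto
      ultimately show ?thesis using aU[OF i] i True by (simp add: V_def)
    next
      case False
      then show ?thesis using y' i by (auto simp: V_def topspace_stone_topology)
    qed
  next
    fix i assume "i \<notin> A" then show "y' i = undefined" using y' by auto
  qed
  show ?thesis
    by (rule exI[of _ b], rule exI[of _ "Pi\<^sub>E A V"], intro conjI ballI impI fin bM op xV VW) (rule agree)
qed

text \<open>Automorphisms obtained from homogeneity are controlled on finite parameter sets only;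
  this criterion shows that such approximations, made in all coordinates at once, decide membership
  in a closed set.\<close>

lemma stone_power_closed:
  assumes Z: "closedin (product_topology (\<lambda>_. stone_topology L I \<pi> M) A) Z"
    and x: "x \<in> A \<rightarrow>\<^sub>E type_space L I \<pi> M"
    and ap: "\<And>a. finite a \<Longrightarrow> a \<subseteq> univ M \<Longrightarrow>
      \<exists>z\<in>Z. \<forall>i\<in>A. x i \<inter> fmls L (I <+> a) = z i \<inter> fmls L (I <+> a)"
  shows "x \<in> Z"
proof (rule ccontr)
  let ?P = "product_topology (\<lambda>_. stone_topology L I \<pi> M) A"
  assume "x \<notin> Z"
  then have "openin ?P (topspace ?P - Z)" "x \<in> topspace ?P - Z"
    using Z x by (auto simp: closedin_def topspace_stone_topology)
  from stone_power_nbhd[OF this] obtain a W0 where a: "finite a" "a \<subseteq> univ M" "x \<in> W0" "W0 \<subseteq> topspace ?P - Z"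
    and sat: "\<forall>y\<in>W0. \<forall>y'\<in>A \<rightarrow>\<^sub>E type_space L I \<pi> M.
      (\<forall>i\<in>A. y i \<inter> fmls L (I <+> a) = y' i \<inter> fmls L (I <+> a)) \<longrightarrow> y' \<in> W0"
    by blast
  obtain z where z: "z \<in> Z" "\<forall>i\<in>A. x i \<inter> fmls L (I <+> a) = z i \<inter> fmls L (I <+> a)"
    using ap[OF a(1,2)] by blast
  have "z \<in> A \<rightarrow>\<^sub>E type_space L I \<pi> M"
    using closedin_subset[OF Z] z(1) by (auto simp: topspace_stone_topology)
  then have "z \<in> W0" using sat a(3) z(2) by blast
  then show False using a(4) z(1) by blast
qed

section \<open>The action of automorphisms on types\<close>

lemma Aut_inv_rename:
  assumes M: "is_struct L M" and \<sigma>: "\<sigma> \<in> Aut L M" and \<phi>: "\<phi> \<in> fmls L (I <+> univ M)"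
  shows "param_rename (Aut_inv M \<sigma>) \<phi> \<in> fmls L (I <+> univ M)"
    and "param_rename \<sigma> (param_rename (Aut_inv M \<sigma>) \<phi>) = \<phi>"
proof -
  show "param_rename (Aut_inv M \<sigma>) \<phi> \<in> fmls L (I <+> univ M)"
    using Aut_in[OF Aut_inv[OF M \<sigma>]] by (intro param_rename_fmls[OF \<phi>]) blast
  show "param_rename \<sigma> (param_rename (Aut_inv M \<sigma>) \<phi>) = \<phi>"
    unfolding param_rename_comp by (rule param_rename_idI[OF \<phi>]) (simp add: Aut_inv_right[OF \<sigma>])
qed

lemma type_act_mem:
  assumes \<sigma>: "\<sigma> \<in> Aut L M" and p: "p \<subseteq> fmls L (I <+> univ M)"
    and \<phi>: "\<phi> \<in> fmls L (I <+> univ M)"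
  shows "param_rename \<sigma> \<phi> \<in> type_act \<sigma> p \<longleftrightarrow> \<phi> \<in> p"
proof -
  have "param_rename (Aut_inv M \<sigma>) (param_rename \<sigma> \<psi>) = \<psi>" if "\<psi> \<in> fmls L (I <+> univ M)" for \<psi>
    unfolding param_rename_comp by (rule param_rename_idI[OF that]) (simp add: Aut_inv_left[OF \<sigma>])
  then have "\<psi> = \<phi>" if "\<psi> \<in> p" "param_rename \<sigma> \<phi> = param_rename \<sigma> \<psi>" for \<psi>
    using that p \<phi> by (metis subsetD)
  then show ?thesis
    unfolding type_act_def by blast
qed

lemma type_act_inv_mem:
  assumes M: "is_struct L M" and \<sigma>: "\<sigma> \<in> Aut L M" and p: "p \<subseteq> fmls L (I <+> univ M)"
    and \<phi>: "\<phi> \<in> fmls L (I <+> univ M)"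
  shows "\<phi> \<in> type_act (Aut_inv M \<sigma>) p \<longleftrightarrow> param_rename \<sigma> \<phi> \<in> p"
proof -
  have "param_rename (Aut_inv M \<sigma>) (param_rename \<sigma> \<phi>) = \<phi>"
    unfolding param_rename_comp by (rule param_rename_idI[OF \<phi>]) (simp add: Aut_inv_left[OF \<sigma>])
  moreover have "param_rename \<sigma> \<phi> \<in> fmls L (I <+> univ M)"
    using Aut_in[OF \<sigma>] by (intro param_rename_fmls[OF \<phi>]) blast
  ultimately show ?thesis
    using type_act_mem[OF Aut_inv[OF M \<sigma>] p] by metis
qed

lemma type_act_compose:
  assumes \<tau>: "\<tau> \<in> Aut L M" and p: "p \<subseteq> fmls L (I <+> univ M)"
  shows "type_act (compose (univ M) \<sigma> \<tau>) p = type_act \<sigma> (type_act \<tau> p)"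
  unfolding type_act_def image_image param_rename_comp
proof (rule image_cong[OF refl])
  fix \<phi> assume "\<phi> \<in> p"
  then have "\<phi> \<in> fmls L (I <+> univ M)" using p by blast
  then show "param_rename (compose (univ M) \<sigma> \<tau>) \<phi> = param_rename (\<sigma> \<circ> \<tau>) \<phi>"
    by (rule param_rename_cong) (simp add: compose_eq)
qed

lemma type_act_id:
  assumes "p \<subseteq> fmls L (I <+> univ M)" "\<And>a. a \<in> univ M \<Longrightarrow> \<sigma> a = a"
  shows "type_act \<sigma> p = p"
proof -
  have "param_rename \<sigma> \<phi> = \<phi>" if "\<phi> \<in> p" for \<phi>
    using that assms by (intro param_rename_idI[of \<phi> L I "univ M"]) auto
  then show ?thesis by (simp add: type_act_def)
qed

lemma type_act_inv_left:
  assumes \<sigma>: "\<sigma> \<in> Aut L M" and p: "p \<subseteq> fmls L (I <+> univ M)"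
  shows "type_act (Aut_inv M \<sigma>) (type_act \<sigma> p) = p"
proof -
  have "type_act (Aut_inv M \<sigma>) (type_act \<sigma> p) = type_act (Aut_inv M \<sigma> \<circ> \<sigma>) p"
    unfolding type_act_def image_image param_rename_comp ..
  then show ?thesis
    using type_act_id[OF p, of "Aut_inv M \<sigma> \<circ> \<sigma>"] Aut_inv_left[OF \<sigma>] by simp
qed

text \<open>If \<open>c\<close> satisfies a finite part of \<open>p\<close>, then
  \<open>\<sigma> \<circ> c\<close> satisfies its image; \<open>\<pi>\<close> has no parameters and
  is fixed.\<close>

lemma type_act_type_space:
  assumes M: "is_struct L M" and \<pi>: "\<pi> \<subseteq> fmls L (I <+> {})" and \<sigma>: "\<sigma> \<in> Aut L M"
    and p: "p \<in> type_space L I \<pi> M"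
  shows "type_act \<sigma> p \<in> type_space L I \<pi> M"
proof (rule type_spaceI)
  note pF = type_spaceD(1)[OF p]
  have im: "\<sigma> ` univ M \<subseteq> univ M" using Aut_in[OF \<sigma>] by blast
  show "type_act \<sigma> p \<subseteq> fmls L (I <+> univ M)"
    unfolding type_act_def using pF param_rename_fmls[OF _ im] by blast
  show "\<pi> \<subseteq> type_act \<sigma> p"
  proof
    fix \<phi> assume "\<phi> \<in> \<pi>"
    then have "param_rename \<sigma> \<phi> = \<phi>" "\<phi> \<in> p"
      using \<pi> type_spaceD(2)[OF p] by (auto intro: param_rename_idI[of \<phi> L I "{}"])
    then show "\<phi> \<in> type_act \<sigma> p" unfolding type_act_def by (metis imageI)
  qed
  fix q assume q: "finite q" "q \<subseteq> type_act \<sigma> p"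
  then obtain q0 where q0: "finite q0" "q0 \<subseteq> p" "q = param_rename \<sigma> ` q0"
    unfolding type_act_def using finite_subset_image by metis
  obtain c where c: "c \<in> I \<rightarrow> univ M" "\<forall>\<phi>\<in>q0. holds M (case_sum c (\<lambda>a. a)) \<phi>"
    using type_spaceD(3)[OF p q0(1,2)] by blast
  have "holds M (case_sum (\<sigma> \<circ> c) (\<lambda>a. a)) (param_rename \<sigma> \<phi>)" if "\<phi> \<in> q0" for \<phi>
  proof -
    have \<phi>: "\<phi> \<in> fmls L (I <+> univ M)" using that q0(2) pF by blast
    have "case_sum (\<sigma> \<circ> c) (\<lambda>a. a) \<circ> map_sum (\<lambda>i. i) \<sigma> = \<sigma> \<circ> case_sum c (\<lambda>a. a)"
      by (auto simp: fun_eq_iff split: sum.splits)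
    moreover have "case_sum c (\<lambda>a. a) ` (I <+> univ M) \<subseteq> univ M" using c(1) by auto
    ultimately show ?thesis
      using holds_Aut[OF M \<sigma> \<phi>] c(2) that by (simp add: holds_rename)
  qed
  moreover have "\<sigma> \<circ> c \<in> I \<rightarrow> univ M" using c(1) im by (auto simp: Pi_def)
  ultimately show "\<exists>c\<in>I \<rightarrow> univ M. \<forall>\<phi>\<in>q. holds M (case_sum c (\<lambda>a. a)) \<phi>"
    unfolding q0(3) by blast
next
  fix \<phi> assume \<phi>: "\<phi> \<in> fmls L (I <+> univ M)"
  let ?\<psi> = "param_rename (Aut_inv M \<sigma>) \<phi>"
  note \<psi> = Aut_inv_rename(1)[OF M \<sigma> \<phi>] and eq = Aut_inv_rename(2)[OF M \<sigma> \<phi>]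
  have "param_rename \<sigma> (Neg ?\<psi>) = Neg \<phi>" using eq by simp
  then show "\<phi> \<in> type_act \<sigma> p \<or> Neg \<phi> \<in> type_act \<sigma> p"
    using type_spaceD(4)[OF p \<psi>] eq unfolding type_act_def by (metis imageI)
qed

lemma continuous_type_act:
  assumes M: "is_struct L M" and \<pi>: "\<pi> \<subseteq> fmls L (I <+> {})" and \<sigma>: "\<sigma> \<in> Aut L M"
  shows "continuous_map (stone_topology L I \<pi> M) (stone_topology L I \<pi> M) (type_act \<sigma>)"
proof (rule continuous_map_stone)
  show "type_act \<sigma> \<in> topspace (stone_topology L I \<pi> M) \<rightarrow> type_space L I \<pi> M"
    using type_act_type_space[OF M \<pi> \<sigma>] by (auto simp: topspace_stone_topology)
  fix \<phi> assume \<phi>: "\<phi> \<in> fmls L (I <+> univ M)"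
  let ?\<psi> = "param_rename (Aut_inv M \<sigma>) \<phi>"
  note \<psi> = Aut_inv_rename(1)[OF M \<sigma> \<phi>] and eq = Aut_inv_rename(2)[OF M \<sigma> \<phi>]
  have "{p \<in> topspace (stone_topology L I \<pi> M). \<phi> \<in> type_act \<sigma> p} = {p \<in> type_space L I \<pi> M. ?\<psi> \<in> p}"
    using type_act_mem[OF \<sigma> type_spaceD(1) \<psi>] eq by (auto simp: topspace_stone_topology)
  then show "openin (stone_topology L I \<pi> M) {p \<in> topspace (stone_topology L I \<pi> M). \<phi> \<in> type_act \<sigma> p}"
    using openin_stone_basic[OF \<psi>] by simp
qed

section \<open>Type spaces over an elementary extension\<close>

lemma finite_ordLess_natLeq: "finite A \<Longrightarrow> |A| <o natLeq"
  by (simp add: finite_iff_ordLess_natLeq)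

locale homogeneous_extension =
  fixes L :: "('f, 'p) lang" and C C' :: "('f, 'p, 'a) struct"
  assumes struct: "is_struct L C" and struct': "is_struct L C'"
    and elementary: "elementary_substruct L C C'"
    and saturated: "saturated natLeq L C"
    and homogeneous: "strongly_homogeneous natLeq L C"
    and homogeneous': "strongly_homogeneous natLeq L C'"
begin

lemma univ_sub: "univ C \<subseteq> univ C'"
  using elementary by (simp add: elementary_substruct_def)

lemma univ_ne: "univ C \<noteq> {}"
  using struct by (simp add: is_struct_def)

text \<open>The type of \<open>b\<close> over \<open>c\<close> is finitely satisfiable in
  \<open>C\<close> by elementarity and so realised there by saturation. Sending \<open>b\<close> to
  the realisation while fixing \<open>c\<close> is elementary, and homogeneity of \<open>C'\<close>
  extends this map.\<close>

lemma Aut_move_into: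
  assumes c: "finite c" "c \<subseteq> univ C" and b: "finite b" "b \<subseteq> univ C'"
  shows "\<exists>\<sigma>\<in>Aut L C'. (\<forall>a\<in>c. \<sigma> a = a) \<and> \<sigma> ` b \<subseteq> univ C"
proof -
  \<comment> \<open>Points of \<open>b\<close> that lie in \<open>c\<close> must stay fixed, so they
    remain parameters and only \<open>b - c\<close> is enumerated by variables.\<close>
  obtain f and n :: nat where f: "bij_betw f {..<n} (b - c)"
    using ex_bij_betw_nat_finite[of "b - c"] b(1) by (auto simp: atLeast0LessThan)
  have fC: "f \<in> {..<n} \<rightarrow> univ C'"
    using bij_betwE[OF f] b(2) by blast
  define j where "j = inv_into {..<n} f"
  have j: "j a \<in> {..<n}" "f (j a) = a" if "a \<in> b - c" for a
  proof -
    have "a \<in> f ` {..<n}" using that f by (simp add: bij_betw_def)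
    then show "j a \<in> {..<n}" "f (j a) = a"
      unfolding j_def by (rule inv_into_into, rule f_inv_into_f)
  qed
  define p where "p = {\<phi> \<in> fmls L ({..<n} <+> c). holds C' (case_sum f (\<lambda>a. a)) \<phi>}"
  have "complete_type L C {..<n} c p"
    unfolding complete_type_def partial_type_def
  proof (intro conjI allI impI ballI)
    show "p \<subseteq> fmls L ({..<n} <+> c)" by (auto simp: p_def)
    fix q assume q: "finite q \<and> q \<subseteq> p"
    show "\<exists>c\<in>{..<n} \<rightarrow> univ C. \<forall>\<phi>\<in>q. holds C (case_sum c (\<lambda>a. a)) \<phi>"
      by (rule elementary_satisfiable[OF elementary univ_ne _ _ c(2) fC]) (use q in \<open>auto simp: p_def\<close>)
  next
    fix \<phi> assume "\<phi> \<in> fmls L ({..<n} <+> c)"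
    then show "\<phi> \<in> p \<or> Neg \<phi> \<in> p" by (auto simp: p_def)
  qed
  then have "realized C {..<n} p"
    using saturated c finite_ordLess_natLeq unfolding saturated_def by blast
  then obtain d where d: "d \<in> {..<n} \<rightarrow> univ C" "\<forall>\<phi>\<in>p. holds C (case_sum d (\<lambda>a. a)) \<phi>"
    by (auto simp: realized_def)
  define g where "g a = (if a \<in> c then a else d (j a))" for a
  \<comment> \<open>\<open>w\<close> replaces each point of \<open>b - c\<close> by the variable
    enumerating it, so that formulas over \<open>c \<union> b\<close> can be compared with
    \<open>p\<close>.\<close>
  define w where "w a = (if a \<in> c then Inr a else Inl (j a))" for a
  have gC: "g a \<in> univ C" if "a \<in> c \<union> b" for a
    using that c(2) d(1) j(1)[of a] by (auto simp: g_def)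
  have "partial_elementary_map L C' (c \<union> b) g"
    unfolding partial_elementary_map_def
  proof (intro conjI ballI)
    show "c \<union> b \<subseteq> univ C'" using c(2) b(2) univ_sub by blast
    show "g ` (c \<union> b) \<subseteq> univ C'" using gC univ_sub by blast
    fix \<phi> assume \<phi>: "\<phi> \<in> fmls L (c \<union> b)"
    have w: "rename w \<phi> \<in> fmls L ({..<n} <+> c)"
      by (rule fmls_rename[OF \<phi>]) (use j(1) in \<open>auto simp: w_def\<close>)
    have "holds C' (\<lambda>a. a) \<phi> \<longleftrightarrow> holds C' (case_sum f (\<lambda>a. a)) (rename w \<phi>)"
      unfolding holds_rename by (rule holds_cong[OF \<phi>]) (use j(2) in \<open>auto simp: w_def\<close>)
    also have "\<dots> \<longleftrightarrow> holds C (case_sum d (\<lambda>a. a)) (rename w \<phi>)"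
    proof -
      have "holds C (case_sum d (\<lambda>a. a)) (rename w \<phi>)" if "holds C' (case_sum f (\<lambda>a. a)) (rename w \<phi>)"
        using d(2) that w by (simp add: p_def)
      moreover have "Neg (rename w \<phi>) \<in> p" if "\<not> holds C' (case_sum f (\<lambda>a. a)) (rename w \<phi>)"
        using that w by (simp add: p_def)
      ultimately show ?thesis
        using d(2) holds_Neg by blast
    qed
    also have "\<dots> \<longleftrightarrow> holds C' (case_sum d (\<lambda>a. a)) (rename w \<phi>)"
      by (rule elementary_holds[OF elementary w]) (use d(1) c(2) in auto)
    also have "\<dots> \<longleftrightarrow> holds C' g \<phi>"
      unfolding holds_rename by (rule holds_cong[OF \<phi>]) (auto simp: w_def g_def)
    finally show "holds C' (\<lambda>a. a) \<phi> \<longleftrightarrow> holds C' g \<phi>" .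
  qed
  then obtain \<sigma> where \<sigma>: "\<sigma> \<in> Aut L C'" "\<forall>a\<in>c \<union> b. \<sigma> a = g a"
    using homogeneous' c(1) b(1) finite_ordLess_natLeq[of "c \<union> b"]
    unfolding strongly_homogeneous_def by blast
  have "\<sigma> ` b \<subseteq> univ C"
  proof
    fix y assume "y \<in> \<sigma> ` b"
    then obtain a where "a \<in> c \<union> b" "y = \<sigma> a" by blast
    then show "y \<in> univ C" using \<sigma>(2) gC[of a] by simp
  qed
  moreover have "\<forall>a\<in>c. \<sigma> a = a" using \<sigma>(2) by (simp add: g_def)
  ultimately show ?thesis using \<sigma>(1) by blast
qed

text \<open>\<open>\<sigma>\<close> need not preserve \<open>C\<close>, but truth about
  \<open>a\<close> and its image is the same in \<open>C\<close> and \<open>C'\<close>. So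
  \<open>\<sigma>\<close> is elementary on \<open>a\<close> within \<open>C\<close>, and homogeneity
  of \<open>C\<close> applies.\<close>

lemma Aut_down:
  assumes a: "finite a" "a \<subseteq> univ C" and \<sigma>: "\<sigma> \<in> Aut L C'" "\<sigma> ` a \<subseteq> univ C"
  shows "\<exists>\<rho>\<in>Aut L C. \<forall>x\<in>a. \<rho> x = \<sigma> x"
proof -
  have "partial_elementary_map L C a \<sigma>"
    unfolding partial_elementary_map_def
  proof (intro conjI ballI a(2) \<sigma>(2))
    fix \<phi> assume \<phi>: "\<phi> \<in> fmls L a"
    have "holds C (\<lambda>a. a) \<phi> \<longleftrightarrow> holds C' (\<lambda>a. a) \<phi>"
      by (rule elementary_holds[OF elementary \<phi>]) (use a in auto)
    also have "\<dots> \<longleftrightarrow> holds C' (\<sigma> \<circ> (\<lambda>a. a)) \<phi>"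
      by (rule holds_Aut[OF struct' \<sigma>(1) \<phi>, symmetric]) (use a univ_sub in auto)
    also have "\<dots> \<longleftrightarrow> holds C' \<sigma> \<phi>"
      by (simp add: o_def)
    also have "\<dots> \<longleftrightarrow> holds C \<sigma> \<phi>"
      by (rule elementary_holds[OF elementary \<phi> \<sigma>(2), symmetric])
    finally show "holds C (\<lambda>a. a) \<phi> \<longleftrightarrow> holds C \<sigma> \<phi>" .
  qed
  then show ?thesis
    using homogeneous finite_ordLess_natLeq[OF a(1)] unfolding strongly_homogeneous_def by blast
qed

text \<open>\<open>\<rho>\<close> as a whole need not extend; finitely many of its values do, by
  homogeneity of \<open>C'\<close>.\<close>

lemma Aut_up:
  assumes a: "finite a" "a \<subseteq> univ C" and \<rho>: "\<rho> \<in> Aut L C"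
  shows "\<exists>\<sigma>\<in>Aut L C'. \<forall>x\<in>a. \<sigma> x = \<rho> x"
proof -
  have \<rho>a: "\<rho> ` a \<subseteq> univ C" using Aut_in[OF \<rho>] a(2) by blast
  have "partial_elementary_map L C' a \<rho>"
    unfolding partial_elementary_map_def
  proof (intro conjI ballI)
    show "a \<subseteq> univ C'" "\<rho> ` a \<subseteq> univ C'" using a(2) \<rho>a univ_sub by auto
    fix \<phi> assume \<phi>: "\<phi> \<in> fmls L a"
    have "holds C' (\<lambda>a. a) \<phi> \<longleftrightarrow> holds C (\<lambda>a. a) \<phi>"
      by (rule elementary_holds[OF elementary \<phi>, symmetric]) (use a in auto)
    also have "\<dots> \<longleftrightarrow> holds C (\<rho> \<circ> (\<lambda>a. a)) \<phi>"
      by (rule holds_Aut[OF struct \<rho> \<phi>, symmetric]) (use a in auto)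
    also have "\<dots> \<longleftrightarrow> holds C \<rho> \<phi>"
      by (simp add: o_def)
    also have "\<dots> \<longleftrightarrow> holds C' \<rho> \<phi>"
      by (rule elementary_holds[OF elementary \<phi> \<rho>a])
    finally show "holds C' (\<lambda>a. a) \<phi> \<longleftrightarrow> holds C' \<rho> \<phi>" .
  qed
  then show ?thesis
    using homogeneous' finite_ordLess_natLeq[OF a(1)] unfolding strongly_homogeneous_def by blast
qed

end

definition type_maps ::
  "('f, 'p) lang \<Rightarrow> 'i set \<Rightarrow> ('f, 'p, 'i + 'a) fm set \<Rightarrow> ('f, 'p, 'a) struct
     \<Rightarrow> (('f, 'p, 'i + 'a) fm set \<Rightarrow> ('f, 'p, 'i + 'a) fm set) set" where
  "type_maps L I \<pi> M = (\<lambda>\<sigma>. restrict (type_act \<sigma>) (type_space L I \<pi> M)) ` Aut L M"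

lemma closed_inv_type_maps:
  "closed_inv (stone_topology L I \<pi> M) (type_maps L I \<pi> M) A Z \<longleftrightarrow>
     closedin (product_topology (\<lambda>_. stone_topology L I \<pi> M) A) Z \<and>
     (\<forall>\<sigma>\<in>Aut L M. \<forall>x\<in>Z. compose A (type_act \<sigma>) x \<in> Z)"
proof -
  have "compose A (restrict (type_act \<sigma>) (type_space L I \<pi> M)) x = compose A (type_act \<sigma>) x"
    if "closedin (product_topology (\<lambda>_. stone_topology L I \<pi> M) A) Z" "x \<in> Z" for \<sigma> x
    by (rule compose_restrict) (use that closedin_subset in \<open>fastforce simp: topspace_stone_topology\<close>)
  then show ?thesis
    unfolding closed_inv_def type_maps_def by auto
qed

section \<open>Restriction of types and the correspondence of closed invariant sets\<close>

locale type_space_extension = homogeneous_extension L C C'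
  for L :: "('f, 'p) lang" and C C' :: "('f, 'p, 'a) struct" +
  fixes I :: "'i set" and \<pi> :: "('f, 'p, 'i + 'a) fm set"
  assumes \<pi>: "\<pi> \<subseteq> fmls L (I <+> {})"
begin

abbreviation "S \<equiv> type_space L I \<pi> C"
abbreviation "S' \<equiv> type_space L I \<pi> C'"
abbreviation "T \<equiv> stone_topology L I \<pi> C"
abbreviation "T' \<equiv> stone_topology L I \<pi> C'"
abbreviation "r \<equiv> type_restrict L I C"

lemma \<pi>_fmls: "\<pi> \<subseteq> fmls L (I <+> univ M)"
  using \<pi> fmls_mono[of "I <+> {}" "I <+> univ M" L] by auto

lemma fmls_sub: "fmls L (I <+> univ C) \<subseteq> fmls L (I <+> univ C')"
  by (rule fmls_mono) (use univ_sub in auto)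

lemma compact_T': "compact_space T'"
  by (intro compact_stone \<pi>_fmls)

lemma r_mem: "\<phi> \<in> fmls L (I <+> univ C) \<Longrightarrow> \<phi> \<in> r p \<longleftrightarrow> \<phi> \<in> p"
  by (simp add: type_restrict_def)

lemma r_type: 
  assumes p: "p \<in> S'"
  shows "r p \<in> S"
proof (rule type_spaceI)
  show "r p \<subseteq> fmls L (I <+> univ C)" by (auto simp: type_restrict_def)
  show "\<pi> \<subseteq> r p" using type_spaceD(2)[OF p] \<pi>_fmls by (auto simp: type_restrict_def)
  fix q assume q: "finite q" "q \<subseteq> r p"
  then have "q \<subseteq> p" "q \<subseteq> fmls L (I <+> univ C)" by (auto simp: type_restrict_def)
  moreover obtain c where "c \<in> I \<rightarrow> univ C'" "\<forall>\<phi>\<in>q. holds C' (case_sum c (\<lambda>a. a)) \<phi>"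
    using type_spaceD(3)[OF p q(1) \<open>q \<subseteq> p\<close>] by blast
  ultimately show "\<exists>c\<in>I \<rightarrow> univ C. \<forall>\<phi>\<in>q. holds C (case_sum c (\<lambda>a. a)) \<phi>"
    using elementary_satisfiable[OF elementary univ_ne q(1)] by blast
next
  fix \<phi> assume \<phi>: "\<phi> \<in> fmls L (I <+> univ C)"
  then show "\<phi> \<in> r p \<or> Neg \<phi> \<in> r p"
    using type_spaceD(4)[OF p, of \<phi>] fmls_sub r_mem by auto
qed

text \<open>By compactness over \<open>C'\<close>: a finite part of \<open>p\<close> is satisfied by
  a tuple of \<open>C\<close>, whose complete type over \<open>C'\<close> contains that part by
  elementarity.\<close>

lemma r_onto_ex:
  assumes p: "p \<in> S"
  shows "\<exists>p'\<in>S'. r p' = p"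
proof -
  \<comment> \<open>The empty partial type is used because a tuple satisfying a finite part of
    \<open>p\<close> need not satisfy all of \<open>\<pi>\<close>; \<open>\<pi>\<close> comes back
    as a subset of \<open>p\<close>.\<close>
  let ?X = "stone_topology L I {} C'"
  let ?K = "\<lambda>\<phi>. {p' \<in> type_space L I {} C'. \<phi> \<in> p'}"
  have pF: "p \<subseteq> fmls L (I <+> univ C')"
    using type_spaceD(1)[OF p] fmls_sub by blast
  have "\<exists>p'. p' \<in> topspace ?X \<and> (\<forall>\<phi>\<in>p. p' \<in> ?K \<phi>)"
  proof -
    have fip: "topspace ?X \<inter> \<Inter> (?K ` q) \<noteq> {}" if q: "finite q" "q \<subseteq> p" for q
    proof -
      obtain c where c: "c \<in> I \<rightarrow> univ C" "\<forall>\<phi>\<in>q. holds C (case_sum c (\<lambda>a. a)) \<phi>"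
        using type_spaceD(3)[OF p q] by blast
      have c': "c \<in> I \<rightarrow> univ C'" using c(1) univ_sub by auto
      let ?t = "{\<phi> \<in> fmls L (I <+> univ C'). holds C' (case_sum c (\<lambda>a. a)) \<phi>}"
      have t: "?t \<in> type_space L I {} C'" by (rule realized_type[OF c'])
      have "\<phi> \<in> ?t" if "\<phi> \<in> q" for \<phi>
      proof -
        have \<phi>: "\<phi> \<in> fmls L (I <+> univ C)" using that q(2) type_spaceD(1)[OF p] by blast
        have "holds C (case_sum c (\<lambda>a. a)) \<phi> \<longleftrightarrow> holds C' (case_sum c (\<lambda>a. a)) \<phi>"
          by (rule elementary_holds[OF elementary \<phi>]) (use c(1) in auto)
        then show ?thesis using c(2) that \<phi> fmls_sub by blast
      qed
      then have "?t \<in> topspace ?X \<inter> \<Inter> (?K ` q)"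
        using t by (simp add: topspace_stone_topology)
      then show ?thesis by blast
    qed
    have "compact_space ?X" by (rule compact_stone) simp
    then have "topspace ?X \<inter> \<Inter> (?K ` p) \<noteq> {}"
      unfolding compact_space_def compactin_fip
    proof (elim conjE allE[of _ "?K ` p"] impE)
      show "(\<forall>K\<in>?K ` p. closedin ?X K) \<and> (\<forall>\<F>. finite \<F> \<and> \<F> \<subseteq> ?K ` p \<longrightarrow> topspace ?X \<inter> \<Inter> \<F> \<noteq> {})"
      proof (intro conjI ballI allI impI)
        fix K assume "K \<in> ?K ` p"
        then show "closedin ?X K" using pF closedin_stone_basic by blast
      next
        fix \<F> assume "finite \<F> \<and> \<F> \<subseteq> ?K ` p"
        then obtain q where "finite q" "q \<subseteq> p" "\<F> = ?K ` q"
          using finite_subset_image[of \<F> ?K p] by blast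
        then show "topspace ?X \<inter> \<Inter> \<F> \<noteq> {}" using fip by simp
      qed
    qed
    then show ?thesis by blast
  qed
  then obtain p' where p': "p' \<in> type_space L I {} C'" "p \<subseteq> p'"
    by (auto simp: topspace_stone_topology)
  have "p' \<in> S'"
    using p' type_spaceD(2)[OF p] by (auto simp: type_space_def)
  moreover have "p \<subseteq> r p'"
    using p' type_spaceD(1)[OF p] by (auto simp: type_restrict_def)
  ultimately show ?thesis
    using type_space_eqI[OF p r_type] by blast
qed

lemma r_onto: "r ` S' = S"
  using r_type r_onto_ex by blast

lemma r_continuous: "continuous_map T' T r"
proof (rule continuous_map_stone)
  show "r \<in> topspace T' \<rightarrow> S" using r_type by (auto simp: topspace_stone_topology)
  fix \<phi> assume \<phi>: "\<phi> \<in> fmls L (I <+> univ C)"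
  have "{p \<in> topspace T'. \<phi> \<in> r p} = {p \<in> S'. \<phi> \<in> p}"
    using r_mem[OF \<phi>] by (auto simp: topspace_stone_topology)
  then show "openin T' {p \<in> topspace T'. \<phi> \<in> r p}"
    using openin_stone_basic[of \<phi> L I C' \<pi>] \<phi> fmls_sub by auto
qed

lemma continuous_restrict_act:
  "\<tau> \<in> Aut L C' \<Longrightarrow> continuous_map (product_topology (\<lambda>_. T') A) (product_topology (\<lambda>_. T) A)
     (\<lambda>y. compose A r (compose A (type_act \<tau>) y))"
  using continuous_map_compose[OF continuous_map_compose_left[OF continuous_type_act[OF struct' \<pi>]]
      continuous_map_compose_left[OF r_continuous]]
  by (simp add: o_def)

lemma compose_act:
  "\<sigma> \<in> Aut L C' \<Longrightarrow> x \<in> A \<rightarrow>\<^sub>E S' \<Longrightarrow> compose A (type_act \<sigma>) x \<in> A \<rightarrow>\<^sub>E S'"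
  by (rule compose_PiE) (auto intro: type_act_type_space[OF struct' \<pi>])

lemma compose_r: "x \<in> A \<rightarrow>\<^sub>E S' \<Longrightarrow> compose A r x \<in> A \<rightarrow>\<^sub>E S"
  by (rule compose_PiE) (auto intro: r_type)

abbreviation "cinv \<equiv> \<lambda>A. closed_inv T (type_maps L I \<pi> C) A"
abbreviation "cinv' \<equiv> \<lambda>A. closed_inv T' (type_maps L I \<pi> C') A"

lemma cinv'_PiE: "cinv' A Z \<Longrightarrow> x \<in> Z \<Longrightarrow> x \<in> A \<rightarrow>\<^sub>E S'"
  using closed_inv_PiE[of T' _ A Z x] by (simp add: topspace_stone_topology)

lemma cinv_PiE: "cinv A Z \<Longrightarrow> x \<in> Z \<Longrightarrow> x \<in> A \<rightarrow>\<^sub>E S"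
  using closed_inv_PiE[of T _ A Z x] by (simp add: topspace_stone_topology)

text \<open>Invariance is not immediate, as \<open>\<rho>\<close> need not extend to
  \<open>C'\<close>. For each finite \<open>a\<close> some automorphism \<open>\<sigma>\<close> of
  \<open>C'\<close> imitates \<open>\<rho>\<close> so that the restriction of
  \<open>\<sigma> x\<close> agrees with \<open>\<rho> y\<close> over \<open>a\<close>, and the image
  is closed by compactness.\<close>

lemma image_cinv:
  fixes A :: "'j set"
  assumes Z: "cinv' A Z"
  shows "cinv A (compose A r ` Z)"
  unfolding closed_inv_type_maps
proof (intro conjI ballI)
  show cl: "closedin (product_topology (\<lambda>_. T) A) (compose A r ` Z)"
    by (rule closedin_compose_image[OF compact_T' Hausdorff_stone r_continuous closed_inv_closedin[OF Z]])
  fix \<rho> y assume \<rho>: "\<rho> \<in> Aut L C" and "y \<in> compose A r ` Z"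
  then obtain x where x: "x \<in> Z" "y = compose A r x" by blast
  have xP: "x \<in> A \<rightarrow>\<^sub>E S'" by (rule cinv'_PiE[OF Z x(1)])
  have yP: "y \<in> A \<rightarrow>\<^sub>E S" unfolding x(2) by (rule compose_r[OF xP])
  let ?y = "compose A (type_act \<rho>) y"
  have y2P: "?y \<in> A \<rightarrow>\<^sub>E S"
    by (rule compose_PiE[OF yP]) (auto intro: type_act_type_space[OF struct \<pi> \<rho>])
  show "?y \<in> compose A r ` Z"
  proof (rule stone_power_closed[OF cl y2P])
    fix a assume a: "finite a" "a \<subseteq> univ C"
    \<comment> \<open>A formula over \<open>a\<close> lies in the translate of a type iff its
      pullback, which is over the preimage of \<open>a\<close>, lies in the type; so
      \<open>\<sigma>\<close> must imitate \<open>\<rho>\<close> on that preimage.\<close>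
    let ?b = "Aut_inv C \<rho> ` a"
    have b: "finite ?b" "?b \<subseteq> univ C"
      using a Aut_in[OF Aut_inv[OF struct \<rho>]] by auto
    obtain \<sigma> where \<sigma>: "\<sigma> \<in> Aut L C'" "\<forall>x\<in>?b. \<sigma> x = \<rho> x"
      using Aut_up[OF b \<rho>] by blast
    let ?z = "compose A (type_act \<sigma>) x"
    have z: "?z \<in> Z"
      using Z \<sigma>(1) x(1) by (simp add: closed_inv_type_maps)
    have "?y i \<inter> fmls L (I <+> a) = compose A r ?z i \<inter> fmls L (I <+> a)" if i: "i \<in> A" for i
    proof -
      have xi: "x i \<in> S'" and yi: "y i = r (x i)" using xP i x(2) by (auto simp: compose_eq)
      have "\<phi> \<in> type_act \<rho> (y i) \<longleftrightarrow> \<phi> \<in> r (type_act \<sigma> (x i))" if \<phi>: "\<phi> \<in> fmls L (I <+> a)" for \<phi>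
      proof -
        define \<psi> where "\<psi> = param_rename (Aut_inv C \<rho>) \<phi>"
        have \<psi>: "\<psi> \<in> fmls L (I <+> ?b)"
          unfolding \<psi>_def by (rule param_rename_fmls[OF \<phi> subset_refl])
        have \<psi>C: "\<psi> \<in> fmls L (I <+> univ C)"
          using \<psi> fmls_mono[of "I <+> ?b" "I <+> univ C" L] b(2) by auto
        have \<phi>C: "\<phi> \<in> fmls L (I <+> univ C)"
          using \<phi> fmls_mono[of "I <+> a" "I <+> univ C" L] a(2) by auto
        have eq: "\<phi> = param_rename \<rho> \<psi>"
          unfolding \<psi>_def param_rename_comp
          by (rule param_rename_idI[OF \<phi>, symmetric]) (use a(2) Aut_inv_right[OF \<rho>] in auto)
        have eq': "\<phi> = param_rename \<sigma> \<psi>"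
          unfolding eq by (rule param_rename_cong[OF \<psi>]) (use \<sigma>(2) in auto)
        have "\<phi> \<in> type_act \<rho> (y i) \<longleftrightarrow> \<psi> \<in> y i"
          unfolding eq by (rule type_act_mem[OF \<rho> _ \<psi>C]) (use yP i type_spaceD(1) in blast)
        also have "\<dots> \<longleftrightarrow> \<psi> \<in> x i"
          unfolding yi by (rule r_mem[OF \<psi>C])
        also have "\<dots> \<longleftrightarrow> \<phi> \<in> type_act \<sigma> (x i)"
          unfolding eq' using type_act_mem[OF \<sigma>(1) type_spaceD(1)[OF xi]] \<psi>C fmls_sub by blast
        also have "\<dots> \<longleftrightarrow> \<phi> \<in> r (type_act \<sigma> (x i))"
          by (rule r_mem[OF \<phi>C, symmetric])
        finally show ?thesis .
      qed
      then show ?thesis using i by (auto simp: compose_eq)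
    qed
    then show "\<exists>z\<in>compose A r ` Z. \<forall>i\<in>A. ?y i \<inter> fmls L (I <+> a) = z i \<inter> fmls L (I <+> a)"
      using z by blast
  qed
qed

text \<open>Once \<open>\<sigma>\<close> has moved a finite \<open>b\<close> into \<open>C\<close>,
  the restriction of \<open>\<sigma> x\<close> determines \<open>x\<close> over \<open>b\<close>. A
  member \<open>w\<close> of \<open>Z2\<close> with this restriction is moved back by the inverse of
  \<open>\<sigma>\<close> and then agrees with \<open>x\<close> over \<open>b\<close>.\<close>

lemma subset_cinv:
  fixes A :: "'j set"
  assumes Z: "cinv' A Z1" "cinv' A Z2" and sub: "compose A r ` Z1 \<subseteq> compose A r ` Z2"
  shows "Z1 \<subseteq> Z2"
proof
  fix x assume x: "x \<in> Z1"
  have xP: "x \<in> A \<rightarrow>\<^sub>E S'" by (rule cinv'_PiE[OF Z(1) x])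
  show "x \<in> Z2"
  proof (rule stone_power_closed[OF closed_inv_closedin[OF Z(2)] xP])
    fix b assume b: "finite b" "b \<subseteq> univ C'"
    obtain \<sigma> where \<sigma>: "\<sigma> \<in> Aut L C'" "\<sigma> ` b \<subseteq> univ C"
      using Aut_move_into[OF finite.emptyI empty_subsetI b] by blast
    have "compose A (type_act \<sigma>) x \<in> Z1"
      using Z(1) \<sigma>(1) x by (simp add: closed_inv_type_maps)
    then have "compose A r (compose A (type_act \<sigma>) x) \<in> compose A r ` Z2"
      by (intro subsetD[OF sub] imageI)
    then obtain w where w: "w \<in> Z2" "compose A r (compose A (type_act \<sigma>) x) = compose A r w"
      by (elim imageE) (rule that)
    have wP: "w \<in> A \<rightarrow>\<^sub>E S'" by (rule cinv'_PiE[OF Z(2) w(1)])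
    have inv: "Aut_inv C' \<sigma> \<in> Aut L C'" by (rule Aut_inv[OF struct' \<sigma>(1)])
    let ?z = "compose A (type_act (Aut_inv C' \<sigma>)) w"
    have z: "?z \<in> Z2"
      using Z(2) inv w(1) by (simp add: closed_inv_type_maps)
    have "x i \<inter> fmls L (I <+> b) = ?z i \<inter> fmls L (I <+> b)" if i: "i \<in> A" for i
    proof -
      have xi: "x i \<in> S'" and wi: "w i \<in> S'" using xP wP i by auto
      have ri: "r (type_act \<sigma> (x i)) = r (w i)"
        using fun_cong[OF w(2), of i] i by (simp add: compose_eq)
      have "\<phi> \<in> x i \<longleftrightarrow> \<phi> \<in> type_act (Aut_inv C' \<sigma>) (w i)" if \<phi>: "\<phi> \<in> fmls L (I <+> b)" for \<phi>
      proof -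
        have \<phi>C: "\<phi> \<in> fmls L (I <+> univ C')"
          using \<phi> fmls_mono[of "I <+> b" "I <+> univ C'" L] b(2) by auto
        have \<sigma>\<phi>: "param_rename \<sigma> \<phi> \<in> fmls L (I <+> univ C)"
          by (rule param_rename_fmls[OF \<phi> \<sigma>(2)])
        have "\<phi> \<in> x i \<longleftrightarrow> param_rename \<sigma> \<phi> \<in> type_act \<sigma> (x i)"
          by (rule type_act_mem[OF \<sigma>(1) type_spaceD(1)[OF xi] \<phi>C, symmetric])
        also have "\<dots> \<longleftrightarrow> param_rename \<sigma> \<phi> \<in> w i"
          using r_mem[OF \<sigma>\<phi>] ri by metis
        also have "\<dots> \<longleftrightarrow> \<phi> \<in> type_act (Aut_inv C' \<sigma>) (w i)"
          by (rule type_act_inv_mem[OF struct' \<sigma>(1) type_spaceD(1)[OF wi] \<phi>C, symmetric])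
        finally show ?thesis .
      qed
      then show ?thesis using i by (auto simp: compose_eq)
    qed
    then show "\<exists>z\<in>Z2. \<forall>i\<in>A. x i \<inter> fmls L (I <+> b) = z i \<inter> fmls L (I <+> b)"
      using z by blast
  qed
qed

text \<open>
  If \<open>x\<^sub>0\<close> is any tuple of extensions of the types \<open>x\<close>, and \<open>\<sigma>\<close> ranges over automorphisms which fix
  more and more parameters from \<open>C\<close> and move more and more parameters from \<open>C'\<close> into \<open>C\<close>, then every
  cluster point of the tuples \<open>\<sigma>\<^sup>-\<^sup>1 x\<^sub>0\<close> extends \<open>x\<close> without leaving the closed invariant set.
\<close>

lemma lift_point:
  fixes A :: "'j set"
  assumes Z: "cinv A Z" and x: "x \<in> Z"
  shows "\<exists>y\<in>A \<rightarrow>\<^sub>E S'. compose A r y = x \<and>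
    (\<forall>\<tau>\<in>Aut L C'. compose A r (compose A (type_act \<tau>) y) \<in> Z)"
proof -
  let ?P = "product_topology (\<lambda>_. T') A"
  have xP: "x \<in> A \<rightarrow>\<^sub>E S" by (rule cinv_PiE[OF Z x])
  have topP: "topspace ?P = A \<rightarrow>\<^sub>E S'" by (simp add: topspace_stone_topology)
  define x0 where "x0 = (\<lambda>i\<in>A. SOME p. p \<in> S' \<and> r p = x i)"
  have x0: "x0 i \<in> S'" "r (x0 i) = x i" if "i \<in> A" for i
  proof -
    have "\<exists>p. p \<in> S' \<and> r p = x i" using r_onto_ex[of "x i"] PiE_mem[OF xP that] by blast
    from someI_ex[OF this] show "x0 i \<in> S'" "r (x0 i) = x i" using that by (simp_all add: x0_def)
  qed
  have x0P: "x0 \<in> A \<rightarrow>\<^sub>E S'" using x0(1) by (auto simp: x0_def)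
  \<comment> \<open>\<open>Q c b\<close> shrinks as \<open>c\<close> and \<open>b\<close> grow and
    is never empty for finite sets by \<open>Aut_move_into\<close>; this gives the finite
    intersection property.\<close>
  define Q where "Q c b = {compose A (type_act (Aut_inv C' \<sigma>)) x0 |\<sigma>. \<sigma> \<in> Aut L C' \<and> (\<forall>a\<in>c. \<sigma> a = a) \<and> \<sigma> ` b \<subseteq> univ C}" for c b
  have Q_sub: "Q c b \<subseteq> topspace ?P" for c b
    unfolding Q_def topP using compose_act[OF Aut_inv[OF struct'] x0P] by blast
  have Q_ne: "Q c b \<noteq> {}" if "finite c" "c \<subseteq> univ C" "finite b" "b \<subseteq> univ C'" for c b
    using Aut_move_into[OF that] unfolding Q_def by blast
  have Q_mono: "Q c b \<subseteq> Q c' b'" if "c' \<subseteq> c" "b' \<subseteq> b" for c b c' b'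
    using that unfolding Q_def by blast
  define D where "D = {(c, b). finite c \<and> c \<subseteq> univ C \<and> finite b \<and> b \<subseteq> univ C'}"
  define K where "K d = ?P closure_of Q (fst d) (snd d)" for d
  have "topspace ?P \<inter> \<Inter> (K ` D) \<noteq> {}"
  proof -
    have "compact_space ?P" using compact_T' by (simp add: compact_space_product_topology)
    moreover have "(\<forall>k\<in>K ` D. closedin ?P k) \<and> (\<forall>\<F>. finite \<F> \<and> \<F> \<subseteq> K ` D \<longrightarrow> topspace ?P \<inter> \<Inter> \<F> \<noteq> {})"
    proof (intro conjI ballI allI impI)
      fix k assume "k \<in> K ` D" then show "closedin ?P k" by (auto simp: K_def)
    next
      fix \<F> assume "finite \<F> \<and> \<F> \<subseteq> K ` D"
      then obtain D0 where D0: "finite D0" "D0 \<subseteq> D" "\<F> = K ` D0"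
        using finite_subset_image[of \<F> K D] by blast
      let ?c = "\<Union> (fst ` D0)" and ?b = "\<Union> (snd ` D0)"
      have D0D: "finite (fst d)" "fst d \<subseteq> univ C" "finite (snd d)" "snd d \<subseteq> univ C'" if "d \<in> D0" for d
        using subsetD[OF D0(2) that] by (simp_all add: D_def case_prod_unfold)
      have "finite ?c" "?c \<subseteq> univ C" "finite ?b" "?b \<subseteq> univ C'"
        using D0(1) D0D by (blast intro: finite_Union finite_imageI)+
      from Q_ne[OF this] obtain q where q: "q \<in> Q ?c ?b" by blast
      have "q \<in> K d" if "d \<in> D0" for d
      proof -
        have "Q ?c ?b \<subseteq> Q (fst d) (snd d)" using that by (intro Q_mono) auto
        then show ?thesis
          unfolding K_def using q closure_of_subset[OF Q_sub] by blast
      qed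
      moreover have "q \<in> topspace ?P" using Q_sub q by blast
      ultimately have "q \<in> topspace ?P \<inter> \<Inter> \<F>" unfolding D0(3) by blast
      then show "topspace ?P \<inter> \<Inter> \<F> \<noteq> {}" by blast
    qed
    ultimately show ?thesis unfolding compact_space_def compactin_fip by blast
  qed
  then obtain y where yP: "y \<in> A \<rightarrow>\<^sub>E S'" and yK: "\<And>d. d \<in> D \<Longrightarrow> y \<in> K d"
    unfolding topP by blast
  have "compose A r y = x"
  proof (rule PiE_ext[OF compose_r[OF yP] xP])
    fix i assume i: "i \<in> A"
    have yi: "y i \<in> S'" and xi: "x i \<in> S" using yP xP i by auto
    have "x i \<subseteq> r (y i)"
    proof
      fix \<phi> assume \<phi>x: "\<phi> \<in> x i"
      then have \<phi>: "\<phi> \<in> fmls L (I <+> univ C)" using type_spaceD(1)[OF xi] by blast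
      then have \<phi>': "\<phi> \<in> fmls L (I <+> univ C')" using fmls_sub by blast
      obtain c where c: "finite c" "c \<subseteq> univ C" "\<phi> \<in> fmls L (I <+> c)"
        using finite_params[OF \<phi>] .
      have "closedin ?P {w \<in> topspace ?P. w i \<in> {p \<in> S'. \<phi> \<in> p}}"
        by (rule closedin_continuous_map_preimage[OF continuous_map_product_projection[OF i] closedin_stone_basic[OF \<phi>']])
      \<comment> \<open>If \<open>\<sigma>\<close> fixes the parameters of \<open>\<phi>\<close>,
        then \<open>\<phi>\<close> survives in the \<open>i\<close>-th type; this closed condition
        passes to \<open>y\<close>.\<close>
      moreover have "Q c {} \<subseteq> {w \<in> topspace ?P. w i \<in> {p \<in> S'. \<phi> \<in> p}}"
      proof
        fix w assume w: "w \<in> Q c {}"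
        then obtain \<sigma> where \<sigma>: "\<sigma> \<in> Aut L C'" "\<forall>a\<in>c. \<sigma> a = a" "w = compose A (type_act (Aut_inv C' \<sigma>)) x0"
          by (auto simp: Q_def)
        have "param_rename \<sigma> \<phi> = \<phi>" by (rule param_rename_idI[OF c(3)]) (use \<sigma>(2) in auto)
        moreover have "\<phi> \<in> x0 i" using \<phi>x x0(2)[OF i] r_mem[OF \<phi>] by metis
        ultimately have "\<phi> \<in> w i"
          using type_act_inv_mem[OF struct' \<sigma>(1) type_spaceD(1)[OF x0(1)[OF i]] \<phi>'] i
          by (simp add: \<sigma>(3) compose_eq)
        moreover have "w \<in> topspace ?P" using Q_sub w by blast
        moreover from this have "w i \<in> S'" using i unfolding topP by auto
        ultimately show "w \<in> {w \<in> topspace ?P. w i \<in> {p \<in> S'. \<phi> \<in> p}}" by simp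
      qed
      ultimately have "K (c, {}) \<subseteq> {w \<in> topspace ?P. w i \<in> {p \<in> S'. \<phi> \<in> p}}"
        unfolding K_def fst_conv snd_conv by (intro closure_of_minimal)
      moreover have "y \<in> K (c, {})" by (rule yK) (use c in \<open>simp add: D_def\<close>)
      ultimately have "\<phi> \<in> y i" by blast
      then show "\<phi> \<in> r (y i)" using r_mem[OF \<phi>] by simp
    qed
    then show "compose A r y i = x i"
      using type_space_eqI[OF xi r_type[OF yi]] i by (simp add: compose_eq)
  qed
  moreover have "compose A r (compose A (type_act \<tau>) y) \<in> Z" if \<tau>: "\<tau> \<in> Aut L C'" for \<tau>
  proof (rule ccontr)
    let ?PC = "product_topology (\<lambda>_. T) A"
    let ?f = "\<lambda>y. compose A r (compose A (type_act \<tau>) y)"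
    assume notin: "?f y \<notin> Z"
    have fP: "?f w \<in> A \<rightarrow>\<^sub>E S" if "w \<in> A \<rightarrow>\<^sub>E S'" for w
      by (intro compose_r compose_act \<tau> that)
    have "closedin ?PC Z" by (rule closed_inv_closedin[OF Z])
    then have op: "openin ?PC (topspace ?PC - Z)" by blast
    have f_in: "?f y \<in> topspace ?PC - Z"
      using notin fP[OF yP] by (simp add: topspace_stone_topology)
    obtain a W where a: "finite a" "a \<subseteq> univ C" and W: "openin ?PC W" "?f y \<in> W" "W \<subseteq> topspace ?PC - Z"
      and agree: "\<forall>w\<in>W. \<forall>w'\<in>A \<rightarrow>\<^sub>E S. (\<forall>i\<in>A. w i \<inter> fmls L (I <+> a) = w' i \<inter> fmls L (I <+> a)) \<longrightarrow> w' \<in> W"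
      using stone_power_nbhd[OF op f_in] by (elim exE conjE) (rule that)
    have \<tau>i: "Aut_inv C' \<tau> \<in> Aut L C'" by (rule Aut_inv[OF struct' \<tau>])
    \<comment> \<open>Formulas over \<open>a\<close> in \<open>\<tau> w\<close> come from formulas
      over this preimage in \<open>w\<close>, so this is the set to be moved into
      \<open>C\<close>.\<close>
    let ?b = "Aut_inv C' \<tau> ` a"
    have b: "finite ?b" "?b \<subseteq> univ C'" using a univ_sub Aut_in[OF \<tau>i] by auto
    have "continuous_map ?P ?PC ?f" by (rule continuous_restrict_act[OF \<tau>])
    then have opP: "openin ?P {w \<in> topspace ?P. ?f w \<in> W}"
      using W(1) by (rule openin_continuous_map_preimage)
    have y_in: "y \<in> {w \<in> topspace ?P. ?f w \<in> W}" using yP W(2) topP by simp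
    have "y \<in> K ({}, ?b)" by (rule yK) (use b in \<open>simp add: D_def\<close>)
    then have cl: "y \<in> ?P closure_of Q {} ?b" by (simp add: K_def)
    obtain w where w: "w \<in> Q {} ?b" "?f w \<in> W"
      using conjunct2[OF cl[unfolded in_closure_of], THEN spec, THEN mp, OF conjI[OF y_in opP]] by auto
    obtain \<sigma> where \<sigma>: "\<sigma> \<in> Aut L C'" "\<sigma> ` ?b \<subseteq> univ C" "w = compose A (type_act (Aut_inv C' \<sigma>)) x0"
      using w(1) by (auto simp: Q_def)
    \<comment> \<open>\<open>\<theta>\<close> carries \<open>a\<close> into \<open>C\<close>, so
      \<open>Aut_down\<close> replaces it on \<open>a\<close> by an automorphism
      \<open>\<rho>\<close> of \<open>C\<close>. The translate of \<open>x\<close> by the inverse of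
      \<open>\<rho>\<close> lies in \<open>Z\<close> and agrees over \<open>a\<close> with the
      restriction of \<open>\<tau> w\<close>.\<close>
    define \<theta> where "\<theta> = compose (univ C') \<sigma> (Aut_inv C' \<tau>)"
    have \<theta>: "\<theta> \<in> Aut L C'" unfolding \<theta>_def by (rule Aut_compose[OF struct' \<sigma>(1) \<tau>i])
    have \<theta>a: "\<theta> ` a \<subseteq> univ C"
      using \<sigma>(2) a(2) univ_sub by (auto simp: \<theta>_def compose_eq subset_eq)
    obtain \<rho> where \<rho>: "\<rho> \<in> Aut L C" "\<forall>x\<in>a. \<rho> x = \<theta> x"
      using Aut_down[OF a \<theta> \<theta>a] by blast
    let ?z = "compose A (type_act (Aut_inv C \<rho>)) x"
    have z: "?z \<in> Z"
      using Z x Aut_inv[OF struct \<rho>(1)] by (simp add: closed_inv_type_maps)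
    have "?f w i \<inter> fmls L (I <+> a) = ?z i \<inter> fmls L (I <+> a)" if i: "i \<in> A" for i
    proof -
      have xi: "x i \<in> S" using xP i by auto
      have x0F: "x0 i \<subseteq> fmls L (I <+> univ C')" by (rule type_spaceD(1)[OF x0(1)[OF i]])
      have "\<phi> \<in> r (type_act \<tau> (type_act (Aut_inv C' \<sigma>) (x0 i))) \<longleftrightarrow> \<phi> \<in> type_act (Aut_inv C \<rho>) (x i)"
        if \<phi>: "\<phi> \<in> fmls L (I <+> a)" for \<phi>
      proof -
        have \<phi>C: "\<phi> \<in> fmls L (I <+> univ C)"
          using \<phi> fmls_mono[of "I <+> a" "I <+> univ C" L] a(2) by auto
        then have \<phi>C': "\<phi> \<in> fmls L (I <+> univ C')" using fmls_sub by blast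
        define \<psi> where "\<psi> = param_rename (Aut_inv C' \<tau>) \<phi>"
        have \<psi>: "\<psi> \<in> fmls L (I <+> univ C')" and eq: "\<phi> = param_rename \<tau> \<psi>"
          unfolding \<psi>_def using Aut_inv_rename[OF struct' \<tau> \<phi>C'] by simp_all
        have \<sigma>\<psi>: "param_rename \<sigma> \<psi> = param_rename \<rho> \<phi>"
          unfolding \<psi>_def param_rename_comp
          by (rule param_rename_cong[OF \<phi>]) (use \<rho>(2) a(2) univ_sub in \<open>auto simp: \<theta>_def compose_eq subset_eq\<close>)
        have \<rho>\<phi>: "param_rename \<rho> \<phi> \<in> fmls L (I <+> univ C)"
          by (rule param_rename_fmls[OF \<phi>C]) (use Aut_in[OF \<rho>(1)] in auto)
        have "\<phi> \<in> r (type_act \<tau> (type_act (Aut_inv C' \<sigma>) (x0 i))) \<longleftrightarrow>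
            \<phi> \<in> type_act \<tau> (type_act (Aut_inv C' \<sigma>) (x0 i))"
          by (rule r_mem[OF \<phi>C])
        also have "\<dots> \<longleftrightarrow> \<psi> \<in> type_act (Aut_inv C' \<sigma>) (x0 i)"
          unfolding eq
          by (rule type_act_mem[OF \<tau> type_spaceD(1)[OF type_act_type_space[OF struct' \<pi> Aut_inv[OF struct' \<sigma>(1)] x0(1)[OF i]]] \<psi>])
        also have "\<dots> \<longleftrightarrow> param_rename \<sigma> \<psi> \<in> x0 i"
          by (rule type_act_inv_mem[OF struct' \<sigma>(1) x0F \<psi>])
        also have "\<dots> \<longleftrightarrow> param_rename \<rho> \<phi> \<in> x i"
          unfolding \<sigma>\<psi> using r_mem[OF \<rho>\<phi>, of "x0 i"] x0(2)[OF i] by simp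
        also have "\<dots> \<longleftrightarrow> \<phi> \<in> type_act (Aut_inv C \<rho>) (x i)"
          by (rule type_act_inv_mem[OF struct \<rho>(1) type_spaceD(1)[OF xi] \<phi>C, symmetric])
        finally show ?thesis .
      qed
      then show ?thesis using i by (auto simp: compose_eq \<sigma>(3))
    qed
    then have "?z \<in> W"
      using agree w(2) cinv_PiE[OF Z z] by blast
    then show False using W(3) z by blast
  qed
  ultimately show ?thesis using yP by blast
qed

text \<open>The lift is the largest invariant set whose image is contained in \<open>Z\<close>;
  \<open>lift_point\<close> shows that nothing of \<open>Z\<close> is missed.\<close>

lemma lift_cinv:
  fixes A :: "'j set"
  assumes Z: "cinv A Z"
  shows "\<exists>Z'. cinv' A Z' \<and> compose A r ` Z' = Z"
proof -
  let ?P = "product_topology (\<lambda>_. T') A"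
  let ?f = "\<lambda>\<tau> y. compose A r (compose A (type_act \<tau>) y)"
  define Z' where "Z' = {y \<in> A \<rightarrow>\<^sub>E S'. \<forall>\<tau>\<in>Aut L C'. ?f \<tau> y \<in> Z}"
  have id: "(\<lambda>a\<in>univ C'. a) \<in> Aut L C'" by (rule Aut_id[OF struct'])
  have topP: "topspace ?P = A \<rightarrow>\<^sub>E S'" by (simp add: topspace_stone_topology)
  have "Z' = \<Inter> ((\<lambda>\<tau>. {y \<in> topspace ?P. ?f \<tau> y \<in> Z}) ` Aut L C')"
    unfolding topP Z'_def using id by auto
  moreover have "closedin ?P {y \<in> topspace ?P. ?f \<tau> y \<in> Z}" if \<tau>: "\<tau> \<in> Aut L C'" for \<tau>
    by (rule closedin_continuous_map_preimage[OF continuous_restrict_act[OF \<tau>] closed_inv_closedin[OF Z]])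
  ultimately have cl: "closedin ?P Z'"
    using id by (auto intro!: closedin_Inter)
  have "compose A (type_act \<sigma>) y \<in> Z'" if \<sigma>: "\<sigma> \<in> Aut L C'" and y: "y \<in> Z'" for \<sigma> y
    unfolding Z'_def
  proof (intro CollectI conjI ballI)
    have yP: "y \<in> A \<rightarrow>\<^sub>E S'" using y by (simp add: Z'_def)
    show "compose A (type_act \<sigma>) y \<in> A \<rightarrow>\<^sub>E S'" by (rule compose_act[OF \<sigma> yP])
    fix \<tau> assume \<tau>: "\<tau> \<in> Aut L C'"
    have "compose A (type_act \<tau>) (compose A (type_act \<sigma>) y) = compose A (type_act (compose (univ C') \<tau> \<sigma>)) y"
    proof
      fix i
      show "compose A (type_act \<tau>) (compose A (type_act \<sigma>) y) i = compose A (type_act (compose (univ C') \<tau> \<sigma>)) y i"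
        using type_act_compose[OF \<sigma> type_spaceD(1)[of "y i" L I \<pi> C'], of \<tau>] yP
        by (cases "i \<in> A") (auto simp: compose_def)
    qed
    then show "?f \<tau> (compose A (type_act \<sigma>) y) \<in> Z"
      using y Aut_compose[OF struct' \<tau> \<sigma>] by (simp add: Z'_def)
  qed
  then have "cinv' A Z'" using cl by (simp add: closed_inv_type_maps)
  moreover have "compose A r ` Z' = Z"
  proof
    show "compose A r ` Z' \<subseteq> Z"
    proof
      fix w assume "w \<in> compose A r ` Z'"
      then obtain y where y: "y \<in> Z'" "w = compose A r y" by blast
      have "compose A (type_act (\<lambda>a\<in>univ C'. a)) y = y"
      proof
        fix i
        have yP: "y \<in> A \<rightarrow>\<^sub>E S'" using y by (simp add: Z'_def)
        show "compose A (type_act (\<lambda>a\<in>univ C'. a)) y i = y i"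
          using type_act_id[OF type_spaceD(1)[of "y i" L I \<pi> C'], of "\<lambda>a\<in>univ C'. a"] yP
          by (cases "i \<in> A") (auto simp: compose_def)
      qed
      moreover have "?f (\<lambda>a\<in>univ C'. a) y \<in> Z" using y(1) id by (simp add: Z'_def)
      ultimately show "w \<in> Z" using y(2) by simp
    qed
    show "Z \<subseteq> compose A r ` Z'"
    proof
      fix x assume x: "x \<in> Z"
      from lift_point[OF Z x] obtain y where "y \<in> Z'" "compose A r y = x"
        by (auto simp: Z'_def)
      then show "x \<in> compose A r ` Z'" by blast
    qed
  qed
  ultimately show ?thesis by blast
qed

theorem type_space_corresp:
  "flow_corresp T' (type_maps L I \<pi> C') T (type_maps L I \<pi> C) r (A :: 'j set)"
  unfolding flow_corresp_def
  by (intro conjI allI impI; (rule image_cinv lift_cinv subset_cinv; assumption))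

end

section \<open>Quotients of type spaces\<close>

locale type_quotient =
  fixes L :: "('f, 'p) lang" and I :: "'i set" and \<pi> :: "('f, 'p, 'i + 'a) fm set"
    and M :: "('f, 'p, 'a) struct" and F :: "('f, 'p, 'i + 'a) fm set rel"
  assumes struct: "is_struct L M" and \<pi>: "\<pi> \<subseteq> fmls L (I <+> {})"
    and F: "closed_invariant_equiv L I \<pi> M F"
begin

abbreviation "S \<equiv> type_space L I \<pi> M"
abbreviation "T \<equiv> stone_topology L I \<pi> M"
abbreviation "\<Phi> \<equiv> type_flow L I \<pi> M F"
abbreviation "cls \<equiv> \<lambda>p. F `` {p}"

lemma equiv_F: "equiv S F"
  using F by (simp add: closed_invariant_equiv_def)

lemma F_sub: "F \<subseteq> S \<times> S"
  using equiv_F by (auto simp: equiv_def refl_on_def)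

lemma F_inv: "\<sigma> \<in> Aut L M \<Longrightarrow> (p, q) \<in> F \<Longrightarrow> (type_act \<sigma> p, type_act \<sigma> q) \<in> F"
  using F by (auto simp: closed_invariant_equiv_def)

lemma S_fmls: "p \<in> S \<Longrightarrow> p \<subseteq> fmls L (I <+> univ M)"
  by (rule type_spaceD(1))

lemma act_S: "\<sigma> \<in> Aut L M \<Longrightarrow> p \<in> S \<Longrightarrow> type_act \<sigma> p \<in> S"
  by (rule type_act_type_space[OF struct \<pi>])

text \<open>\<open>F_inv\<close> for \<open>\<sigma>\<close> gives one inclusion, and for the
  inverse of \<open>\<sigma>\<close> the other.\<close>

lemma act_class:
  assumes \<sigma>: "\<sigma> \<in> Aut L M" and p: "p \<in> S"
  shows "type_act \<sigma> ` cls p = cls (type_act \<sigma> p)"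
proof
  show "type_act \<sigma> ` cls p \<subseteq> cls (type_act \<sigma> p)"
    using F_inv[OF \<sigma>] by blast
  show "cls (type_act \<sigma> p) \<subseteq> type_act \<sigma> ` cls p"
  proof
    fix q assume "q \<in> cls (type_act \<sigma> p)"
    then have q: "(type_act \<sigma> p, q) \<in> F" by simp
    then have qS: "q \<in> S" using F_sub by blast
    have "(type_act (Aut_inv M \<sigma>) (type_act \<sigma> p), type_act (Aut_inv M \<sigma>) q) \<in> F"
      by (rule F_inv[OF Aut_inv[OF struct \<sigma>] q])
    then have "type_act (Aut_inv M \<sigma>) q \<in> cls p"
      using type_act_inv_left[OF \<sigma> S_fmls[OF p]] by simp
    moreover have "type_act \<sigma> (type_act (Aut_inv M \<sigma>) q) = q"
    proof -
      have "type_act \<sigma> (type_act (Aut_inv M \<sigma>) q) = type_act (\<sigma> \<circ> Aut_inv M \<sigma>) q"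
        unfolding type_act_def image_image param_rename_comp ..
      then show ?thesis
        using type_act_id[OF S_fmls[OF qS], of "\<sigma> \<circ> Aut_inv M \<sigma>"] Aut_inv_right[OF \<sigma>] by simp
    qed
    ultimately show "q \<in> type_act \<sigma> ` cls p" by (metis imageI)
  qed
qed

lemma carrier: "flow_carrier \<Phi> = S // F"
  by (simp add: flow_carrier_def type_flow_def topspace_quotient_topology topspace_stone_topology)

lemma maps: "flow_maps \<Phi> = (\<lambda>\<sigma>. \<lambda>c\<in>S // F. type_act \<sigma> ` c) ` Aut L M"
  by (simp add: flow_maps_def carrier) (simp add: type_flow_def)

lemma space: "flow_space \<Phi> = quotient_topology (T) F"
  by (simp add: type_flow_def)

lemma class_in: "p \<in> S \<Longrightarrow> cls p \<in> S // F"
  by (rule quotientI)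

lemma map_class: "\<sigma> \<in> Aut L M \<Longrightarrow> p \<in> S \<Longrightarrow> (\<lambda>c\<in>S // F. type_act \<sigma> ` c) (cls p) = cls (type_act \<sigma> p)"
  by (simp add: class_in act_class)

lemma cont_class: "continuous_map (T) (flow_space \<Phi>) cls"
  unfolding space by (rule continuous_map_quotient_topology)

lemma class_onto: "cls ` S = S // F"
  by (auto simp: quotient_def)

lemma quotient_map_class: "quotient_map (T) (flow_space \<Phi>) cls"
  unfolding quotient_map_def space
  by (auto simp: topspace_quotient_topology topspace_stone_topology class_onto openin_quotient_topology)

lemma compact_stone': "compact_space (T)"
  using fmls_mono[of "I <+> {}" "I <+> univ M" L] \<pi> by (intro compact_stone) auto

lemma Hausdorff_flow: "Hausdorff_space (flow_space \<Phi>)"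
  unfolding space
proof (rule Hausdorff_quotient_topology[OF compact_stone' Hausdorff_stone])
  show "equiv (topspace (T)) F" by (simp add: topspace_stone_topology equiv_F)
  show "closedin (prod_topology (T) (T)) F"
    using F by (simp add: closed_invariant_equiv_def)
qed

sublocale flow_quotient T "type_maps L I \<pi> M" "flow_space \<Phi>" "flow_maps \<Phi>" cls
proof
  show "type_maps L I \<pi> M \<subseteq> topspace (T) \<rightarrow> topspace (T)"
    using act_S by (auto simp: type_maps_def topspace_stone_topology)
  show "cls ` topspace (T) = topspace (flow_space \<Phi>)"
    by (simp add: space topspace_quotient_topology topspace_stone_topology class_onto)
next
  fix h assume "h \<in> type_maps L I \<pi> M"
  then obtain \<sigma> where \<sigma>: "\<sigma> \<in> Aut L M" "h = restrict (type_act \<sigma>) S" by (auto simp: type_maps_def)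
  then show "\<exists>k\<in>flow_maps \<Phi>. \<forall>y\<in>topspace (T). k (cls y) = cls (h y)"
    unfolding maps topspace_stone_topology using map_class[OF \<sigma>(1)]
    by (intro bexI[of _ "\<lambda>c\<in>S // F. type_act \<sigma> ` c"]) auto
next
  fix k assume "k \<in> flow_maps \<Phi>"
  then obtain \<sigma> where \<sigma>: "\<sigma> \<in> Aut L M" "k = (\<lambda>c\<in>S // F. type_act \<sigma> ` c)" by (auto simp: maps)
  then show "\<exists>h\<in>type_maps L I \<pi> M. \<forall>y\<in>topspace (T). k (cls y) = cls (h y)"
    unfolding type_maps_def topspace_stone_topology using map_class[OF \<sigma>(1)]
    by (intro bexI[of _ "restrict (type_act \<sigma>) S"]) auto
qed (fact compact_stone' Hausdorff_flow cont_class)+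

sublocale compact_flow \<Phi>
proof
  show "compact_space (flow_space \<Phi>)"
    using image_compactin[OF compact_stone'[unfolded compact_space_def] cont_class] onto
    by (simp add: compact_space_def)
  show "Hausdorff_space (flow_space \<Phi>)" by (rule Hausdorff_flow)
next
  fix h assume "h \<in> flow_maps \<Phi>"
  then obtain \<sigma> where \<sigma>: "\<sigma> \<in> Aut L M" "h = (\<lambda>c\<in>S // F. type_act \<sigma> ` c)" by (auto simp: maps)
  have "continuous_map (T) (flow_space \<Phi>) (cls \<circ> type_act \<sigma>)"
    by (rule continuous_map_compose[OF continuous_type_act[OF struct \<pi> \<sigma>(1)] cont_class])
  then have "continuous_map (T) (flow_space \<Phi>) (h \<circ> cls)"
    by (rule continuous_map_eq) (simp add: topspace_stone_topology \<sigma>(2) class_in act_class[OF \<sigma>(1)])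
  then show "continuous_map (flow_space \<Phi>) (flow_space \<Phi>) h"
    by (rule continuous_compose_quotient_map[OF quotient_map_class])
next
  have id: "(\<lambda>a\<in>univ M. a) \<in> Aut L M" by (rule Aut_id[OF struct])
  have "(\<lambda>c\<in>S // F. type_act (\<lambda>a\<in>univ M. a) ` c) = (\<lambda>y\<in>S // F. y)"
  proof
    fix c
    show "(\<lambda>c\<in>S // F. type_act (\<lambda>a\<in>univ M. a) ` c) c = (\<lambda>y\<in>S // F. y) c"
    proof (cases "c \<in> S // F")
      case True
      then obtain p where p: "p \<in> S" "c = cls p" by (auto simp: quotient_def)
      have "type_act (\<lambda>a\<in>univ M. a) p = p" by (rule type_act_id[OF S_fmls[OF p(1)]]) simp
      then show ?thesis using map_class[OF id p(1)] True p(2) by simp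
    qed simp
  qed
  then show "(\<lambda>y\<in>flow_carrier \<Phi>. y) \<in> flow_maps \<Phi>"
    unfolding carrier maps using id by (metis (no_types, lifting) imageI)
next
  fix g h assume "g \<in> flow_maps \<Phi>" "h \<in> flow_maps \<Phi>"
  then obtain \<sigma> \<tau> where \<sigma>: "\<sigma> \<in> Aut L M" "g = (\<lambda>c\<in>S // F. type_act \<sigma> ` c)"
    and \<tau>: "\<tau> \<in> Aut L M" "h = (\<lambda>c\<in>S // F. type_act \<tau> ` c)" by (auto simp: maps)
  let ?\<rho> = "compose (univ M) \<sigma> \<tau>"
  have \<rho>: "?\<rho> \<in> Aut L M" by (rule Aut_compose[OF struct \<sigma>(1) \<tau>(1)])
  have "compose (S // F) g h = (\<lambda>c\<in>S // F. type_act ?\<rho> ` c)"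
  proof
    fix c
    show "compose (S // F) g h c = (\<lambda>c\<in>S // F. type_act ?\<rho> ` c) c"
    proof (cases "c \<in> S // F")
      case True
      then obtain p where p: "p \<in> S" "c = cls p" by (auto simp: quotient_def)
      have "compose (S // F) g h c = g (h (cls p))" using True p by (simp add: compose_eq)
      also have "\<dots> = cls (type_act \<sigma> (type_act \<tau> p))"
        unfolding \<sigma>(2) \<tau>(2) map_class[OF \<tau>(1) p(1)] by (rule map_class[OF \<sigma>(1) act_S[OF \<tau>(1) p(1)]])
      also have "\<dots> = (\<lambda>c\<in>S // F. type_act ?\<rho> ` c) c"
        unfolding p(2) map_class[OF \<rho> p(1)] type_act_compose[OF \<tau>(1) S_fmls[OF p(1)]] ..
      finally show ?thesis .
    qed (simp add: compose_def)
  qed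
  then show "compose (flow_carrier \<Phi>) g h \<in> flow_maps \<Phi>"
    unfolding carrier maps using \<rho> by (metis (no_types, lifting) imageI)
qed

end

section \<open>Compatibility of the quotients and the isomorphism of Ellis groups\<close>

theorem theorem3p2:
  fixes L :: "('f, 'p) lang"
    and T :: "('f, 'p, unit) fm set"
    and I :: "'i set"
    and \<pi> :: "('f, 'p, 'i + 'a) fm set"
    and C C' :: "('f, 'p, 'a) struct"
    and F F' :: "('f, 'p, 'i + 'a) fm set rel"
    and \<M> \<M>' :: "(('f, 'p, 'i + 'a) fm set set \<Rightarrow> ('f, 'p, 'i + 'a) fm set set) set"
    and u u' :: "('f, 'p, 'i + 'a) fm set set \<Rightarrow> ('f, 'p, 'i + 'a) fm set set"
  defines "\<Phi> \<equiv> type_flow L I \<pi> C F"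
    and "\<Phi>' \<equiv> type_flow L I \<pi> C' F'"
  assumes "complete_theory L T"
    and "is_model L T C" and "is_model L T C'"
    and "elementary_substruct L C C'"
    and "partial_type L C I {} \<pi>"
    and "saturated natLeq L C" and "strongly_homogeneous natLeq L C"
    and "saturated natLeq L C'" and "strongly_homogeneous natLeq L C'"
    and "closed_invariant_equiv L I \<pi> C F"
    and "closed_invariant_equiv L I \<pi> C' F'"
    and "{(type_restrict L I C a, type_restrict L I C b) | a b. (a, b) \<in> F'} = F"
    and "minimal_left_ideal \<Phi> \<M>" and "u \<in> \<M>" and "ellis_mult \<Phi> u u = u"
    and "minimal_left_ideal \<Phi>' \<M>'" and "u' \<in> \<M>'" and "ellis_mult \<Phi>' u' u' = u'"
  shows "\<exists>h. h \<in> iso (ellis_group \<Phi>' \<M>' u') (ellis_group \<Phi> \<M> u) \<and>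
     homeomorphic_map (tau_topology \<Phi>' \<M>' u') (tau_topology \<Phi> \<M> u) h"
proof -
  have struct: "is_struct L C" "is_struct L C'"
    using assms(4,5) by (auto simp: is_model_def)
  have \<pi>: "\<pi> \<subseteq> fmls L (I <+> {})"
    using assms(7) by (simp add: partial_type_def)
  interpret ext: type_space_extension L C C' I \<pi>
    by unfold_locales (fact struct assms \<pi>)+
  interpret low: type_quotient L I \<pi> C F
    by unfold_locales (fact struct assms \<pi>)+
  interpret high: type_quotient L I \<pi> C' F'
    by unfold_locales (fact struct assms \<pi>)+
  let ?r = "type_restrict L I C"
  \<comment> \<open>All restrictions of members of an \<open>F'\<close>-class lie in one
    \<open>F\<close>-class; the relational image yields that class without choosing a
    representative.\<close>
  define \<rho> where "\<rho> c = F `` (?r ` c)" for c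
  have compat: "(a, b) \<in> F \<longleftrightarrow> (\<exists>a' b'. (a', b') \<in> F' \<and> ?r a' = a \<and> ?r b' = b)" for a b
    unfolding assms(14)[symmetric] by blast
  have \<rho>: "\<rho> (F' `` {p}) = F `` {?r p}" if p: "p \<in> type_space L I \<pi> C'" for p
  proof -
    have "(p, p) \<in> F'" using high.equiv_F p by (auto simp: equiv_def refl_on_def)
    moreover have "F `` {?r q} = F `` {?r p}" if "(p, q) \<in> F'" for q
      using equiv_class_eq[OF low.equiv_F, of "?r p" "?r q"] compat that by blast
    ultimately show ?thesis unfolding \<rho>_def by blast
  qed
  interpret q: compatible_quotients ext.T "type_maps L I \<pi> C" "flow_space \<Phi>" "flow_maps \<Phi>" "\<lambda>p. F `` {p}"
    ext.T' "type_maps L I \<pi> C'" "flow_space \<Phi>'" "flow_maps \<Phi>'" "\<lambda>p. F' `` {p}" ?r \<rho>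
    unfolding \<Phi>_def \<Phi>'_def
  proof unfold_locales
    show "?r ` topspace (ext.T') = topspace (ext.T)"
      by (simp add: topspace_stone_topology ext.r_onto)
    fix p assume "p \<in> topspace (ext.T')"
    then show "\<rho> (F' `` {p}) = F `` {?r p}" by (simp add: topspace_stone_topology \<rho>)
  next
    fix a b assume ab: "a \<in> topspace (ext.T)" "b \<in> topspace (ext.T)" "F `` {a} = F `` {b}"
    then have "(a, b) \<in> F"
      using eq_equiv_class[OF ab(3) low.equiv_F] by (simp add: topspace_stone_topology)
    then obtain a' b' where ab': "(a', b') \<in> F'" "?r a' = a" "?r b' = b" using compat by blast
    moreover have "F' `` {a'} = F' `` {b'}" by (rule equiv_class_eq[OF high.equiv_F ab'(1)])
    moreover have "a' \<in> topspace (ext.T')" "b' \<in> topspace (ext.T')"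
      using high.F_sub ab'(1) by (auto simp: topspace_stone_topology)
    ultimately show "\<exists>a'\<in>topspace (ext.T'). \<exists>b'\<in>topspace (ext.T').
        F' `` {a'} = F' `` {b'} \<and> ?r a' = a \<and> ?r b' = b"
      by blast
  qed
  have "ellis_ideal \<Phi> \<M> u"
    using low.compact_flow_axioms assms(15-17)
    by (simp add: ellis_ideal_def ellis_ideal_axioms_def \<Phi>_def ellis_mult_def)
  moreover have "ellis_ideal \<Phi>' \<M>' u'"
    using high.compact_flow_axioms assms(18-20)
    by (simp add: ellis_ideal_def ellis_ideal_axioms_def \<Phi>'_def ellis_mult_def)
  moreover have "\<rho> \<in> flow_carrier \<Phi>' \<rightarrow> flow_carrier \<Phi>"
  proof
    fix c assume "c \<in> flow_carrier \<Phi>'"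
    then obtain p where "p \<in> type_space L I \<pi> C'" "c = F' `` {p}"
      by (auto simp: \<Phi>'_def high.carrier quotient_def)
    then show "\<rho> c \<in> flow_carrier \<Phi>"
      by (simp add: \<rho> \<Phi>_def low.carrier low.class_in ext.r_type)
  qed
  \<comment> \<open>\<open>ext.type_space_corresp\<close> holds for every index set, hence for the
    three powers required here and for the doubles that \<open>q.flow_corresp_quotient\<close> asks
    for.\<close>
  ultimately interpret ideals: corresponding_ellis_ideals \<Phi> \<M> u \<Phi>' \<M>' u' \<rho>
    by (intro corresponding_ellis_ideals.intro corresponding_ellis_ideals_axioms.intro
        q.flow_corresp_quotient ext.type_space_corresp)
  show ?thesis
    using ideals.ellis_groups_isomorphic by blast
qed

end
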